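(* Let $Q:(\mathbb{Z}^N)^\vee\to L^\vee$ be any toric GIT problem (not necessarily Calabi–Yau), let $C$ be a chamber of its GKZ stratification, and let $H\subset L^\vee_{\mathbb{R}}$ be a relevant subspace. Let $Q_{/H}$ be the Coulomb problem of $H$, let $C/H$ be the chamber of the GKZ stratification of $Q_{/H}$ which is the image of $C$ under the quotient map $L^\vee_{\mathbb{R}}\to L^\vee_{\mathbb{R}}/H$, let $X_{C/H}$ be the corresponding phase of $Q_{/H}$, and let $Z_{H/H}$ (a point) be the semi-orthogonal component attached to the relevant subspace $H/H=\{0\}$ of $L^\vee_{\mathbb{R}}/H$ in the problem $Q_{/H}$. Then the semi-orthogonal decomposition multiplicities satisfy $$[X_C: Z_H]=[X_{C/H}: Z_{H/H}],$$ where the left side is computed in the problem $Q$ and the right side in the problem $Q_{/H}$.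
   Context: **Toric GIT problem.** $L$ is a lattice of rank $k$, $Q^\vee:L\to\mathbb{Z}^N$ is an injective homomorphism, and $Q:(\mathbb{Z}^N)^\vee\to L^\vee$ is its dual (so $Q$ has finite cokernel). Put $q_i=Q(e_i^\vee)$, where $e_1^\vee,\dots,e_N^\vee$ is the standard basis, and $[N]=\{1,\dots,N\}$. The torus $T=L\otimes\mathbb{C}^*$ acts on $V=\mathbb{C}^N$ with weights $q_1,\dots,q_N$. Write $\det V=\sum_i q_i\in L^\vee$ and $L^\vee_{\mathbb{R}}=L^\vee\otimes\mathbb{R}$. **GKZ stratification.** Two points of $L^\vee_{\mathbb{R}}$ are in the same stratum iff they lie in $Q_{\mathbb{R}}(\tau)$ for the same set of closed faces $\tau$ of $(\mathbb{R}^N_{\ge0})^\vee$. Top-dimensional strata are called chambers, codimension-one strata walls. If $\mathrm{cone}(q_1,\dots,q_N)\neq L^\vee_{\mathbb{R}}$, its complement is one stratum, called the empty chamber. For $c\in L^\vee_{\mathbb{R}}$ the phase is the quotient stack $X_c=[(\mathbb{C}^N)^{ss}_c/T]$, where $z\in(\mathbb{C}^N)_c^{ss}$ iff $c\in\mathrm{cone}(q_i: z_i\ne0)$. It depends only on the stratum $C\ni c$ and is denoted $X_C$ (so $X_C=\emptyset$ for the empty chamber). **Subspaces.** For a linear subspace $H\subset L^\vee_{\mathbb{R}}$ let $[N]_H=\{i:q_i\in H\}$. $H$ is weight supported if $H=\mathrm{span}_{\mathbb{R}}\{q_i: i\in[N]_H\}$, and relevant if moreover there are $c_i>0$ $(i\in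 [N]_H)$ with $\sum_{i\in[N]_H}c_iq_i=0$; equivalently $H=\mathrm{cone}(q_i:q_i\in H)$. For weight supported $H$, the Higgs problem is $Q_H:(\mathbb{Z}^{[N]_H})^\vee\to L^\vee\cap H$, $e_i^\vee\mapsto q_i$, and the Coulomb problem is $Q_{/H}:(\mathbb{Z}^{[N]\setminus[N]_H})^\vee\to L^\vee/(L^\vee\cap H)$, $e_i^\vee\mapsto q_i \bmod H$. It is known that, for relevant $H$, the quotient map $L^\vee_{\mathbb{R}}\to L^\vee_{\mathbb{R}}/H$ sends each GKZ stratum of $Q$ to a GKZ stratum of $Q_{/H}$, and chambers to chambers. **Minimal phases and $Z$'s.** A chamber is minimal if its closure contains $-\det V$; its phase is a minimal phase (unique up to derived equivalence, possibly empty). For $H$ relevant, $Z_H$ denotes the (non-empty) minimal phase of the Higgs problem $Q_H$. For a wall $W$ with $H_W=\mathrm{span}_{\mathbb{R}}(W)$ (which is weight supported if $W$ lies in the support), $Z_W$ denotes the phase of the Higgs problem $Q_{H_W}$ for the chamber of $Q_{H_W}$ containing $W$. Let $\lambda_W\in L$ be a primitive vector with $\lambda_W\perp W$ and $d_W=|\langle\lambda_W,\det V\rangle|$. **SOD multiplicity.** $\mathrm{Coh}$ denotes the bounded derived category of coherent sheaves. If $W$ separates chambers $C_+,C_-$ with $d_W>0$ and $\det V$ pointing to the $C_+$ side, there is a semi-orthogonal decomposition (SOD) $\mathrm{Coh}(X_{C_+})=\langle \mathrm{Coh}(X_{C_-}),\mathrm{Coh}(Z_W),\dots,\mathrm{Coh}(Z_W)\rangle$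 with $d_W$ copies of $\mathrm{Coh}(Z_W)$. Starting from a generic $c\in C$ and following the ray $c-t\det V$, $t\ge0$ (which crosses only walls and ends in a minimal chamber), and then repeating the procedure for each $Z_W$ inside $Q_{H_W}$, one gets a complete SOD of $\mathrm{Coh}(X_C)$ whose components are $\mathrm{Coh}(Z_{H'})$ for relevant subspaces $H'$. The multiplicity $[X_C:Z_{H}]$ is the number of components labelled by $H$; it is known (Kite–Segal) to be independent of choices. Explicitly, with $W$ ranging over the walls crossed by the ray, $$[X_C:Z_H]=\delta_{H,L^\vee_{\mathbb{R}}}+\sum_{W:\ H\subset \mathrm{span}_{\mathbb R} W} d_W\,[Z_W:Z_H],$$ where $[Z_W:Z_H]$ is the multiplicity in the problem $Q_{H_W}$. (All multiplicities are $0$ when $C$ is the empty chamber.) *)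

theory Defs
  imports "HOL-Analysis.Analysis" "HOL-Library.Multiset"
begin

text \<open>
  Lattices live inside a Euclidean space, which serves only as an ambient real vector space.
  The record stores the lattice \<open>L\<^sup>\<or>\<close> (\<open>dlat\<close>), the finite index set \<open>[N]\<close> (\<open>idx\<close>) and the
  weights \<open>q\<^sub>i\<close> (\<open>wt\<close>); \<open>L\<^sup>\<or>\<otimes>\<real>\<close> is the real span of \<open>dlat\<close>. The lattice need not have full rank
  in the ambient space, so that Higgs problems live in the same type as the original problem.
\<close>

record ('i, 'v) toric_git =
  dlat :: "'v set"
  idx :: "'i set"
  wt :: "'i \<Rightarrow> 'v"

definition is_lattice :: "'v::euclidean_space set \<Rightarrow> bool" where
  "is_lattice \<Lambda> \<longleftrightarrow>
     (\<exists>B. finite B \<and> independent B \<and> \<Lambda> = {\<Sum>b\<in>B. of_int (n b) *\<^sub>R b | n :: 'v \<Rightarrow> int. True})"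

definition amb :: "('i, 'v::euclidean_space) toric_git \<Rightarrow> 'v set" where
  "amb Q = span (dlat Q)"

text \<open>
  The lattice \<open>L = Hom(L\<^sup>\<or>, \<int>)\<close>: every integral functional on \<open>dlat\<close> is the inner product with a
  unique vector of \<open>amb\<close>, and we identify the two.
\<close>

definition lat :: "('i, 'v::euclidean_space) toric_git \<Rightarrow> 'v set" where
  "lat Q = {l \<in> amb Q. \<forall>x\<in>dlat Q. l \<bullet> x \<in> \<int>}"

text \<open>The last condition says that \<open>Q\<^sup>\<or> : L \<rightarrow> \<int>\<^sup>N\<close> is injective.\<close>

definition toric_git_problem :: "('i, 'v::euclidean_space) toric_git \<Rightarrow> bool" where
  "toric_git_problem Q \<longleftrightarrow>
     is_lattice (dlat Q) \<and> finite (idx Q) \<and> wt Q ` idx Q \<subseteq> dlat Q \<and>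
     inj_on (\<lambda>l. restrict (\<lambda>i. l \<bullet> wt Q i) (idx Q)) (lat Q)"

definition det_wt :: "('i, 'v::euclidean_space) toric_git \<Rightarrow> 'v" where
  "det_wt Q = (\<Sum>i\<in>idx Q. wt Q i)"


text \<open>
  The closed faces of the orthant correspond to the subsets \<open>S\<close> of the index set;
  \<open>wcone Q S\<close> is the image of the face \<open>S\<close> under \<open>Q\<^sub>\<real>\<close>.
\<close>

definition wcone :: "('i, 'v::euclidean_space) toric_git \<Rightarrow> 'i set \<Rightarrow> 'v set" where
  "wcone Q S = {\<Sum>i\<in>S. t i *\<^sub>R wt Q i | t. \<forall>i\<in>S. 0 \<le> t i}"

definition gkz_strata :: "('i, 'v::euclidean_space) toric_git \<Rightarrow> 'v set set" where
  "gkz_strata Q = amb Q //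
     {(x, y). x \<in> amb Q \<and> y \<in> amb Q \<and> (\<forall>S\<subseteq>idx Q. x \<in> wcone Q S \<longleftrightarrow> y \<in> wcone Q S)}"

text \<open>Strata are relatively open in their linear span, so their dimension is \<open>dim\<close>.\<close>

definition gkz_chamber :: "('i, 'v::euclidean_space) toric_git \<Rightarrow> 'v set \<Rightarrow> bool" where
  "gkz_chamber Q C \<longleftrightarrow> C \<in> gkz_strata Q \<and> dim C = dim (amb Q)"

definition gkz_wall :: "('i, 'v::euclidean_space) toric_git \<Rightarrow> 'v set \<Rightarrow> bool" where
  "gkz_wall Q W \<longleftrightarrow> W \<in> gkz_strata Q \<and> dim W + 1 = dim (amb Q)"


definition idx_in :: "('i, 'v::euclidean_space) toric_git \<Rightarrow> 'v set \<Rightarrow> 'i set" where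
  "idx_in Q H = {i \<in> idx Q. wt Q i \<in> H}"

definition weight_supported :: "('i, 'v::euclidean_space) toric_git \<Rightarrow> 'v set \<Rightarrow> bool" where
  "weight_supported Q H \<longleftrightarrow> H = span (wt Q ` idx_in Q H)"

definition relevant :: "('i, 'v::euclidean_space) toric_git \<Rightarrow> 'v set \<Rightarrow> bool" where
  "relevant Q H \<longleftrightarrow> weight_supported Q H \<and>
     (\<exists>c. (\<forall>i\<in>idx_in Q H. c i > (0::real)) \<and> (\<Sum>i\<in>idx_in Q H. c i *\<^sub>R wt Q i) = 0)"

definition higgs :: "('i, 'v::euclidean_space) toric_git \<Rightarrow> 'v set \<Rightarrow> ('i, 'v) toric_git" where
  "higgs Q H = \<lparr> dlat = dlat Q \<inter> H, idx = idx_in Q H, wt = wt Q \<rparr>"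

text \<open>
  A linear map \<open>\<pi>\<close> whose kernel on \<open>amb Q\<close> is \<open>H\<close> realises the quotient map from \<open>amb Q\<close> onto
  \<open>amb Q / H \<cong> \<pi> ` amb Q\<close>, and \<open>\<pi> ` dlat Q \<cong> dlat Q / (dlat Q \<inter> H)\<close>.
\<close>

definition realises_quotient ::
  "('i, 'v::euclidean_space) toric_git \<Rightarrow> 'v set \<Rightarrow> ('v \<Rightarrow> 'w::euclidean_space) \<Rightarrow> bool" where
  "realises_quotient Q H \<pi> \<longleftrightarrow> linear \<pi> \<and> {v \<in> amb Q. \<pi> v = 0} = H"

definition coulomb ::
  "('v \<Rightarrow> 'w) \<Rightarrow> ('i, 'v::euclidean_space) toric_git \<Rightarrow> 'v set
     \<Rightarrow> ('i, 'w::euclidean_space) toric_git" where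
  "coulomb \<pi> Q H = \<lparr> dlat = \<pi> ` dlat Q, idx = idx Q - idx_in Q H, wt = \<pi> \<circ> wt Q \<rparr>"


definition primitive :: "('i, 'v::euclidean_space) toric_git \<Rightarrow> 'v \<Rightarrow> bool" where
  "primitive Q l \<longleftrightarrow> l \<in> lat Q \<and> l \<noteq> 0 \<and>
     (\<forall>m\<in>lat Q. \<forall>n::int. l = of_int n *\<^sub>R m \<longrightarrow> \<bar>n\<bar> = 1)"

text \<open>A primitive vector orthogonal to a wall is unique up to sign.\<close>

definition wall_degree :: "('i, 'v::euclidean_space) toric_git \<Rightarrow> 'v set \<Rightarrow> nat" where
  "wall_degree Q W =
     (THE d. \<exists>l. primitive Q l \<and> (\<forall>w\<in>W. l \<bullet> w = 0) \<and> real d = \<bar>l \<bullet> det_wt Q\<bar>)"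

definition ray :: "('i, 'v::euclidean_space) toric_git \<Rightarrow> 'v \<Rightarrow> 'v set" where
  "ray Q c = {c - t *\<^sub>R det_wt Q | t. t \<ge> 0}"

definition generic_start :: "('i, 'v::euclidean_space) toric_git \<Rightarrow> 'v \<Rightarrow> bool" where
  "generic_start Q c \<longleftrightarrow>
     (\<forall>S\<in>gkz_strata Q. S \<inter> ray Q c \<noteq> {} \<longrightarrow> gkz_chamber Q S \<or> gkz_wall Q S)"

definition crossed_walls :: "('i, 'v::euclidean_space) toric_git \<Rightarrow> 'v \<Rightarrow> 'v set set" where
  "crossed_walls Q c = {W. gkz_wall Q W \<and> W \<inter> ray Q c \<noteq> {}}"

text \<open>
  \<open>complete_sod Q C M\<close>: some run of the wall-crossing procedure, started in the chamber \<open>C\<close>,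
  produces a complete semi-orthogonal decomposition of the phase \<open>X\<^sub>C\<close> in which the components
  are labelled by the subspaces in the multiset \<open>M\<close> (a label \<open>H\<close> standing for \<open>Z\<^sub>H\<close>). Phases are
  represented by their chambers. Every crossed wall \<open>W\<close> contributes \<open>d\<^sub>W\<close> copies of a
  decomposition of \<open>Z\<^sub>W\<close>, the phase of the Higgs problem of \<open>span W\<close> for its chamber \<open>Z W\<close>
  containing \<open>W\<close>. The minimal phase at the end of the ray is the component labelled by
  \<open>L\<^sup>\<or>\<otimes>\<real>\<close>; it is non-empty iff \<open>L\<^sup>\<or>\<otimes>\<real>\<close> is relevant. The generic starting point is chosen anew
  for each occurring phase.
\<close>

inductive complete_sod ::
  "('i, 'v::euclidean_space) toric_git \<Rightarrow> 'v set \<Rightarrow> 'v set multiset \<Rightarrow> bool" where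
  sod_empty: "complete_sod Q C {#}"
    if "gkz_chamber Q C" "C \<inter> wcone Q (idx Q) = {}"
| sod_cross: "complete_sod Q C
      ((if relevant Q (amb Q) then {#amb Q#} else {#}) +
       (\<Sum>W\<in>crossed_walls Q c. repeat_mset (wall_degree Q W) (M W)))"
    if "gkz_chamber Q C" "C \<subseteq> wcone Q (idx Q)" "c \<in> C" "generic_start Q c"
       "\<And>W. W \<in> crossed_walls Q c \<Longrightarrow>
          gkz_chamber (higgs Q (span W)) (Z W) \<and> W \<subseteq> Z W \<and>
          complete_sod (higgs Q (span W)) (Z W) (M W)"

text \<open>
  The multiplicity \<open>[X\<^sub>C : Z\<^sub>H]\<close>. The definite description is meaningful because the number of
  components labelled by \<open>H\<close> does not depend on the choices made (Kite--Segal).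
\<close>

definition sod_mult :: "('i, 'v::euclidean_space) toric_git \<Rightarrow> 'v set \<Rightarrow> 'v set \<Rightarrow> nat" where
  "sod_mult Q C H = (THE n. \<exists>M. complete_sod Q C M \<and> n = count M H)"


text \<open>The recursive formula for the multiplicities, along any run of the procedure.\<close>

lemma complete_sod_labels: "complete_sod Q C M \<Longrightarrow> H \<in># M \<Longrightarrow> H \<subseteq> amb Q"
proof (induction rule: complete_sod.induct)
  case (sod_empty Q C)
  then show ?case by simp
next
  case (sod_cross Q C c Z M)
  show ?case
  proof (cases "H = amb Q")
    case False
    let ?S = "\<Sum>W\<in>crossed_walls Q c. repeat_mset (wall_degree Q W) (M W)"
    have "H \<in># ?S" using sod_cross.prems False by (auto split: if_splits)
    then have "count ?S H \<noteq> 0" by (simp add: count_eq_zero_iff)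
    then have "(\<Sum>W\<in>crossed_walls Q c. wall_degree Q W * count (M W) H) \<noteq> 0"
      by (simp add: count_sum)
    then obtain W where W: "W \<in> crossed_walls Q c" "wall_degree Q W * count (M W) H \<noteq> 0"
      by (rule sum.not_neutral_contains_not_neutral)
    then have "H \<in># M W" by (metis count_eq_zero_iff mult_0_right)
    then have "H \<subseteq> amb (higgs Q (span W))" using sod_cross W(1) by blast
    also have "\<dots> \<subseteq> amb Q" by (simp add: amb_def higgs_def span_mono)
    finally show ?thesis .
  qed simp
qed

lemma count_sod_cross:
  assumes "relevant Q H"
    and M: "\<And>W. W \<in> crossed_walls Q c \<Longrightarrow> complete_sod (higgs Q (span W)) (Z W) (M W)"
    and fin: "finite (crossed_walls Q c)"
  shows "count ((if relevant Q (amb Q) then {#amb Q#} else {#}) +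
            (\<Sum>W\<in>crossed_walls Q c. repeat_mset (wall_degree Q W) (M W))) H
       = (if H = amb Q then 1 else 0) +
         (\<Sum>W | W \<in> crossed_walls Q c \<and> H \<subseteq> span W. wall_degree Q W * count (M W) H)"
proof -
  have 0: "count (M W) H = 0" if "W \<in> crossed_walls Q c" "\<not> H \<subseteq> span W" for W
  proof -
    have "amb (higgs Q (span W)) \<subseteq> span W"
      by (simp add: amb_def higgs_def span_minimal)
    then show ?thesis
      using complete_sod_labels[OF M[OF that(1)], of H] that(2) by (auto simp: count_eq_zero_iff)
  qed
  have "(\<Sum>W\<in>crossed_walls Q c. wall_degree Q W * count (M W) H)
      = (\<Sum>W | W \<in> crossed_walls Q c \<and> H \<subseteq> span W. wall_degree Q W * count (M W) H)"
    by (rule sum.mono_neutral_right) (use fin 0 in auto)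
  then show ?thesis using assms(1) by (auto simp: count_sum)
qed

end

theory Submission imports Defs begin

text \<open>
  Let \<open>\<pi>\<close> be the quotient map by \<open>H\<close>. Since \<open>H\<close> is the cone of its weights, preimages of Coulomb
  cones are cones, so a generic ray of \<open>Q\<close> maps to a generic ray of \<open>Q\<^bsub>/H\<^esub>\<close>, and the walls crossed by
  the latter are the images of the crossed walls whose span contains \<open>H\<close>, with equal degrees. Passing
  to Coulomb problems commutes with passing to the Higgs problems of these walls, so by induction each
  run of the wall-crossing procedure for \<open>Q\<close> projects to a run for \<open>Q\<^bsub>/H\<^esub>\<close> with the same count.

  Not every run for \<open>Q\<^bsub>/H\<^esub>\<close> arises in this way (chambers need not map onto chambers), so the
  independence of \<open>[X\<^sub>C : Z\<^bsub>{0}\<^esub>]\<close> of all choices is needed as well. Let \<open>\<chi>(c)\<close> be the sum of the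
  lattice indices of all bases of weights whose cone contains \<open>c\<close>. It jumps by \<open>d\<^sub>W \<chi>(Z\<^sub>W)\<close> at a wall \<open>W\<close>
  and takes the same value on all minimal chambers; hence \<open>\<chi>(X\<^sub>C) = \<Sum>\<^sub>H [X\<^sub>C : Z\<^sub>H] \<chi>(Z\<^sub>H)\<close>. By the first
  part and induction on the dimension all terms with \<open>H \<noteq> {0}\<close> are determined, and \<open>\<chi>(Z\<^bsub>{0}\<^esub>) = 1\<close>.
\<close>

section \<open>Weight cones and strata\<close>

text \<open>The weighted count chi is the Euler characteristic and therefore additive over a
  semi-orthogonal decomposition; it is used because it is defined without reference to any ray. Only
  the multiplicity of {0} has to be extracted from it.

  Two rays end at the same value because the segment joining their far ends meets only walls whose
  span contains \<open>det_wt Q\<close>: on any other wall the pairing with the conormal would grow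
  with the distance. At such a wall the jump, a multiple of the pairing of the conormal with
  \<open>det_wt Q\<close>, is zero.

  Jumps are computed only at transversal crossings, and genericity says nothing about direction.
  Transversality holds because a ray whose direction lies in the span of a wall it meets would stay,
  back to its start, in a cone spanning only that hyperplane, whereas it starts in a chamber.

  Chambers and walls are handled at single points through \<open>stratum_span\<close>. The lemmas on
  Coulomb problems leave the target type open: the theorem needs an arbitrary one, the induction on
  dimension needs the type of \<open>Q\<close> itself.\<close>

lemma subspace_amb [simp]: "subspace (amb Q)"
  by (simp add: amb_def)

lemma wconeI:
  "(\<And>i. i \<in> S \<Longrightarrow> 0 \<le> t i) \<Longrightarrow> x = (\<Sum>i\<in>S. t i *\<^sub>R wt Q i) \<Longrightarrow> x \<in> wcone Q S"
  unfolding wcone_def by blast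

lemma wconeE:
  assumes "x \<in> wcone Q S"
  obtains t where "\<And>i. i \<in> S \<Longrightarrow> 0 \<le> t i" "x = (\<Sum>i\<in>S. t i *\<^sub>R wt Q i)"
proof -
  obtain t where "\<forall>i\<in>S. 0 \<le> t i" "x = (\<Sum>i\<in>S. t i *\<^sub>R wt Q i)"
    using assms unfolding wcone_def by blast
  then show ?thesis using that[of t] by simp
qed

lemma wcone_mono:
  assumes "finite S'" "S \<subseteq> S'"
  shows "wcone Q S \<subseteq> wcone Q S'"
proof
  fix x assume "x \<in> wcone Q S"
  then obtain t where t: "\<forall>i\<in>S. 0 \<le> t i" "x = (\<Sum>i\<in>S. t i *\<^sub>R wt Q i)"
    by (auto simp: wcone_def)
  let ?t = "\<lambda>i. if i \<in> S then t i else 0"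
  have "x = (\<Sum>i\<in>S'. ?t i *\<^sub>R wt Q i)"
    unfolding t(2) using assms by (intro sum.mono_neutral_cong_left) auto
  then show "x \<in> wcone Q S'" using t(1) by (auto simp: wcone_def intro!: exI[of _ ?t])
qed

lemma wcone_subset_span: "wcone Q S \<subseteq> span (wt Q ` S)"
  unfolding wcone_def by (auto intro!: span_sum span_mul intro: span_base)

lemma wcone_add:
  assumes "x \<in> wcone Q S" "y \<in> wcone Q S"
  shows "x + y \<in> wcone Q S"
proof -
  obtain t u where "\<forall>i\<in>S. 0 \<le> t i" "x = (\<Sum>i\<in>S. t i *\<^sub>R wt Q i)"
    "\<forall>i\<in>S. 0 \<le> u i" "y = (\<Sum>i\<in>S. u i *\<^sub>R wt Q i)"
    using assms by (auto simp: wcone_def)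
  then show ?thesis unfolding wcone_def
    by (auto simp: scaleR_left_distrib sum.distrib intro!: exI[of _ "\<lambda>i. t i + u i"])
qed

lemma wcone_scale:
  assumes "x \<in> wcone Q S" "0 \<le> r"
  shows "r *\<^sub>R x \<in> wcone Q S"
proof -
  obtain t where "\<forall>i\<in>S. 0 \<le> t i" "x = (\<Sum>i\<in>S. t i *\<^sub>R wt Q i)"
    using assms by (auto simp: wcone_def)
  then show ?thesis unfolding wcone_def
    by (auto simp: scaleR_sum_right assms intro!: exI[of _ "\<lambda>i. r * t i"])
qed

lemma zero_in_wcone: "0 \<in> wcone Q S"
  by (auto simp: wcone_def intro!: exI[of _ "\<lambda>i. 0"])

lemma wt_in_wcone:
  assumes "finite S" "i \<in> S"
  shows "wt Q i \<in> wcone Q S"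
proof -
  have "(\<Sum>j\<in>S. (if j = i then 1 else 0) *\<^sub>R wt Q j) = (\<Sum>j\<in>S. if j = i then wt Q j else 0)"
    by (intro sum.cong) auto
  also have "\<dots> = wt Q i" using assms by simp
  finally show ?thesis unfolding wcone_def
    by (auto intro!: exI[of _ "\<lambda>j. if j = i then 1 else 0"])
qed

text \<open>Serves closedness, which is known for convex cone hulls of finite sets.\<close>

lemma wcone_eq_hull:
  assumes "finite S"
  shows "wcone Q S = convex_cone hull (wt Q ` S)"
proof
  show "convex_cone hull (wt Q ` S) \<subseteq> wcone Q S"
    by (rule hull_minimal)
      (auto simp: convex_cone_iff assms intro: wt_in_wcone wcone_add wcone_scale zero_in_wcone)
  have "(\<Sum>i\<in>S. t i *\<^sub>R wt Q i) \<in> convex_cone hull (wt Q ` S)" if "\<forall>i\<in>S. 0 \<le> t i" for t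
    using assms that
  proof (induction S rule: finite_induct)
    case (insert i S)
    have "convex_cone hull (wt Q ` S) \<subseteq> convex_cone hull (wt Q ` insert i S)"
      by (intro hull_mono) auto
    with insert show ?case
      by (auto intro!: convex_cone_hull_add convex_cone_hull_mul intro: hull_inc)
  qed (simp add: convex_cone_hull_contains_0)
  then show "wcone Q S \<subseteq> convex_cone hull (wt Q ` S)" by (auto simp: wcone_def)
qed

lemma closed_wcone: "finite S \<Longrightarrow> closed (wcone Q S)"
  by (simp add: wcone_eq_hull closed_convex_cone_hull)

text \<open>Independence of the indexed family: two indices may carry the same weight, and the image
  set alone would not see the repetition.\<close>

definition wt_free :: "('i, 'v::euclidean_space) toric_git \<Rightarrow> 'i set \<Rightarrow> bool" where
  "wt_free Q S \<longleftrightarrow> inj_on (wt Q) S \<and> independent (wt Q ` S)"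

lemma wt_free_subset: "wt_free Q S \<Longrightarrow> S' \<subseteq> S \<Longrightarrow> wt_free Q S'"
  unfolding wt_free_def by (meson image_mono independent_mono inj_on_subset)

text \<open>The dual coordinates, extended linearly to the whole space so that they are continuous
  around a point; as coordinates they are meaningful only on the span of the weights.\<close>

lemma wt_free_coords:
  assumes "wt_free Q S" "finite S"
  obtains f where "\<And>i. i \<in> S \<Longrightarrow> linear (f i :: 'v \<Rightarrow> real)"
    and "\<And>t i. i \<in> S \<Longrightarrow> f i (\<Sum>j\<in>S. t j *\<^sub>R wt (Q :: ('i, 'v::euclidean_space) toric_git) j) = t i"
    and "\<And>x. x \<in> span (wt Q ` S) \<Longrightarrow> x = (\<Sum>j\<in>S. f j x *\<^sub>R wt Q j)"
proof -
  have "\<exists>g. linear g \<and> (\<forall>b\<in>wt Q ` S. g b = (if b = wt Q i then 1 else 0 :: real))" for i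
    using assms(1) by (intro linear_independent_extend) (simp add: wt_free_def)
  then obtain f where lin: "\<And>i. linear (f i :: 'v \<Rightarrow> real)"
    and f: "\<And>i b. b \<in> wt Q ` S \<Longrightarrow> f i b = (if b = wt Q i then 1 else 0)"
    by metis
  have coord: "f i (\<Sum>j\<in>S. t j *\<^sub>R wt Q j) = t i" if "i \<in> S" for t i
  proof -
    have "f i (\<Sum>j\<in>S. t j *\<^sub>R wt Q j) = (\<Sum>j\<in>S. t j * f i (wt Q j))"
      by (simp add: linear_sum[OF lin] linear_cmul[OF lin])
    also have "\<dots> = (\<Sum>j\<in>S. if j = i then t j else 0)"
      using assms(1) that by (intro sum.cong) (auto simp: f wt_free_def inj_on_def)
    finally show ?thesis using that assms(2) by simp
  qed
  moreover have "x = (\<Sum>j\<in>S. f j x *\<^sub>R wt Q j)" if "x \<in> span (wt Q ` S)" for x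
  proof -
    have "linear (\<lambda>x. \<Sum>j\<in>S. f j x *\<^sub>R wt Q j)"
      by (simp add: linear_iff linear_add[OF lin] linear_cmul[OF lin] scaleR_left_distrib
          sum.distrib scaleR_sum_right)
    moreover have "(\<Sum>j\<in>S. f j b *\<^sub>R wt Q j) = b" if b: "b \<in> wt Q ` S" for b
    proof -
      obtain i where i: "i \<in> S" "b = wt Q i" using b by blast
      have "(\<Sum>j\<in>S. f j b *\<^sub>R wt Q j) = (\<Sum>j\<in>S. if j = i then wt Q j else 0)"
        using assms(1) i by (intro sum.cong) (auto simp: f wt_free_def inj_on_def)
      then show ?thesis using i assms(2) by simp
    qed
    ultimately show ?thesis
      using linear_eq_on_span[of "\<lambda>x. x" "\<lambda>x. \<Sum>j\<in>S. f j x *\<^sub>R wt Q j" "wt Q ` S" x] that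
      by (simp add: linear_id[unfolded id_def])
  qed
  ultimately show ?thesis using lin that by blast
qed

lemma wt_freeI:
  assumes "finite S" and "\<And>t i. (\<Sum>j\<in>S. t j *\<^sub>R wt Q j) = 0 \<Longrightarrow> i \<in> S \<Longrightarrow> t i = 0"
  shows "wt_free Q S"
  unfolding wt_free_def
proof
  show inj: "inj_on (wt Q) S"
  proof (rule inj_onI, rule ccontr)
    fix i j assume ij: "i \<in> S" "j \<in> S" "wt Q i = wt Q j" "i \<noteq> j"
    let ?t = "\<lambda>k. if k = i then 1 else if k = j then -1 else 0 :: real"
    have "(\<Sum>k\<in>S. ?t k *\<^sub>R wt Q k) = (\<Sum>k\<in>{i,j}. ?t k *\<^sub>R wt Q k)"
      using ij assms(1) by (intro sum.mono_neutral_right) auto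
    also have "\<dots> = 0" using ij by simp
    finally show False using assms(2)[of ?t i] ij by simp
  qed
  show "independent (wt Q ` S)"
  proof (rule independent_if_scalars_zero)
    fix g x assume "(\<Sum>y\<in>wt Q ` S. g y *\<^sub>R y) = 0" "x \<in> wt Q ` S"
    then show "g x = 0" using assms(2)[of "\<lambda>i. g (wt Q i)"] by (auto simp: sum.reindex[OF inj])
  qed (simp add: assms(1))
qed

text \<open>Conic Caratheodory. Strict positivity of the coefficients is the point: it makes the
  representation persist under small moves inside the span of the weights in
  \<open>S'\<close>.\<close>

lemma wcone_caratheodory:
  assumes "finite S" "x \<in> wcone Q S"
  obtains S' t where "S' \<subseteq> S" "wt_free Q S'" "\<And>i. i \<in> S' \<Longrightarrow> 0 < t i"
    "x = (\<Sum>i\<in>S'. t i *\<^sub>R wt Q i)"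
proof -
  have "\<exists>S' t. S' \<subseteq> S \<and> wt_free Q S' \<and> (\<forall>i\<in>S'. 0 < t i) \<and> x = (\<Sum>i\<in>S'. t i *\<^sub>R wt Q i)"
    using assms
  proof (induction S rule: finite_psubset_induct)
    case (psubset S)
    obtain t where t: "\<And>i. i \<in> S \<Longrightarrow> 0 \<le> t i" "x = (\<Sum>i\<in>S. t i *\<^sub>R wt Q i)"
      using psubset.prems by (auto simp: wcone_def)
    have step: ?case if k: "k \<in> S" and s: "\<And>i. i \<in> S \<Longrightarrow> 0 \<le> s i" "s k = 0"
      "x = (\<Sum>i\<in>S. s i *\<^sub>R wt Q i)" for k s
    proof -
      have "x = (\<Sum>i\<in>S - {k}. s i *\<^sub>R wt Q i)"
        using s psubset.hyps by (simp add: sum.remove[OF psubset.hyps k])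
      then have "x \<in> wcone Q (S - {k})" using s(1) unfolding wcone_def by blast
      then show ?thesis using psubset.IH[of "S - {k}"] k by blast
    qed
    show ?case
    proof (cases "wt_free Q S \<or> (\<exists>k\<in>S. t k = 0)")
      case True
      then show ?thesis
      proof
        assume "\<exists>k\<in>S. t k = 0"
        then obtain k where "k \<in> S" "t k = 0" by blast
        then show ?thesis using step[of k t] t by blast
      next
        assume free: "wt_free Q S"
        show ?thesis
        proof (cases "\<exists>k\<in>S. t k = 0")
          case True
          then obtain k where "k \<in> S" "t k = 0" by blast
          then show ?thesis using step[of k t] t by blast
        next
          case False
          then have "\<forall>i\<in>S. 0 < t i" using t(1) by (metis less_eq_real_def)
          then show ?thesis using free t(2) by blast
        qed
      qed
    next
      case False
      then obtain u' i' where u': "(\<Sum>j\<in>S. u' j *\<^sub>R wt Q j) = 0" "i' \<in> S" "u' i' \<noteq> 0"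
        using wt_freeI[OF psubset.hyps(1)] by metis
      define u where "u = (if u' i' > 0 then u' else (\<lambda>j. - u' j))"
      have u: "(\<Sum>j\<in>S. u j *\<^sub>R wt Q j) = 0" "u i' > 0"
        using u' by (simp_all add: u_def sum_negf)
      define P where "P = {i \<in> S. u i > 0}"
      have P: "finite P" "i' \<in> P" using psubset.hyps u(2) u'(2) by (simp_all add: P_def)
      then have "P \<noteq> {}" by blast
      \<comment> \<open>The largest multiple of the relation that can be subtracted with all
        coefficients staying nonnegative; at the minimizing index the coefficient becomes 0.\<close>
      define r where "r = Min ((\<lambda>i. t i / u i) ` P)"
      have "r \<in> (\<lambda>i. t i / u i) ` P" unfolding r_def using P(1) \<open>P \<noteq> {}\<close> by (intro Min_in) auto
      then obtain k where k: "k \<in> P" "r = t k / u k" by blast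
      have r: "r \<le> t i / u i" if "i \<in> P" for i
        unfolding r_def using P(1) that by (intro Min_le) auto
      have "0 \<le> r" using k t(1)[of k] by (auto simp: P_def)
      show ?thesis
      proof (rule step[of k "\<lambda>i. t i - r * u i"])
        show "k \<in> S" using k by (simp add: P_def)
        show "0 \<le> t i - r * u i" if "i \<in> S" for i
        proof (cases "u i > 0")
          case True
          then show ?thesis using r[of i] that by (simp add: P_def pos_le_divide_eq)
        next
          case False
          then have "r * u i \<le> 0" using \<open>0 \<le> r\<close> by (simp add: mult_nonneg_nonpos)
          then show ?thesis using t(1)[OF that] by linarith
        qed
        show "t k - r * u k = 0" using k by (auto simp: P_def)
        have "(\<Sum>i\<in>S. (r * u i) *\<^sub>R wt Q i) = r *\<^sub>R (\<Sum>i\<in>S. u i *\<^sub>R wt Q i)"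
          by (simp add: scaleR_sum_right)
        then show "x = (\<Sum>i\<in>S. (t i - r * u i) *\<^sub>R wt Q i)"
          using u(1) t(2) by (simp add: scaleR_left_diff_distrib sum_subtractf)
      qed
    qed
  qed
  then show ?thesis using that by blast
qed

section \<open>Strata and their linear spans\<close>

definition stratum :: "('i, 'v::euclidean_space) toric_git \<Rightarrow> 'v \<Rightarrow> 'v set" where
  "stratum Q x = {y \<in> amb Q. \<forall>S\<subseteq>idx Q. x \<in> wcone Q S \<longleftrightarrow> y \<in> wcone Q S}"

text \<open>The linear span of \<open>stratum Q x\<close> in closed form
  (\<open>span_stratum\<close>). Only cones containing \<open>x\<close> restrict the directions,
  since avoiding a closed cone is an open condition.\<close>

definition stratum_span :: "('i, 'v::euclidean_space) toric_git \<Rightarrow> 'v \<Rightarrow> 'v set" where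
  "stratum_span Q x = {v \<in> amb Q. \<forall>S\<subseteq>idx Q. x \<in> wcone Q S \<longrightarrow> v \<in> span (wt Q ` S)}"

lemma gkz_strata_eq: "gkz_strata Q = stratum Q ` amb Q"
  unfolding gkz_strata_def quotient_def stratum_def Image_def by (simp add: image_def) blast

lemma stratum_self: "x \<in> amb Q \<Longrightarrow> x \<in> stratum Q x"
  by (simp add: stratum_def)

lemma stratum_span_cong: "y \<in> stratum Q x \<Longrightarrow> stratum_span Q y = stratum_span Q x"
  by (simp add: stratum_def stratum_span_def)

lemma subspace_stratum_span: "subspace (stratum_span Q x)"
  unfolding subspace_def stratum_span_def
  by (auto simp: span_zero span_add span_mul subspace_0 subspace_add subspace_mul)

lemma stratum_span_subset_amb: "stratum_span Q x \<subseteq> amb Q"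
  by (auto simp: stratum_span_def)

lemma stratum_span_subset_span:
  "S \<subseteq> idx Q \<Longrightarrow> x \<in> wcone Q S \<Longrightarrow> stratum_span Q x \<subseteq> span (wt Q ` S)"
  by (auto simp: stratum_span_def)

lemma self_in_stratum_span: "x \<in> amb Q \<Longrightarrow> x \<in> stratum_span Q x"
  using wcone_subset_span unfolding stratum_span_def by blast

lemma stratum_subset_stratum_span: "stratum Q x \<subseteq> stratum_span Q x"
  unfolding stratum_def stratum_span_def using wcone_subset_span by blast

lemma finite_gkz_strata:
  assumes "finite (idx Q)"
  shows "finite (gkz_strata Q)"
proof -
  let ?h = "\<lambda>A. {y \<in> amb Q. \<forall>S\<subseteq>idx Q. S \<in> A \<longleftrightarrow> y \<in> wcone Q S}"
  have "stratum Q x = ?h {S. S \<subseteq> idx Q \<and> x \<in> wcone Q S}" for x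
    unfolding stratum_def by blast
  then have "stratum Q x \<in> ?h ` Pow (Pow (idx Q))" for x
    by (rule image_eqI) blast
  then have "gkz_strata Q \<subseteq> ?h ` Pow (Pow (idx Q))"
    unfolding gkz_strata_eq by blast
  then show ?thesis using assms by (meson finite_Pow_iff finite_surj)
qed

lemma eventually_linear_pos:
  fixes f :: "'i \<Rightarrow> 'v::euclidean_space \<Rightarrow> real"
  assumes "finite S" "\<And>i. i \<in> S \<Longrightarrow> linear (f i)" "\<And>i. i \<in> S \<Longrightarrow> 0 < f i x"
  shows "\<forall>\<^sub>F y in nhds x. \<forall>i\<in>S. 0 < f i y"
proof (rule eventually_ball_finite[OF assms(1)], rule ballI)
  fix i assume i: "i \<in> S"
  have "open {y. 0 < f i y}"
    by (intro open_Collect_less continuous_on_const linear_continuous_on)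
      (simp add: assms(2) i linear_linear)
  then show "\<forall>\<^sub>F y in nhds x. 0 < f i y"
    using eventually_nhds_in_open[of "{y. 0 < f i y}" x] assms(3)[OF i] by simp
qed

lemma eventually_pos_coords:
  assumes "finite S" "wt_free Q S" "\<And>i. i \<in> S \<Longrightarrow> 0 < t i"
  shows "\<forall>\<^sub>F y in nhds (\<Sum>i\<in>S. t i *\<^sub>R wt Q i). y \<in> span (wt Q ` S) \<longrightarrow> y \<in> wcone Q S"
proof -
  let ?x = "\<Sum>i\<in>S. t i *\<^sub>R wt Q i"
  obtain f where f: "\<And>i. i \<in> S \<Longrightarrow> linear (f i)"
    "\<And>t i. i \<in> S \<Longrightarrow> f i (\<Sum>j\<in>S. t j *\<^sub>R wt Q j) = t i"
    "\<And>x. x \<in> span (wt Q ` S) \<Longrightarrow> x = (\<Sum>j\<in>S. f j x *\<^sub>R wt Q j)"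
    by (rule wt_free_coords[OF assms(2,1)]) (rule that)
  have "\<forall>\<^sub>F y in nhds ?x. \<forall>i\<in>S. 0 < f i y"
    using assms(3) by (intro eventually_linear_pos[OF assms(1) f(1)]) (simp_all add: f(2))
  then show ?thesis
  proof (rule eventually_mono, intro impI)
    fix y assume "\<forall>i\<in>S. 0 < f i y" "y \<in> span (wt Q ` S)"
    then show "y \<in> wcone Q S" using f(3) by (intro wconeI[of S "\<lambda>i. f i y"]) (auto intro: less_imp_le)
  qed
qed

lemma eventually_not_in_wcone:
  assumes "finite S" "x \<notin> wcone Q S"
  shows "\<forall>\<^sub>F y in nhds x. y \<notin> wcone Q S"
  using eventually_nhds_in_open[OF open_Compl[OF closed_wcone[OF assms(1), of Q]], of x] assms(2)
  by simp

text \<open>Strata are relatively open in \<open>stratum_span\<close>. Nearby points stay off a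
  closed cone that misses \<open>x\<close>; they stay in a cone containing \<open>x\<close> because
  moves within the span of a free subset keep positive coordinates positive.\<close>

lemma eventually_in_stratum:
  assumes "finite (idx Q)"
  shows "\<forall>\<^sub>F y in nhds x. y \<in> stratum_span Q x \<longrightarrow> y \<in> stratum Q x"
proof -
  have "\<forall>\<^sub>F y in nhds x. \<forall>S\<in>Pow (idx Q). y \<in> stratum_span Q x \<longrightarrow>
      (x \<in> wcone Q S \<longleftrightarrow> y \<in> wcone Q S)"
  proof (rule eventually_ball_finite, simp add: assms, rule ballI)
    fix S assume "S \<in> Pow (idx Q)"
    then have S: "S \<subseteq> idx Q" "finite S" using assms by (auto intro: finite_subset)
    show "\<forall>\<^sub>F y in nhds x. y \<in> stratum_span Q x \<longrightarrow> (x \<in> wcone Q S \<longleftrightarrow> y \<in> wcone Q S)"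
    proof (cases "x \<in> wcone Q S")
      case True
      obtain S' t where S': "S' \<subseteq> S" "wt_free Q S'" "\<And>i. i \<in> S' \<Longrightarrow> 0 < t i"
        "x = (\<Sum>i\<in>S'. t i *\<^sub>R wt Q i)"
        by (rule wcone_caratheodory[OF S(2) True]) (rule that)
      have fin: "finite S'" using S' S(2) finite_subset by blast
      have "x \<in> wcone Q S'" using S'(3,4) unfolding wcone_def by (auto intro: less_imp_le)
      then have "stratum_span Q x \<subseteq> span (wt Q ` S')"
        using S S' by (intro stratum_span_subset_span) auto
      moreover have "wcone Q S' \<subseteq> wcone Q S" by (rule wcone_mono[OF S(2) S'(1)])
      moreover have "\<forall>\<^sub>F y in nhds x. y \<in> span (wt Q ` S') \<longrightarrow> y \<in> wcone Q S'"
        unfolding S'(4) by (rule eventually_pos_coords[OF fin S'(2) S'(3)])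
      ultimately show ?thesis
        using True by (auto elim!: eventually_mono)
    next
      case False
      then show ?thesis
        using eventually_mono[OF eventually_not_in_wcone[OF S(2) False]] by auto
    qed
  qed
  then show ?thesis
    by (rule eventually_mono) (auto simp: stratum_def stratum_span_def)
qed

lemma eventually_line:
  fixes x v :: "'a::real_normed_vector"
  assumes "\<forall>\<^sub>F y in nhds x. P y"
  shows "\<forall>\<^sub>F s in nhds 0. P (x + s *\<^sub>R v)"
proof -
  have "((\<lambda>s::real. x + s *\<^sub>R v) \<longlongrightarrow> x + 0 *\<^sub>R v) (nhds 0)"
    by (intro tendsto_intros filterlim_ident)
  then show ?thesis using assms by (simp add: filterlim_iff)
qed

text \<open>For small nonzero \<open>s\<close> both \<open>x\<close> and \<open>x + s v\<close> lie
  in the stratum, so every \<open>v\<close> of the right-hand side is a multiple of a difference of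
  two of its points.\<close>

lemma span_stratum:
  assumes "finite (idx Q)" "x \<in> amb Q"
  shows "span (stratum Q x) = stratum_span Q x"
proof
  show "span (stratum Q x) \<subseteq> stratum_span Q x"
    by (simp add: span_minimal subspace_stratum_span stratum_subset_stratum_span)
  show "stratum_span Q x \<subseteq> span (stratum Q x)"
  proof
    fix v assume v: "v \<in> stratum_span Q x"
    have "\<forall>\<^sub>F s in at (0::real). x + s *\<^sub>R v \<in> stratum_span Q x \<longrightarrow> x + s *\<^sub>R v \<in> stratum Q x"
      using eventually_line[OF eventually_in_stratum[OF assms(1)], of x v]
      unfolding eventually_at_filter by (rule eventually_mono) simp
    moreover have "\<forall>\<^sub>F s in at (0::real). s \<noteq> 0" by (simp add: eventually_at_filter)
    ultimately have "\<forall>\<^sub>F s in at (0::real). s \<noteq> 0 \<and> x + s *\<^sub>R v \<in> stratum Q x"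
      by eventually_elim
        (use v self_in_stratum_span[OF assms(2)] in
          \<open>auto intro: subspace_add subspace_mul subspace_stratum_span\<close>)
    then obtain s :: real where s: "s \<noteq> 0" "x + s *\<^sub>R v \<in> stratum Q x"
      using eventually_happens'[OF at_neq_bot] by blast
    have "(1/s) *\<^sub>R ((x + s *\<^sub>R v) - x) \<in> span (stratum Q x)"
      using s stratum_self[OF assms(2)] by (intro span_mul span_diff span_base)
    then show "v \<in> span (stratum Q x)" using s by simp
  qed
qed

lemma dim_stratum:
  assumes "finite (idx Q)" "x \<in> amb Q"
  shows "dim (stratum Q x) = dim (stratum_span Q x)"
  by (metis assms dim_span span_stratum)

lemma chamber_stratum_iff:
  assumes "finite (idx Q)" "x \<in> amb Q"
  shows "gkz_chamber Q (stratum Q x) \<longleftrightarrow> stratum_span Q x = amb Q"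
  using assms subspace_dim_equal[OF subspace_stratum_span subspace_amb stratum_span_subset_amb, of Q x]
  by (auto simp: gkz_chamber_def gkz_strata_eq dim_stratum)

lemma wall_stratum_iff:
  assumes "finite (idx Q)" "x \<in> amb Q"
  shows "gkz_wall Q (stratum Q x) \<longleftrightarrow> dim (stratum_span Q x) + 1 = dim (amb Q)"
  using assms by (auto simp: gkz_wall_def gkz_strata_eq dim_stratum)

lemma stratumE:
  assumes "S \<in> gkz_strata Q"
  obtains x where "x \<in> amb Q" "S = stratum Q x"
  using assms by (auto simp: gkz_strata_eq)

lemma stratum_of_mem:
  assumes "S \<in> gkz_strata Q" "x \<in> S"
  shows "x \<in> amb Q" "S = stratum Q x"
  using assms by (auto simp: gkz_strata_eq stratum_def)

lemma chamber_of_mem: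
  assumes "gkz_chamber Q C" "x \<in> C"
  shows "x \<in> amb Q" "C = stratum Q x"
  using assms stratum_of_mem unfolding gkz_chamber_def by blast+

section \<open>Lattices\<close>

definition int_span :: "'v::euclidean_space set \<Rightarrow> 'v set" where
  "int_span B = {\<Sum>b\<in>B. of_int (n b) *\<^sub>R b | n :: 'v \<Rightarrow> int. True}"

lemma int_spanI: "x = (\<Sum>b\<in>B. of_int (n b) *\<^sub>R b) \<Longrightarrow> x \<in> int_span B"
  unfolding int_span_def by blast

lemma int_spanE:
  assumes "x \<in> int_span B"
  obtains n where "x = (\<Sum>b\<in>B. of_int (n b) *\<^sub>R b)"
  using assms unfolding int_span_def by blast

lemma int_span_mult:
  assumes "x \<in> int_span B"
  shows "of_int k *\<^sub>R x \<in> int_span B"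
proof -
  obtain n where "x = (\<Sum>b\<in>B. of_int (n b) *\<^sub>R b)" using assms by (rule int_spanE)
  then show ?thesis
    by (intro int_spanI[of _ "\<lambda>b. k * n b"]) (simp add: scaleR_sum_right)
qed

text \<open>Steinitz exchange over the integers. Exchanging \<open>t\<close> for \<open>s\<close>
  introduces as denominator the coefficient of \<open>t\<close> in \<open>m s\<close>, and the new
  \<open>m\<close> absorbs it: a lattice basis is not preserved, a bound on denominators is.\<close>

lemma lattice_exchange:
  fixes \<Lambda> B S :: "'v::euclidean_space set"
  assumes "\<Lambda> = int_span B" "independent B" "independent S" "S \<subseteq> \<Lambda>"
  shows "\<exists>B'\<subseteq>B. S \<inter> B' = {} \<and> independent (S \<union> B') \<and>
    (\<exists>m>0. \<forall>x\<in>\<Lambda>. of_int m *\<^sub>R x \<in> int_span (S \<union> B'))"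
  using independent_imp_finite[OF assms(3)] assms(3,4)
proof (induction S rule: finite_induct)
  case empty
  then show ?case using assms(1,2) by (intro exI[of _ B]) (auto intro!: exI[of _ 1])
next
  case (insert s S)
  have "independent S" using insert.prems(1) independent_mono by blast
  then obtain B' m where B': "B' \<subseteq> B" "S \<inter> B' = {}" "independent (S \<union> B')" "m > 0"
    "\<forall>x\<in>\<Lambda>. of_int m *\<^sub>R x \<in> int_span (S \<union> B')"
    using insert by auto
  show ?case
  proof (cases "s \<in> B'")
    case True
    then have *: "insert s S \<union> (B' - {s}) = S \<union> B'" by blast
    show ?thesis
      by (rule exI[of _ "B' - {s}"]) (unfold *, use B' insert.hyps True in blast)
  next
    case False
    let ?T = "S \<union> B'"
    have fin: "finite ?T" using B'(3) independent_imp_finite by blast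
    have "of_int m *\<^sub>R s \<in> int_span ?T" using B'(5) insert.prems(2) by blast
    then obtain n where n: "of_int m *\<^sub>R s = (\<Sum>b\<in>?T. of_int (n b) *\<^sub>R b)"
      by (rule int_spanE)
    have s_notin: "s \<notin> span S"
      using insert.prems(1) insert.hyps by (simp add: independent_insert)
    have "\<exists>t\<in>B'. n t \<noteq> 0"
    proof (rule ccontr)
      assume "\<not> ?thesis"
      then have "of_int m *\<^sub>R s = (\<Sum>b\<in>S. of_int (n b) *\<^sub>R b)"
        unfolding n using fin by (intro sum.mono_neutral_right) auto
      then have "of_int m *\<^sub>R s \<in> span S" by (auto intro!: span_sum span_mul intro: span_base)
      then have "(1 / of_int m) *\<^sub>R (of_int m *\<^sub>R s) \<in> span S" by (rule span_mul)
      then show False using s_notin B'(4) by simp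
    qed
    then obtain t where t: "t \<in> B'" "n t \<noteq> 0" by blast
    let ?R = "?T - {t}" and ?k = "n t"
    have T': "insert s S \<union> (B' - {t}) = insert s ?R" using t B'(2) by blast
    have s_R: "s \<notin> ?R" using False insert.hyps by blast
    have ns: "of_int m *\<^sub>R s = of_int ?k *\<^sub>R t + (\<Sum>b\<in>?R. of_int (n b) *\<^sub>R b)"
      unfolding n using fin t by (intro sum.remove) auto
    have "s \<notin> span ?R"
    proof
      assume "s \<in> span ?R"
      then have "of_int m *\<^sub>R s - (\<Sum>b\<in>?R. of_int (n b) *\<^sub>R b) \<in> span ?R"
        by (intro span_diff span_mul span_sum) (auto intro: span_base)
      then have "of_int ?k *\<^sub>R t \<in> span ?R" using ns by simp
      then have "(1 / of_int ?k) *\<^sub>R (of_int ?k *\<^sub>R t) \<in> span ?R" by (rule span_mul)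
      then have "t \<in> span ?R" using t by simp
      then show False using B'(3) t by (meson UnI2 dependent_def)
    qed
    then have ind: "independent (insert s ?R)"
      using B'(3) independent_mono[OF B'(3), of ?R] by (simp add: independent_insert s_R)
    have "of_int (\<bar>?k\<bar> * m) *\<^sub>R x \<in> int_span (insert s ?R)" if "x \<in> \<Lambda>" for x
    proof -
      have "of_int m *\<^sub>R x \<in> int_span ?T" using B'(5) that by blast
      then obtain a where "of_int m *\<^sub>R x = (\<Sum>b\<in>?T. of_int (a b) *\<^sub>R b)"
        by (rule int_spanE)
      also have "\<dots> = of_int (a t) *\<^sub>R t + (\<Sum>b\<in>?R. of_int (a b) *\<^sub>R b)"
        using fin t by (intro sum.remove) auto
      finally have mx: "of_int m *\<^sub>R x
          = of_int (a t) *\<^sub>R t + (\<Sum>b\<in>?R. of_int (a b) *\<^sub>R b)" .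
      have "of_int (?k * m) *\<^sub>R x = of_int ?k *\<^sub>R (of_int m *\<^sub>R x)" by simp
      also have "\<dots>
          = of_int (a t) *\<^sub>R (of_int ?k *\<^sub>R t) + of_int ?k *\<^sub>R (\<Sum>b\<in>?R. of_int (a b) *\<^sub>R b)"
        unfolding mx by (simp add: scaleR_right_distrib mult.commute)
      also have "of_int ?k *\<^sub>R t = of_int m *\<^sub>R s - (\<Sum>b\<in>?R. of_int (n b) *\<^sub>R b)"
        using ns by simp
      finally have eq: "of_int (?k * m) *\<^sub>R x = of_int (a t * m) *\<^sub>R s +
          (\<Sum>b\<in>?R. of_int (?k * a b - a t * n b) *\<^sub>R b)"
        by (simp add: scaleR_right_diff_distrib scaleR_left_diff_distrib scaleR_sum_right
            sum_subtractf)
      let ?c = "\<lambda>b. if b = s then a t * m else ?k * a b - a t * n b"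
      have "of_int (?k * m) *\<^sub>R x = of_int (?c s) *\<^sub>R s + (\<Sum>b\<in>?R. of_int (?c b) *\<^sub>R b)"
        unfolding eq using s_R by (intro arg_cong2[where f = plus] sum.cong) auto
      also have "\<dots> = (\<Sum>b\<in>insert s ?R. of_int (?c b) *\<^sub>R b)"
        using fin s_R by (intro sum.insert[symmetric]) auto
      finally have "of_int (?k * m) *\<^sub>R x \<in> int_span (insert s ?R)" by (rule int_spanI)
      \<comment> \<open>\<open>?k\<close> may be negative; multiplying by its sign keeps the
        multiplier positive.\<close>
      then have "of_int (sgn ?k) *\<^sub>R (of_int (?k * m) *\<^sub>R x) \<in> int_span (insert s ?R)"
        by (rule int_span_mult)
      moreover have "real_of_int (sgn ?k) * of_int (?k * m) = of_int (\<bar>?k\<bar> * m)"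
        by (simp add: sgn_if)
      ultimately show ?thesis by (metis scaleR_scaleR)
    qed
    moreover have "\<bar>?k\<bar> * m > 0" using t B'(4) by simp
    ultimately show ?thesis
      using ind T' B'(1) False insert.hyps B'(2)
      by (intro exI[of _ "B' - {t}"]) (auto intro!: exI[of _ "\<bar>?k\<bar> * m"])
  qed
qed

text \<open>A lattice vector in \<open>span S\<close>, expanded in the enlarged family, has no
  component outside \<open>S\<close> by independence. In this form, free of any chosen basis, the
  finiteness also passes to quotient lattices.\<close>

lemma lattice_commensurable:
  fixes \<Lambda> S :: "'v::euclidean_space set"
  assumes "is_lattice \<Lambda>" "independent S" "S \<subseteq> \<Lambda>"
  shows "\<exists>m>0. \<forall>x\<in>\<Lambda> \<inter> span S. of_int m *\<^sub>R x \<in> int_span S"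
proof -
  obtain B where "independent B" "\<Lambda> = int_span B"
    using assms(1) unfolding is_lattice_def int_span_def by blast
  then obtain B' m where B': "S \<inter> B' = {}" "independent (S \<union> B')" "m > 0"
    "\<forall>x\<in>\<Lambda>. of_int m *\<^sub>R x \<in> int_span (S \<union> B')"
    using lattice_exchange assms(2,3) by metis
  have fin: "finite (S \<union> B')" using B'(2) independent_imp_finite by blast
  have "of_int m *\<^sub>R x \<in> int_span S" if x: "x \<in> \<Lambda>" "x \<in> span S" for x
  proof -
    have "of_int m *\<^sub>R x \<in> int_span (S \<union> B')" using B'(4) x(1) by blast
    then obtain n where n: "of_int m *\<^sub>R x = (\<Sum>b\<in>S \<union> B'. of_int (n b) *\<^sub>R b)"
      by (rule int_spanE)
    have "n b = 0" if b: "b \<in> B'" for b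
    proof (rule ccontr)
      assume nz: "n b \<noteq> 0"
      let ?R = "S \<union> B' - {b}"
      have "of_int m *\<^sub>R x = of_int (n b) *\<^sub>R b + (\<Sum>b\<in>?R. of_int (n b) *\<^sub>R b)"
        unfolding n using fin b by (intro sum.remove) auto
      then have "of_int (n b) *\<^sub>R b = of_int m *\<^sub>R x - (\<Sum>b\<in>?R. of_int (n b) *\<^sub>R b)" by simp
      also have "\<dots> \<in> span ?R"
      proof (intro span_diff span_mul span_sum)
        have "S \<subseteq> ?R" using b B'(1) by blast
        then show "x \<in> span ?R" using x(2) span_mono by blast
      qed (auto intro: span_base)
      finally have "(1 / of_int (n b)) *\<^sub>R (of_int (n b) *\<^sub>R b) \<in> span ?R" by (rule span_mul)
      then have "b \<in> span ?R" using nz by simp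
      then show False using B'(2) b by (meson UnI2 dependent_def)
    qed
    then have "of_int m *\<^sub>R x = (\<Sum>b\<in>S. of_int (n b) *\<^sub>R b)"
      unfolding n using fin by (intro sum.mono_neutral_right) auto
    then show ?thesis by (rule int_spanI)
  qed
  then show ?thesis using B'(3) by blast
qed

text \<open>
  The properties of a toric GIT problem used below, in a form that passes to Higgs and Coulomb
  problems: the last condition replaces the existence of a lattice basis.
\<close>

definition tame :: "('i, 'v::euclidean_space) toric_git \<Rightarrow> bool" where
  "tame Q \<longleftrightarrow> finite (idx Q) \<and> wt Q ` idx Q \<subseteq> dlat Q \<and> span (wt Q ` idx Q) = amb Q \<and>
     0 \<in> dlat Q \<and> (\<forall>x\<in>dlat Q. \<forall>y\<in>dlat Q. x - y \<in> dlat Q) \<and>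
     (\<forall>B\<subseteq>dlat Q. independent B \<longrightarrow>
        (\<exists>m>0. \<forall>x\<in>dlat Q \<inter> span B. of_int m *\<^sub>R x \<in> int_span B))"

text \<open>The primitive normal of a wall. Primitivity is expressed by the value 1 on some lattice
  vector, which descends to quotients directly; \<open>wall_degree_eq\<close> compares it with
  \<open>primitive\<close>.\<close>

definition conormal :: "('i, 'v::euclidean_space) toric_git \<Rightarrow> 'v set \<Rightarrow> 'v \<Rightarrow> bool" where
  "conormal Q V l \<longleftrightarrow> l \<in> lat Q \<and> (\<forall>v\<in>V. l \<bullet> v = 0) \<and> (\<exists>x\<in>dlat Q. l \<bullet> x = 1)"

lemma span_insert_hyperplane:
  fixes V A :: "'v::euclidean_space set"
  assumes "subspace V" "subspace A" "V \<subseteq> A" "dim V + 1 = dim A" "x \<in> A" "x \<notin> V"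
  shows "span (insert x V) = A"
proof (rule subspace_dim_equal)
  show "span (insert x V) \<subseteq> A" using assms by (simp add: span_minimal)
  have "x \<notin> span V" using assms(1,6) by (simp add: span_eq_iff[THEN iffD2])
  then show "dim A \<le> dim (span (insert x V))" using assms(4) by (simp add: dim_insert)
qed (use assms in auto)

text \<open>Stated for a bare difference-closed set because \<open>exists_conormal\<close> needs it
  before \<open>tame\<close> is available.\<close>

lemma group_int_mult:
  fixes \<Lambda> :: "'v::real_vector set"
  assumes "0 \<in> \<Lambda>" "\<And>x y. x \<in> \<Lambda> \<Longrightarrow> y \<in> \<Lambda> \<Longrightarrow> x - y \<in> \<Lambda>" "x \<in> \<Lambda>"
  shows "of_int k *\<^sub>R x \<in> \<Lambda>"
proof (induction k rule: int_induct[of _ 0])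
  have neg: "- y \<in> \<Lambda>" if "y \<in> \<Lambda>" for y using assms(2)[OF assms(1) that] by simp
  case (step1 i)
  then show ?case using assms(2)[OF step1(2) neg[OF assms(3)]] by (simp add: scaleR_left_distrib)
next
  case (step2 i)
  then show ?case using assms(2)[OF step2(2) assms(3)] by (simp add: scaleR_left_diff_distrib)
qed (simp add: assms(1))

lemma group_sum:
  fixes \<Lambda> :: "'v::real_vector set"
  assumes "0 \<in> \<Lambda>" "\<And>x y. x \<in> \<Lambda> \<Longrightarrow> y \<in> \<Lambda> \<Longrightarrow> x - y \<in> \<Lambda>" "\<And>i. i \<in> I \<Longrightarrow> f i \<in> \<Lambda>"
  shows "sum f I \<in> \<Lambda>"
  using assms(3)
proof (induction I rule: infinite_finite_induct)
  case (insert i I)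
  have "sum f I \<in> \<Lambda>" using insert by blast
  from assms(2)[OF insert.prems[OF insertI1] assms(2)[OF assms(1) this]]
  show ?case using insert.hyps by simp
qed (use assms(1) in auto)

text \<open>The normal component of a lattice vector off the hyperplane is scaled to an integral
  functional and then divided by its least positive value. The lattice properties are separate
  hypotheses because the spanning condition in \<open>tame\<close> is itself proved with this
  lemma.\<close>

lemma exists_conormal:
  fixes Q :: "('i, 'v::euclidean_space) toric_git"
  assumes "0 \<in> dlat Q" "\<And>x y. x \<in> dlat Q \<Longrightarrow> y \<in> dlat Q \<Longrightarrow> x - y \<in> dlat Q"
    and comm: "\<And>B. B \<subseteq> dlat Q \<Longrightarrow> independent B \<Longrightarrow>
        \<exists>m>0. \<forall>x\<in>dlat Q \<inter> span B. of_int m *\<^sub>R x \<in> int_span B"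
    and B: "B \<subseteq> dlat Q" "independent B" "dim (span B) + 1 = dim (amb Q)"
  shows "\<exists>l. conormal Q (span B) l"
proof -
  have "span B \<subseteq> amb Q" using B(1) by (simp add: amb_def span_mono)
  have "\<not> dlat Q \<subseteq> span B"
  proof
    assume "dlat Q \<subseteq> span B"
    then have "amb Q \<subseteq> span B" by (simp add: amb_def span_minimal)
    then show False using B(3) \<open>span B \<subseteq> amb Q\<close> by auto
  qed
  then obtain b where b: "b \<in> dlat Q" "b \<notin> span B" by blast
  then have ind: "independent (insert b B)" "b \<notin> B"
    using B(2) by (auto simp: independent_insert intro: span_base)
  have b_amb: "b \<in> amb Q" using b by (simp add: amb_def span_base)
  have sp: "span (insert b B) = amb Q"
    using span_insert_hyperplane[OF subspace_span subspace_amb \<open>span B \<subseteq> amb Q\<close> B(3) b_amb b(2)]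
    by (simp add: span_insert span_span)
  obtain m where m: "m > 0" "\<forall>x\<in>dlat Q \<inter> amb Q. of_int m *\<^sub>R x \<in> int_span (insert b B)"
    using comm[of "insert b B"] B(1) b(1) ind(1) sp by auto
  obtain y l0 where yl: "y \<in> span B" "\<And>w. w \<in> span B \<Longrightarrow> orthogonal l0 w" "b = y + l0"
    using orthogonal_subspace_decomp_exists[of B b] by blast
  have "l0 \<noteq> 0" using yl b(2) by auto
  have l0b: "l0 \<bullet> b = l0 \<bullet> l0" using yl by (simp add: inner_add_right orthogonal_def)
  have "l0 \<in> amb Q"
  proof -
    have "b - y \<in> amb Q" using b_amb yl(1) \<open>span B \<subseteq> amb Q\<close> by (intro subspace_diff) auto
    then show ?thesis using yl(3) by simp
  qed
  \<comment> \<open>Scaled so that \<open>l1\<close> takes the value \<open>m\<close> on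
    \<open>b\<close>: then its value at a lattice vector \<open>x\<close> is the integer coefficient
    of \<open>b\<close> in \<open>m x\<close>.\<close>
  define l1 where "l1 = (of_int m / (l0 \<bullet> l0)) *\<^sub>R l0"
  have l1: "l1 \<in> amb Q" "\<And>w. w \<in> span B \<Longrightarrow> l1 \<bullet> w = 0" "l1 \<bullet> b = of_int m"
    using \<open>l0 \<in> amb Q\<close> yl(2) \<open>l0 \<noteq> 0\<close> l0b by (auto simp: l1_def subspace_mul orthogonal_def)
  have l1_int: "\<exists>k::int. l1 \<bullet> x = of_int k" if x: "x \<in> dlat Q" for x
  proof -
    have "x \<in> amb Q" using x by (simp add: amb_def span_base)
    then have "of_int m *\<^sub>R x \<in> int_span (insert b B)" using m(2) x by blast
    then obtain n where n: "of_int m *\<^sub>R x = (\<Sum>c\<in>insert b B. of_int (n c) *\<^sub>R c)"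
      by (rule int_spanE)
    have "of_int m * (l1 \<bullet> x) = l1 \<bullet> (of_int m *\<^sub>R x)" by simp
    also have "\<dots> = (\<Sum>c\<in>insert b B. of_int (n c) * (l1 \<bullet> c))"
      unfolding n by (simp add: inner_sum_right)
    also have "\<dots> = of_int (n b) * (l1 \<bullet> b) + (\<Sum>c\<in>B. of_int (n c) * (l1 \<bullet> c))"
      using ind independent_imp_finite[OF B(2)] by simp
    also have "(\<Sum>c\<in>B. of_int (n c) * (l1 \<bullet> c)) = 0"
      by (intro sum.neutral) (simp add: l1(2) span_base)
    finally show ?thesis using l1(3) m(1) by (intro exI[of _ "n b"]) simp
  qed
  \<comment> \<open>The values of \<open>l1\<close> on \<open>dlat Q\<close> form a subgroup of the
    integers; \<open>g\<close> is its positive generator, as division with remainder shows.\<close>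
  define G where "G = {k::nat. k > 0 \<and> (\<exists>x\<in>dlat Q. l1 \<bullet> x = of_nat k)}"
  have "nat m \<in> G" using m(1) b(1) l1(3) by (auto simp: G_def intro!: bexI[of _ b])
  define g where "g = (LEAST k. k \<in> G)"
  have "g \<in> G" unfolding g_def using \<open>nat m \<in> G\<close> by (rule LeastI)
  then obtain x0 where x0: "g > 0" "x0 \<in> dlat Q" "l1 \<bullet> x0 = of_nat g" by (auto simp: G_def)
  have dvd: "\<exists>k::int. l1 \<bullet> x = of_int (int g * k)" if x: "x \<in> dlat Q" for x
  proof -
    obtain k :: int where k: "l1 \<bullet> x = of_int k" using l1_int[OF x] by blast
    let ?y = "x - of_int (k div int g) *\<^sub>R x0"
    have y: "?y \<in> dlat Q" by (rule assms(2)[OF x group_int_mult[OF assms(1,2) x0(2)]])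
    have "k - (k div int g) * int g = k mod int g" by (simp add: minus_div_mult_eq_mod)
    then have "l1 \<bullet> ?y = of_int (k mod int g)"
      using k x0(3) by (metis inner_diff_right inner_scaleR_right of_int_diff of_int_mult
          of_int_of_nat_eq)
    moreover have "0 \<le> k mod int g" "k mod int g < int g" using x0(1) by simp_all
    ultimately have eq: "l1 \<bullet> ?y = of_nat (nat (k mod int g))" "nat (k mod int g) < g" by auto
    have "nat (k mod int g) = 0"
    proof (rule ccontr)
      assume "nat (k mod int g) \<noteq> 0"
      then have "nat (k mod int g) \<in> G" using y eq(1) by (auto simp: G_def)
      then have "g \<le> nat (k mod int g)" unfolding g_def by (rule Least_le)
      then show False using eq(2) by simp
    qed
    then have "int g dvd k" using \<open>0 \<le> k mod int g\<close> by (simp add: dvd_eq_mod_eq_0)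
    then show ?thesis using k by (metis dvdE)
  qed
  let ?l = "(1 / real g) *\<^sub>R l1"
  have "?l \<bullet> x \<in> \<int>" if "x \<in> dlat Q" for x using dvd[OF that] x0(1) by auto
  then have "conormal Q (span B) ?l"
    unfolding conormal_def lat_def using x0 l1 by (auto simp: subspace_mul intro!: bexI[of _ x0])
  then show ?thesis by blast
qed

text \<open>Injectivity of the dual map concerns integral functionals only. To conclude that the
  weights span over the reals, a functional killing them must be produced inside
  \<open>lat Q\<close>: the conormal of a hyperplane that contains them and is spanned by lattice
  vectors.\<close>

lemma tame_of_problem:
  fixes Q :: "('i, 'v::euclidean_space) toric_git"
  assumes "toric_git_problem Q"
  shows "tame Q"
proof -
  have lattice: "is_lattice (dlat Q)" and fin: "finite (idx Q)" and wt: "wt Q ` idx Q \<subseteq> dlat Q"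
    and inj: "inj_on (\<lambda>l. restrict (\<lambda>i. l \<bullet> wt Q i) (idx Q)) (lat Q)"
    using assms by (auto simp: toric_git_problem_def)
  obtain B0 where B0: "dlat Q = int_span B0"
    using lattice unfolding is_lattice_def int_span_def by blast
  have zero: "0 \<in> dlat Q" unfolding B0 by (rule int_spanI[of _ "\<lambda>_. 0"]) simp
  have diff: "x - y \<in> dlat Q" if xy: "x \<in> dlat Q" "y \<in> dlat Q" for x y
  proof -
    obtain n where "x = (\<Sum>b\<in>B0. of_int (n b) *\<^sub>R b)"
      using xy(1) unfolding B0 by (rule int_spanE)
    moreover obtain k where "y = (\<Sum>b\<in>B0. of_int (k b) *\<^sub>R b)"
      using xy(2) unfolding B0 by (rule int_spanE)
    ultimately show ?thesis unfolding B0
      by (intro int_spanI[of _ "\<lambda>b. n b - k b"]) (simp add: scaleR_left_diff_distrib sum_subtractf)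
  qed
  have comm: "\<exists>m>0. \<forall>x\<in>dlat Q \<inter> span B. of_int m *\<^sub>R x \<in> int_span B"
    if "B \<subseteq> dlat Q" "independent B" for B
    using lattice_commensurable[OF lattice that(2,1)] .
  have "span (wt Q ` idx Q) = amb Q"
  proof (rule ccontr)
    assume neq: "span (wt Q ` idx Q) \<noteq> amb Q"
    have sub: "span (wt Q ` idx Q) \<subseteq> amb Q" using wt by (simp add: amb_def span_mono)
    obtain B where B: "B \<subseteq> wt Q ` idx Q" "independent B" "wt Q ` idx Q \<subseteq> span B"
      using maximal_independent_subset by blast
    obtain D where D: "B \<subseteq> D" "D \<subseteq> dlat Q" "independent D" "dlat Q \<subseteq> span D"
      using maximal_independent_subset_extend[of B "dlat Q"] B(1,2) wt by blast
    have spanD: "span D = amb Q"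
      using D(2,4) by (simp add: amb_def span_mono span_minimal subset_antisym)
    have "D \<noteq> B"
    proof
      assume "D = B"
      then have "amb Q \<subseteq> span (wt Q ` idx Q)" using spanD B(1) span_mono by blast
      then show False using neq sub by blast
    qed
    \<comment> \<open>\<open>D\<close> is a basis of \<open>amb Q\<close> by lattice vectors that
      extends a basis of the weight span, so \<open>D - {b}\<close> spans a hyperplane containing
      all weights.\<close>
    then obtain b where b: "b \<in> D" "b \<notin> B" using D(1) by blast
    have ind: "independent (D - {b})" using D(3) independent_mono by blast
    have "dim (amb Q) = card D" unfolding spanD[symmetric] dim_span
      by (rule dim_eq_card_independent[OF D(3)])
    moreover have "dim (span (D - {b})) = card (D - {b})"
      unfolding dim_span by (rule dim_eq_card_independent[OF ind])
    moreover have "card D = Suc (card (D - {b}))"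
      using b independent_imp_finite[OF D(3)] by (intro card.remove) auto
    ultimately have "dim (span (D - {b})) + 1 = dim (amb Q)" by simp
    moreover have "D - {b} \<subseteq> dlat Q" using D by blast
    ultimately obtain l where l: "conormal Q (span (D - {b})) l"
      using exists_conormal[OF zero diff comm _ ind] by blast
    have "l \<bullet> wt Q i = 0" if "i \<in> idx Q" for i
    proof -
      have "wt Q i \<in> span B" using B(3) that by blast
      also have "span B \<subseteq> span (D - {b})" using D(1) b by (intro span_mono) blast
      finally show ?thesis using l by (simp add: conormal_def)
    qed
    then have "restrict (\<lambda>i. l \<bullet> wt Q i) (idx Q) = restrict (\<lambda>i. 0 \<bullet> wt Q i) (idx Q)"
      by (auto intro!: restrict_ext)
    moreover have "0 \<in> lat Q" by (simp add: lat_def subspace_0)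
    ultimately have "l = 0" using inj l unfolding inj_on_def conormal_def by blast
    then show False using l by (auto simp: conormal_def)
  qed
  then show ?thesis unfolding tame_def using fin wt zero diff comm by blast
qed

lemma tame_finite: "tame Q \<Longrightarrow> finite (idx Q)"
  and tame_wt: "tame Q \<Longrightarrow> i \<in> idx Q \<Longrightarrow> wt Q i \<in> dlat Q"
  and tame_span: "tame Q \<Longrightarrow> span (wt Q ` idx Q) = amb Q"
  and tame_zero: "tame Q \<Longrightarrow> 0 \<in> dlat Q"
  and tame_diff: "tame Q \<Longrightarrow> x \<in> dlat Q \<Longrightarrow> y \<in> dlat Q \<Longrightarrow> x - y \<in> dlat Q"
  and tame_comm: "tame Q \<Longrightarrow> B \<subseteq> dlat Q \<Longrightarrow> independent B \<Longrightarrow>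
      \<exists>m>0. \<forall>x\<in>dlat Q \<inter> span B. of_int m *\<^sub>R x \<in> int_span B"
  unfolding tame_def by blast+

lemma tame_wt_amb: "tame Q \<Longrightarrow> i \<in> idx Q \<Longrightarrow> wt Q i \<in> amb Q"
  unfolding amb_def by (intro span_base tame_wt)

lemma tame_int_mult: "tame Q \<Longrightarrow> x \<in> dlat Q \<Longrightarrow> of_int k *\<^sub>R x \<in> dlat Q"
  by (rule group_int_mult) (auto intro: tame_zero tame_diff)

lemma tame_sum: "tame Q \<Longrightarrow> (\<And>i. i \<in> I \<Longrightarrow> f i \<in> dlat Q) \<Longrightarrow> sum f I \<in> dlat Q"
  by (rule group_sum) (auto intro: tame_zero tame_diff)

lemma tame_det: "tame Q \<Longrightarrow> det_wt Q \<in> dlat Q"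
  unfolding det_wt_def by (intro tame_sum tame_wt)

lemma tame_det_amb: "tame Q \<Longrightarrow> det_wt Q \<in> amb Q"
  unfolding amb_def by (intro span_base tame_det)

lemma wcone_subset_amb: "tame Q \<Longrightarrow> S \<subseteq> idx Q \<Longrightarrow> wcone Q S \<subseteq> amb Q"
  using wcone_subset_span[of Q S] span_mono[of "wt Q ` S" "wt Q ` idx Q"] tame_span[of Q] by blast

section \<open>Hyperplanes, conormals and wall degrees\<close>

definition hyperplane :: "('i, 'v::euclidean_space) toric_git \<Rightarrow> 'v set \<Rightarrow> bool" where
  "hyperplane Q V \<longleftrightarrow> subspace V \<and> V \<subseteq> amb Q \<and> dim V + 1 = dim (amb Q)"

lemma hyperplane_stratum_span:
  "dim (stratum_span Q x) + 1 = dim (amb Q) \<longleftrightarrow> hyperplane Q (stratum_span Q x)"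
  by (simp add: hyperplane_def subspace_stratum_span stratum_span_subset_amb)

lemma hyperplane_neq: "hyperplane Q V \<Longrightarrow> V \<noteq> amb Q"
  by (auto simp: hyperplane_def)

lemma hyperplane_maximal:
  assumes "hyperplane Q V" "subspace U" "V \<subseteq> U" "U \<subseteq> amb Q" "U \<noteq> amb Q"
  shows "U = V"
proof (rule ccontr)
  assume "U \<noteq> V"
  then obtain x where x: "x \<in> U" "x \<notin> V" using assms(3) by blast
  have "span (insert x V) = amb Q"
    using assms(1) x assms(4) by (intro span_insert_hyperplane) (auto simp: hyperplane_def)
  moreover have "span (insert x V) \<subseteq> U" using x assms(2,3) by (intro span_minimal) auto
  ultimately show False using assms(4,5) by blast
qed

text \<open>The difference lies in \<open>amb Q\<close> and is orthogonal to \<open>V\<close> and to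
  \<open>x\<close>, which together span \<open>amb Q\<close>; so it is orthogonal to itself.\<close>

lemma conormal_unique:
  assumes "hyperplane Q V" "conormal Q V l'" "x \<in> dlat Q" "l' \<bullet> x = 1"
    and "l \<in> amb Q" "\<And>v. v \<in> V \<Longrightarrow> l \<bullet> v = 0"
  shows "l = (l \<bullet> x) *\<^sub>R l'"
proof -
  let ?d = "l - (l \<bullet> x) *\<^sub>R l'"
  have l': "l' \<in> amb Q" "\<And>v. v \<in> V \<Longrightarrow> l' \<bullet> v = 0" using assms(2) by (auto simp: conormal_def lat_def)
  have "x \<in> amb Q" using assms(3) by (simp add: amb_def span_base)
  moreover have "x \<notin> V" using l'(2)[of x] assms(4) by auto
  ultimately have "span (insert x V) = amb Q"
    using assms(1) by (intro span_insert_hyperplane) (auto simp: hyperplane_def)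
  then have d: "?d \<in> span (insert x V)" using l'(1) assms(5) by (simp add: subspace_diff subspace_mul)
  have "orthogonal ?d y" if "y \<in> insert x V" for y
    using that l' assms(4,6) unfolding orthogonal_def by (auto simp: inner_diff_left)
  then have "orthogonal ?d ?d" using orthogonal_to_span[OF d] by blast
  then show ?thesis by (simp add: orthogonal_self)
qed

lemma conormal_int:
  "conormal Q V l \<Longrightarrow> x \<in> dlat Q \<Longrightarrow> \<exists>k::int. l \<bullet> x = of_int k"
  by (auto simp: conormal_def lat_def elim!: Ints_cases)

text \<open>Evaluates the definite description: any primitive vector orthogonal to \<open>W\<close>
  is an integer multiple of \<open>l\<close> by \<open>conormal_unique\<close>, and primitivity
  makes that integer 1 or -1.\<close>

lemma wall_degree_eq:
  assumes "tame Q" "hyperplane Q (span W)" "conormal Q (span W) l"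
  shows "real (wall_degree Q W) = \<bar>l \<bullet> det_wt Q\<bar>"
proof -
  obtain x0 where x0: "x0 \<in> dlat Q" "l \<bullet> x0 = 1" using assms(3) by (auto simp: conormal_def)
  have l: "l \<in> lat Q" "\<And>w. w \<in> W \<Longrightarrow> l \<bullet> w = 0"
    using assms(3) by (auto simp: conormal_def span_base)
  obtain k :: int where k: "l \<bullet> det_wt Q = of_int k"
    using conormal_int[OF assms(3) tame_det[OF assms(1)]] by blast
  have "primitive Q l" unfolding primitive_def
  proof (intro conjI ballI allI impI)
    show "l \<noteq> 0" using x0 by auto
    fix m and n :: int assume m: "m \<in> lat Q" "l = of_int n *\<^sub>R m"
    obtain j :: int where "m \<bullet> x0 = of_int j"
      using m(1) x0(1) by (auto simp: lat_def elim: Ints_cases)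
    then have "real_of_int (n * j) = of_int 1" using m(2) x0(2) by simp
    then have "n * j = 1" using of_int_eq_iff by blast
    then show "\<bar>n\<bar> = 1" by (simp add: zmult_eq_1_iff) auto
  qed (rule l(1))
  moreover have "\<bar>l' \<bullet> det_wt Q\<bar> = \<bar>l \<bullet> det_wt Q\<bar>"
    if l': "primitive Q l'" "\<forall>w\<in>W. l' \<bullet> w = 0" for l'
  proof -
    have lat: "l' \<in> lat Q" using l' by (simp add: primitive_def)
    have "l' \<bullet> v = 0" if "v \<in> span W" for v
      using orthogonal_to_span[OF that, of l'] l'(2) by (simp add: orthogonal_def)
    moreover have "l' \<in> amb Q" using lat by (simp add: lat_def)
    ultimately have eq: "l' = (l' \<bullet> x0) *\<^sub>R l"
      using conormal_unique[OF assms(2,3) x0] by blast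
    obtain j :: int where j: "l' \<bullet> x0 = of_int j"
      using lat x0(1) by (auto simp: lat_def elim: Ints_cases)
    have "\<bar>j\<bar> = 1" using l'(1) l(1) eq j unfolding primitive_def by metis
    moreover have "l' = of_int j *\<^sub>R l" using eq j by simp
    ultimately show ?thesis by (simp add: abs_mult flip: of_int_abs)
  qed
  ultimately have "wall_degree Q W = nat \<bar>k\<bar>"
    unfolding wall_degree_def using l(2) k
    by (intro the_equality) (auto intro!: exI[of _ l])
  then show ?thesis using k by simp
qed

lemma tame_conormal:
  assumes "tame Q" "hyperplane Q (span (wt Q ` S))" "S \<subseteq> idx Q"
  shows "\<exists>l. conormal Q (span (wt Q ` S)) l"
proof -
  obtain B where B: "B \<subseteq> wt Q ` S" "independent B" "wt Q ` S \<subseteq> span B"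
    using maximal_independent_subset by blast
  have sp: "span B = span (wt Q ` S)"
    by (intro equalityI span_mono[OF B(1)] span_minimal[OF B(3) subspace_span])
  have sub: "B \<subseteq> dlat Q" using B(1) assms(3) tame_wt[OF assms(1)] by blast
  have "\<exists>l. conormal Q (span B) l"
  proof (rule exists_conormal[OF tame_zero[OF assms(1)] tame_diff[OF assms(1)]
        tame_comm[OF assms(1)] sub B(2)])
    show "dim (span B) + 1 = dim (amb Q)" using assms(2) unfolding sp hyperplane_def by blast
  qed
  then show ?thesis unfolding sp .
qed

section \<open>Higgs problems\<close>

lemma higgs_simps [simp]:
  "dlat (higgs Q H) = dlat Q \<inter> H" "idx (higgs Q H) = idx_in Q H" "wt (higgs Q H) = wt Q"
  by (simp_all add: higgs_def)

lemma wcone_higgs [simp]: "wcone (higgs Q H) S = wcone Q S"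
  by (simp add: wcone_def)

lemma weight_supported_subspace: "weight_supported Q H \<Longrightarrow> subspace H"
  unfolding weight_supported_def by (metis subspace_span)

lemma amb_higgs:
  assumes "tame Q" "weight_supported Q H"
  shows "amb (higgs Q H) = H"
proof
  show "amb (higgs Q H) \<subseteq> H"
    unfolding amb_def using weight_supported_subspace[OF assms(2)] by (intro span_minimal) auto
  have "wt Q ` idx_in Q H \<subseteq> dlat Q \<inter> H" using assms(1) by (auto simp: idx_in_def tame_wt)
  then have "span (wt Q ` idx_in Q H) \<subseteq> amb (higgs Q H)"
    unfolding amb_def higgs_simps by (rule span_mono)
  then show "H \<subseteq> amb (higgs Q H)" using assms(2) unfolding weight_supported_def by blast
qed

lemma tame_higgs:
  assumes "tame Q" "weight_supported Q H"
  shows "tame (higgs Q H)"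
proof -
  have "\<exists>m>0. \<forall>x\<in>dlat Q \<inter> H \<inter> span B. of_int m *\<^sub>R x \<in> int_span B"
    if "B \<subseteq> dlat Q \<inter> H" "independent B" for B
    using tame_comm[OF assms(1), of B] that by blast
  moreover have "span (wt Q ` idx_in Q H) = H"
    using assms(2) unfolding weight_supported_def by (rule sym)
  ultimately show ?thesis
    using assms weight_supported_subspace[OF assms(2)] tame_finite[OF assms(1)]
    unfolding tame_def amb_higgs[OF assms] higgs_simps
    by (auto simp: idx_in_def subspace_0 subspace_diff)
qed

text \<open>Some cone containing \<open>x\<close> has a proper span; a free subset carrying
  \<open>x\<close> still spans at least the wall, and codimension one leaves no room in
  between.\<close>

lemma wall_basis:
  assumes "tame Q" "x \<in> amb Q" "hyperplane Q (stratum_span Q x)"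
  obtains S t where "S \<subseteq> idx Q" "wt_free Q S" "\<And>i. i \<in> S \<Longrightarrow> 0 < t i"
    "x = (\<Sum>i\<in>S. t i *\<^sub>R wt Q i)" "span (wt Q ` S) = stratum_span Q x"
proof -
  obtain T where T: "T \<subseteq> idx Q" "x \<in> wcone Q T" "\<not> amb Q \<subseteq> span (wt Q ` T)"
  proof -
    have "\<not> amb Q \<subseteq> stratum_span Q x"
      using hyperplane_neq[OF assms(3)] stratum_span_subset_amb[of Q x] by blast
    then show ?thesis using that unfolding stratum_span_def by blast
  qed
  have "finite T" using T(1) tame_finite[OF assms(1)] finite_subset by blast
  then obtain S t where S: "S \<subseteq> T" "wt_free Q S" "\<And>i. i \<in> S \<Longrightarrow> 0 < t i"
    "x = (\<Sum>i\<in>S. t i *\<^sub>R wt Q i)"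
    using T(2) by (rule wcone_caratheodory) (rule that)
  have "x \<in> wcone Q S" using S(3,4) by (intro wconeI[of S t]) (auto intro: less_imp_le)
  then have "stratum_span Q x \<subseteq> span (wt Q ` S)"
    using S(1) T(1) by (intro stratum_span_subset_span) auto
  moreover have "span (wt Q ` S) \<subseteq> span (wt Q ` T)" using S(1) by (intro span_mono) auto
  moreover have "span (wt Q ` T) \<subseteq> amb Q"
    using T(1) tame_span[OF assms(1)] span_mono[of "wt Q ` T" "wt Q ` idx Q"] by blast
  ultimately have "span (wt Q ` S) = stratum_span Q x"
    using T(3) by (intro hyperplane_maximal[OF assms(3)]) auto
  then show ?thesis using that S T(1) by blast
qed

lemma span_weights_supported:
  assumes "S \<subseteq> idx Q"
  shows "weight_supported Q (span (wt Q ` S))"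
  unfolding weight_supported_def
proof
  have "wt Q ` S \<subseteq> wt Q ` idx_in Q (span (wt Q ` S))"
    using assms by (auto simp: idx_in_def intro!: imageI span_base)
  then show "span (wt Q ` S) \<subseteq> span (wt Q ` idx_in Q (span (wt Q ` S)))" by (rule span_mono)
  show "span (wt Q ` idx_in Q (span (wt Q ` S))) \<subseteq> span (wt Q ` S)"
    by (intro span_minimal) (auto simp: idx_in_def)
qed

lemma wall_supported:
  assumes "tame Q" "x \<in> amb Q" "hyperplane Q (stratum_span Q x)"
  shows "weight_supported Q (stratum_span Q x)"
  using wall_basis[OF assms] span_weights_supported by metis

lemma wall_conormal:
  assumes "tame Q" "x \<in> amb Q" "hyperplane Q (stratum_span Q x)"
  shows "\<exists>l. conormal Q (stratum_span Q x) l"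
  using wall_basis[OF assms] tame_conormal[OF assms(1)] assms(3) by metis

text \<open>The Higgs problem tests only cones of weights in the wall span. Those containing
  \<open>x\<close> already span all of it, and with fewer conditions the stratum can only
  grow.\<close>

lemma higgs_wall_chamber:
  assumes "tame Q" "x \<in> amb Q" "hyperplane Q (stratum_span Q x)"
  shows "x \<in> amb (higgs Q (stratum_span Q x))"
    and "stratum_span (higgs Q (stratum_span Q x)) x = amb (higgs Q (stratum_span Q x))"
    and "stratum Q x \<subseteq> stratum (higgs Q (stratum_span Q x)) x"
proof -
  let ?V = "stratum_span Q x"
  have amb: "amb (higgs Q ?V) = ?V" by (rule amb_higgs[OF assms(1) wall_supported[OF assms]])
  show "x \<in> amb (higgs Q ?V)" unfolding amb by (rule self_in_stratum_span[OF assms(2)])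
  have sub: "idx_in Q ?V \<subseteq> idx Q" by (auto simp: idx_in_def)
  show "stratum_span (higgs Q ?V) x = amb (higgs Q ?V)"
  proof
    show "amb (higgs Q ?V) \<subseteq> stratum_span (higgs Q ?V) x"
    proof
      fix v assume "v \<in> amb (higgs Q ?V)"
      then have "v \<in> span (wt Q ` S)" if "S \<subseteq> idx_in Q ?V" "x \<in> wcone Q S" for S
        using stratum_span_subset_span[of S Q x] that sub unfolding amb by blast
      with \<open>v \<in> amb (higgs Q ?V)\<close> show "v \<in> stratum_span (higgs Q ?V) x"
        unfolding stratum_span_def[of "higgs Q ?V"] higgs_simps wcone_higgs by blast
    qed
  qed (rule stratum_span_subset_amb)
  show "stratum Q x \<subseteq> stratum (higgs Q ?V) x"
  proof
    fix y assume y: "y \<in> stratum Q x"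
    then have "y \<in> ?V" using stratum_subset_stratum_span by blast
    moreover have "x \<in> wcone Q S \<longleftrightarrow> y \<in> wcone Q S" if "S \<subseteq> idx_in Q ?V" for S
      using y that sub unfolding stratum_def by blast
    ultimately show "y \<in> stratum (higgs Q ?V) x"
      unfolding stratum_def[of "higgs Q ?V"] higgs_simps wcone_higgs amb by blast
  qed
qed

lemma higgs_amb: "tame Q \<Longrightarrow> higgs Q (amb Q) = Q"
proof -
  assume Q: "tame Q"
  have "dlat Q \<inter> amb Q = dlat Q" by (auto simp: amb_def span_base)
  moreover have "idx_in Q (amb Q) = idx Q" using tame_wt_amb[OF Q] by (auto simp: idx_in_def)
  ultimately show ?thesis by (simp add: higgs_def)
qed

lemma higgs_higgs:
  assumes "H \<subseteq> V"
  shows "higgs (higgs Q V) H = higgs Q H"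
proof -
  have "dlat Q \<inter> V \<inter> H = dlat Q \<inter> H" "idx_in (higgs Q V) H = idx_in Q H"
    using assms by (auto simp: idx_in_def)
  then show ?thesis by (simp add: higgs_def)
qed

lemma relevant_higgs:
  assumes "H \<subseteq> V"
  shows "relevant (higgs Q V) H \<longleftrightarrow> relevant Q H"
proof -
  have "idx_in (higgs Q V) H = idx_in Q H" using assms by (auto simp: idx_in_def)
  then show ?thesis by (simp add: relevant_def weight_supported_def)
qed

section \<open>The Euler characteristic of a phase\<close>

text \<open>The index in \<open>dlat Q\<close> of the sublattice generated by the weights in \<open>S\<close>.\<close>

definition box_index :: "('i, 'v::euclidean_space) toric_git \<Rightarrow> 'i set \<Rightarrow> nat" where
  "box_index Q S = card {x \<in> dlat Q. \<exists>t. (\<forall>i\<in>S. 0 \<le> t i \<and> t i < 1) \<and> x = (\<Sum>i\<in>S. t i *\<^sub>R wt Q i)}"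

lemma card_int_box:
  fixes a :: int
  assumes "a \<noteq> 0"
  shows "card {k::int. 0 \<le> real_of_int k / of_int a \<and> real_of_int k / of_int a < 1} = nat \<bar>a\<bar>"
proof (cases "a > 0")
  case True
  then have "{k::int. 0 \<le> real_of_int k / of_int a \<and> real_of_int k / of_int a < 1} = {0..<a}"
    by (auto simp: zero_le_divide_iff)
  then show ?thesis using True by simp
next
  case False
  then have "{k::int. 0 \<le> real_of_int k / of_int a \<and> real_of_int k / of_int a < 1} = {a<..0}"
    using assms by (auto simp: zero_le_divide_iff divide_less_eq)
  then show ?thesis using False by simp
qed

lemma conormal_off_hyperplane:
  assumes "hyperplane Q V" "conormal Q V l" "x \<in> amb Q" "x \<notin> V"
  shows "l \<bullet> x \<noteq> 0"
proof
  assume "l \<bullet> x = 0"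
  have l: "l \<in> amb Q" "\<And>v. v \<in> V \<Longrightarrow> l \<bullet> v = 0" using assms(2) by (auto simp: conormal_def lat_def)
  have "span (insert x V) = amb Q"
    using assms by (intro span_insert_hyperplane) (auto simp: hyperplane_def)
  then have "l \<in> span (insert x V)" using l(1) by simp
  moreover have "orthogonal l y" if "y \<in> insert x V" for y
    using that l(2) \<open>l \<bullet> x = 0\<close> by (auto simp: orthogonal_def)
  ultimately have "orthogonal l l" using orthogonal_to_span by blast
  then show False using assms(2) by (auto simp: orthogonal_self conormal_def)
qed

lemma wt_free_insert:
  assumes "wt_free Q S" "wt Q j \<notin> span (wt Q ` S)"
  shows "wt_free Q (insert j S)" "j \<notin> S"
proof -
  have j: "wt Q j \<notin> wt Q ` S" using assms(2) span_base[of "wt Q j" "wt Q ` S"] by blast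
  then show "j \<notin> S" by blast
  show "wt_free Q (insert j S)" unfolding wt_free_def
  proof
    show "inj_on (wt Q) (insert j S)" using j assms(1) unfolding wt_free_def by (simp add: inj_on_insert) blast
    show "independent (wt Q ` insert j S)"
      using j assms unfolding wt_free_def image_insert independent_insert by simp
  qed
qed

text \<open>The half-open box of the larger set is sliced by the integer value \<open>k\<close> of
  \<open>l\<close>. There are as many slices as the absolute value of \<open>l\<close> at the new
  weight, and each is matched with the box of \<open>S\<close> by shifting along \<open>x0\<close>
  and reducing modulo the weights in \<open>S\<close>.\<close>

lemma box_index_insert:
  fixes Q :: "('i, 'v::euclidean_space) toric_git"
  assumes Q: "tame Q" and V: "hyperplane Q V" and l: "conormal Q V l"
    and S: "S \<subseteq> idx Q" "wt_free Q S" "span (wt Q ` S) = V"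
    and j: "j \<in> idx Q" "wt Q j \<notin> V"
  shows "real (box_index Q (insert j S)) = \<bar>l \<bullet> wt Q j\<bar> * real (box_index (higgs Q V) S)"
proof -
  let ?S = "insert j S"
  have finS: "finite S" using S(1) tame_finite[OF Q] finite_subset by blast
  have free: "wt_free Q ?S" and jS: "j \<notin> S" using wt_free_insert[OF S(2)] j(2) S(3) by auto
  have Vs: "subspace V" using V by (simp add: hyperplane_def)
  have sp: "span (wt Q ` ?S) = amb Q"
  proof -
    have "span (insert (wt Q j) V) = amb Q"
      using V j tame_wt_amb[OF Q] by (intro span_insert_hyperplane) (auto simp: hyperplane_def)
    then show ?thesis unfolding S(3)[symmetric] by (simp add: span_insert span_span)
  qed
  obtain x0 where x0: "x0 \<in> dlat Q" "l \<bullet> x0 = 1" using l by (auto simp: conormal_def)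
  have lV: "l \<bullet> v = 0" if "v \<in> V" for v using l that by (simp add: conormal_def)
  have wtV: "wt Q i \<in> V" if "i \<in> S" for i using S(3) that by (auto intro: span_base)
  obtain a :: int where a: "l \<bullet> wt Q j = of_int a"
    using conormal_int[OF l tame_wt[OF Q j(1)]] by blast
  have a0: "a \<noteq> 0" using conormal_off_hyperplane[OF V l tame_wt_amb[OF Q j(1)] j(2)] a by simp
  have amb: "x \<in> amb Q" if "x \<in> dlat Q" for x using that by (simp add: amb_def span_base)
  obtain f where f: "\<And>i. i \<in> ?S \<Longrightarrow> linear (f i)"
    "\<And>t i. i \<in> ?S \<Longrightarrow> f i (\<Sum>j\<in>?S. t j *\<^sub>R wt Q j) = t i"
    "\<And>x. x \<in> span (wt Q ` ?S) \<Longrightarrow> x = (\<Sum>j\<in>?S. f j x *\<^sub>R wt Q j)"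
    using finS by (rule wt_free_coords[OF free finite_insert[THEN iffD2]]) (rule that)
  have f_S: "f i (\<Sum>k\<in>S. t k *\<^sub>R wt Q k) = t i" if "i \<in> S" for t i
  proof -
    have "(\<Sum>k\<in>?S. (if k = j then 0 else t k) *\<^sub>R wt Q k)
        = (\<Sum>k\<in>S. (if k = j then 0 else t k) *\<^sub>R wt Q k)"
      using finS jS by simp
    also have "\<dots> = (\<Sum>k\<in>S. t k *\<^sub>R wt Q k)" using jS by (intro sum.cong) auto
    finally show ?thesis using f(2)[of i "\<lambda>k. if k = j then 0 else t k"] that jS by auto
  qed
  have l_sum: "l \<bullet> (\<Sum>k\<in>?S. t k *\<^sub>R wt Q k) = t j * of_int a" for t
    using finS jS a lV wtV by (simp add: inner_add_right inner_sum_right)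
  have l_sumS: "l \<bullet> (\<Sum>k\<in>S. t k *\<^sub>R wt Q k) = 0" for t
    using lV wtV by (simp add: inner_sum_right)
  have fj: "f j x = l \<bullet> x / of_int a" if "x \<in> amb Q" for x
  proof -
    have "x = (\<Sum>k\<in>?S. f k x *\<^sub>R wt Q k)" using f(3) that sp by blast
    then have "l \<bullet> x = f j x * of_int a" using l_sum[of "\<lambda>k. f k x"] by simp
    then show ?thesis using a0 by simp
  qed
  \<comment> \<open>Reduces the coordinates along \<open>S\<close> to their fractional parts and
    leaves the coordinate along \<open>j\<close> alone.\<close>
  let ?red = "\<lambda>z. z - (\<Sum>i\<in>S. of_int \<lfloor>f i z\<rfloor> *\<^sub>R wt Q i)"
  have red_dlat: "?red z \<in> dlat Q" if "z \<in> dlat Q" for z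
    using that S(1) by (intro tame_diff[OF Q] tame_sum[OF Q] tame_int_mult[OF Q] tame_wt[OF Q]) auto
  have red_eq: "?red z = (\<Sum>k\<in>?S. (if k = j then f j z else frac (f k z)) *\<^sub>R wt Q k)"
    if "z \<in> amb Q" for z
  proof -
    have "z = (\<Sum>k\<in>?S. f k z *\<^sub>R wt Q k)" using f(3) that sp by blast
    also have "\<dots> = f j z *\<^sub>R wt Q j + (\<Sum>k\<in>S. f k z *\<^sub>R wt Q k)" using finS jS by simp
    finally have "?red z = f j z *\<^sub>R wt Q j + (\<Sum>k\<in>S. frac (f k z) *\<^sub>R wt Q k)"
      by (simp add: frac_def scaleR_left_diff_distrib sum_subtractf algebra_simps)
    also have "(\<Sum>k\<in>S. frac (f k z) *\<^sub>R wt Q k)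
        = (\<Sum>k\<in>S. (if k = j then f j z else frac (f k z)) *\<^sub>R wt Q k)"
      using jS by (intro sum.cong) auto
    finally show ?thesis using finS jS by simp
  qed
  let ?P = "\<lambda>\<Lambda> S. {x \<in> \<Lambda>. \<exists>t. (\<forall>i\<in>S. 0 \<le> t i \<and> t i < (1::real)) \<and> x = (\<Sum>i\<in>S. t i *\<^sub>R wt Q i)}"
  let ?K = "{k::int. 0 \<le> real_of_int k / of_int a \<and> real_of_int k / of_int a < 1}"
  \<comment> \<open>From a slice \<open>k\<close> and a box point \<open>y\<close> in
    \<open>V\<close> to the point of the larger box congruent to \<open>y + k x0\<close> modulo the
    weights in \<open>S\<close>.\<close>
  let ?\<Psi> = "\<lambda>(k::int, y). ?red (y + of_int k *\<^sub>R x0)"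
  have z_dlat: "y + of_int k *\<^sub>R x0 \<in> dlat Q" if "y \<in> dlat Q" for y and k :: int
    using tame_diff[OF Q that tame_int_mult[OF Q x0(1), of "-k"]] by simp
  have P0: "y \<in> dlat Q" "l \<bullet> y = 0" "y = (\<Sum>i\<in>S. f i y *\<^sub>R wt Q i)"
    "\<And>i. i \<in> S \<Longrightarrow> 0 \<le> f i y \<and> f i y < 1" if y: "y \<in> ?P (dlat Q \<inter> V) S" for y
  proof -
    obtain t where t: "\<forall>i\<in>S. 0 \<le> t i \<and> t i < 1" "y = (\<Sum>i\<in>S. t i *\<^sub>R wt Q i)" using y by blast
    show "y \<in> dlat Q" "l \<bullet> y = 0" using y lV by auto
    have ft: "f i y = t i" if "i \<in> S" for i using f_S[OF that] t(2) by simp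
    then show "\<And>i. i \<in> S \<Longrightarrow> 0 \<le> f i y \<and> f i y < 1" using t(1) by simp
    have "(\<Sum>i\<in>S. f i y *\<^sub>R wt Q i) = (\<Sum>i\<in>S. t i *\<^sub>R wt Q i)" by (intro sum.cong) (simp_all add: ft)
    then show "y = (\<Sum>i\<in>S. f i y *\<^sub>R wt Q i)" using t(2) by simp
  qed
  have "bij_betw ?\<Psi> (?K \<times> ?P (dlat Q \<inter> V) S) (?P (dlat Q) ?S)"
    unfolding bij_betw_def
  proof
    show "inj_on ?\<Psi> (?K \<times> ?P (dlat Q \<inter> V) S)"
    proof (rule inj_onI)
      fix p p'
      assume p: "p \<in> ?K \<times> ?P (dlat Q \<inter> V) S" "p' \<in> ?K \<times> ?P (dlat Q \<inter> V) S" "?\<Psi> p = ?\<Psi> p'"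
      obtain k y k' y' where kp: "p = (k, y)" "p' = (k', y')" by (metis surj_pair)
      have yP: "y \<in> ?P (dlat Q \<inter> V) S" "y' \<in> ?P (dlat Q \<inter> V) S"
        using p(1,2) unfolding kp by blast+
      have eq: "?red (y + of_int k *\<^sub>R x0) = ?red (y' + of_int k' *\<^sub>R x0)"
        using p(3) unfolding kp by simp
      \<comment> \<open>\<open>l\<close> recovers the slice, because both \<open>y\<close> and the
        subtracted weights lie in its kernel.\<close>
      have lred: "l \<bullet> ?red (y + of_int k *\<^sub>R x0) = of_int k"
        if "y \<in> ?P (dlat Q \<inter> V) S" for y k
        using P0(2)[OF that] x0(2) l_sumS by (simp add: inner_diff_right inner_add_right)
      have "real_of_int k = l \<bullet> ?red (y + of_int k *\<^sub>R x0)" by (rule lred[OF yP(1), symmetric])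
      also have "\<dots> = l \<bullet> ?red (y' + of_int k' *\<^sub>R x0)" by (simp only: eq)
      also have "\<dots> = of_int k'" by (rule lred[OF yP(2)])
      finally have k: "k = k'" by simp
      \<comment> \<open>The two box points differ by an integer combination of the weights in
        \<open>S\<close>, yet their coordinates differ by less than 1.\<close>
      define n where "n i = \<lfloor>f i (y + of_int k *\<^sub>R x0)\<rfloor> - \<lfloor>f i (y' + of_int k *\<^sub>R x0)\<rfloor>" for i
      have "y - y' = (\<Sum>i\<in>S. of_int (n i) *\<^sub>R wt Q i)"
        using eq k by (simp add: n_def scaleR_left_diff_distrib sum_subtractf algebra_simps)
      then have "f i (y - y') = of_int (n i)" if "i \<in> S" for i
        using f_S[OF that, of "\<lambda>i. of_int (n i)"] by simp
      then have d: "f i y - f i y' = of_int (n i)" if "i \<in> S" for i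
        using linear_diff[OF f(1)[of i], of y y'] that by simp
      have "f i y = f i y'" if i: "i \<in> S" for i
      proof -
        have "\<bar>real_of_int (n i)\<bar> < 1" using d[OF i] P0(4)[OF yP(1) i] P0(4)[OF yP(2) i] by linarith
        then have "n i = 0" by linarith
        then show ?thesis using d[OF i] by simp
      qed
      then have "y = y'" using P0(3)[OF yP(1)] P0(3)[OF yP(2)] by (metis (no_types, lifting) sum.cong)
      then show "p = p'" using k kp by blast
    qed
    show "?\<Psi> ` (?K \<times> ?P (dlat Q \<inter> V) S) = ?P (dlat Q) ?S"
    proof
      show "?\<Psi> ` (?K \<times> ?P (dlat Q \<inter> V) S) \<subseteq> ?P (dlat Q) ?S"
      proof (rule image_subsetI)
        fix p assume p: "p \<in> ?K \<times> ?P (dlat Q \<inter> V) S"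
        obtain k y where kp: "p = (k, y)" by (metis surj_pair)
        have k: "0 \<le> real_of_int k / of_int a" "real_of_int k / of_int a < 1"
          and y: "y \<in> dlat Q" "y \<in> V"
          using p unfolding kp by blast+
        let ?z = "y + of_int k *\<^sub>R x0"
        have z: "?z \<in> dlat Q" by (rule z_dlat[OF y(1)])
        have "f j ?z = of_int k / of_int a"
          using fj[OF amb[OF z]] lV[OF y(2)] x0(2) by (simp add: inner_add_right)
        then have "\<forall>i\<in>?S. 0 \<le> (if i = j then f j ?z else frac (f i ?z)) \<and>
            (if i = j then f j ?z else frac (f i ?z)) < 1"
          using k by (simp add: frac_ge_0 frac_lt_1)
        then have "?red ?z \<in> ?P (dlat Q) ?S"
          using red_eq[OF amb[OF z]] red_dlat[OF z]
          by (intro CollectI conjI exI[of _ "\<lambda>i. if i = j then f j ?z else frac (f i ?z)"])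
        then show "?\<Psi> p \<in> ?P (dlat Q) ?S" unfolding kp by simp
      qed
      show "?P (dlat Q) ?S \<subseteq> ?\<Psi> ` (?K \<times> ?P (dlat Q \<inter> V) S)"
      proof
        fix x assume "x \<in> ?P (dlat Q) ?S"
        then obtain t where x: "x \<in> dlat Q" and t: "\<forall>i\<in>?S. 0 \<le> t i \<and> t i < 1"
          and xt: "x = (\<Sum>i\<in>?S. t i *\<^sub>R wt Q i)" by blast
        have ft: "f i x = t i" if "i \<in> ?S" for i using f(2)[OF that] xt by simp
        obtain k :: int where k: "l \<bullet> x = of_int k" using conormal_int[OF l x] by blast
        have "t j = of_int k / of_int a" using fj[OF amb[OF x]] ft[of j] k by simp
        then have kK: "k \<in> ?K" using t by auto
        let ?u = "x - of_int k *\<^sub>R x0"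
        have y0: "?u \<in> dlat Q" by (rule tame_diff[OF Q x tame_int_mult[OF Q x0(1)]])
        have l0: "l \<bullet> ?u = 0" using k x0(2) by (simp add: inner_diff_right)
        have "?u \<in> V"
          using conormal_off_hyperplane[OF V l amb[OF y0]] l0 by blast
        let ?y = "?red ?u"
        have fj0: "f j ?u = 0" unfolding fj[OF amb[OF y0]] l0 by simp
        have "?y = (\<Sum>k\<in>?S. (if k = j then f j ?u else frac (f k ?u)) *\<^sub>R wt Q k)"
          by (rule red_eq[OF amb[OF y0]])
        also have "\<dots> = (\<Sum>k\<in>S. (if k = j then f j ?u else frac (f k ?u)) *\<^sub>R wt Q k)"
          using finS jS fj0 by simp
        also have "\<dots> = (\<Sum>k\<in>S. frac (f k ?u) *\<^sub>R wt Q k)"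
          using jS by (intro sum.cong) auto
        finally have y_eq: "?y = (\<Sum>k\<in>S. frac (f k ?u) *\<^sub>R wt Q k)" .
        have "?y \<in> V"
          unfolding y_eq using wtV by (intro subspace_sum[OF Vs] subspace_mul[OF Vs])
        then have yP: "?y \<in> ?P (dlat Q \<inter> V) S"
          using red_dlat[OF y0] y_eq
          by (intro CollectI conjI IntI exI[of _ "\<lambda>k. frac (f k ?u)"]) (auto simp: frac_lt_1)
        \<comment> \<open>Reducing after adding \<open>k x0\<close> back undoes the first reduction:
          the coordinates of \<open>x\<close> along \<open>S\<close> lie in [0,1), so the second
          floor is exactly \<open>- m i\<close>.\<close>
        define m where "m i = \<lfloor>f i ?u\<rfloor>" for i
        have z: "?y + of_int k *\<^sub>R x0 = x - (\<Sum>i\<in>S. of_int (m i) *\<^sub>R wt Q i)"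
          by (simp add: m_def)
        have "\<lfloor>f i (?y + of_int k *\<^sub>R x0)\<rfloor> = - m i" if i: "i \<in> S" for i
        proof -
          have "f i (?y + of_int k *\<^sub>R x0) = t i - of_int (m i)"
            unfolding z using linear_diff[OF f(1)[of i]] ft[of i] f_S[OF i, of "\<lambda>i. of_int (m i)"] i
            by simp
          then show ?thesis using t i by (simp add: floor_eq_iff)
        qed
        then have "(\<Sum>i\<in>S. of_int \<lfloor>f i (?y + of_int k *\<^sub>R x0)\<rfloor> *\<^sub>R wt Q i)
            = (\<Sum>i\<in>S. - (of_int (m i) *\<^sub>R wt Q i))"
          by (intro sum.cong) auto
        then have "?red (?y + of_int k *\<^sub>R x0) = x"
          unfolding z by (simp add: sum_negf)
        then have "x = ?\<Psi> (k, ?y)" by simp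
        then show "x \<in> ?\<Psi> ` (?K \<times> ?P (dlat Q \<inter> V) S)" using kK yP by blast
      qed
    qed
  qed
  from bij_betw_same_card[OF this]
  have "box_index Q ?S = nat \<bar>a\<bar> * box_index (higgs Q V) S"
    unfolding card_cartesian_product card_int_box[OF a0] box_index_def higgs_simps by (rule sym)
  then show ?thesis using a by simp
qed

section \<open>The sum over bases and its behaviour near a wall\<close>

definition bases :: "('i, 'v::euclidean_space) toric_git \<Rightarrow> 'i set set" where
  "bases Q = {S. S \<subseteq> idx Q \<and> wt_free Q S \<and> span (wt Q ` S) = amb Q}"

text \<open>
  The Euler characteristic of \<open>X\<^sub>c\<close>, for \<open>c\<close> in a chamber: the torus-fixed points correspond to the
  bases whose cone contains \<open>c\<close>, and such a point contributes the order of its isotropy group.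
\<close>

definition chi :: "('i, 'v::euclidean_space) toric_git \<Rightarrow> 'v \<Rightarrow> real" where
  "chi Q x = (\<Sum>S | S \<in> bases Q \<and> x \<in> wcone Q S. real (box_index Q S))"

lemma finite_bases: "tame Q \<Longrightarrow> finite (bases Q)"
  by (rule finite_subset[of _ "Pow (idx Q)"]) (auto simp: bases_def tame_finite)

lemma chi_sum:
  assumes "tame Q"
  shows "chi Q x = (\<Sum>S\<in>bases Q. if x \<in> wcone Q S then real (box_index Q S) else 0)"
  unfolding chi_def by (subst sum.inter_filter[OF finite_bases[OF assms]]) (rule refl)

lemma chi_cong:
  assumes "y \<in> stratum Q x"
  shows "chi Q y = chi Q x"
proof -
  have "{S \<in> bases Q. y \<in> wcone Q S} = {S \<in> bases Q. x \<in> wcone Q S}"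
    using assms unfolding stratum_def bases_def by blast
  then show ?thesis unfolding chi_def by (rule arg_cong)
qed

lemma in_wcone_iff_coords:
  assumes "\<And>t i. i \<in> S \<Longrightarrow> f i (\<Sum>j\<in>S. t j *\<^sub>R wt Q j) = t i"
    and "x = (\<Sum>j\<in>S. f j x *\<^sub>R wt Q j)"
  shows "x \<in> wcone Q S \<longleftrightarrow> (\<forall>i\<in>S. 0 \<le> f i x)"
proof
  assume "x \<in> wcone Q S"
  then obtain t where "\<forall>i\<in>S. 0 \<le> t i" "x = (\<Sum>i\<in>S. t i *\<^sub>R wt Q i)" unfolding wcone_def by blast
  then show "\<forall>i\<in>S. 0 \<le> f i x" using assms(1) by simp
next
  assume "\<forall>i\<in>S. 0 \<le> f i x"
  then show "x \<in> wcone Q S" by (intro wconeI[OF _ assms(2)]) blast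
qed

lemma wcone_delete_zero:
  assumes "finite S" "i \<in> S" "\<And>j. j \<in> S \<Longrightarrow> 0 \<le> t j" "t i = 0" "x = (\<Sum>j\<in>S. t j *\<^sub>R wt Q j)"
  shows "x \<in> wcone Q (S - {i})"
proof -
  have "x = (\<Sum>j\<in>S - {i}. t j *\<^sub>R wt Q j)"
    using assms(4,5) by (simp add: sum.remove[OF assms(1,2)])
  then show ?thesis using assms(3) by (intro wconeI[of _ t]) auto
qed

lemma wt_free_notin_span:
  assumes "wt_free Q S" "i \<in> S"
  shows "wt Q i \<notin> span (wt Q ` (S - {i}))"
proof -
  have "wt Q ` (S - {i}) = wt Q ` S - {wt Q i}"
    using assms unfolding wt_free_def inj_on_def by blast
  then show ?thesis using assms unfolding wt_free_def dependent_def by auto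
qed

text \<open>With a zero coefficient \<open>x\<close> would lie in the cone of
  \<open>S - {i}\<close>, whose span is too small to contain
  \<open>stratum_span Q x\<close>.\<close>

lemma wall_cone_pos:
  assumes "finite S" "S \<subseteq> idx Q" "wt_free Q S" "span (wt Q ` S) \<subseteq> stratum_span Q x"
    and "\<And>j. j \<in> S \<Longrightarrow> 0 \<le> t j" "x = (\<Sum>j\<in>S. t j *\<^sub>R wt Q j)" "i \<in> S"
  shows "0 < t i"
proof (rule ccontr)
  assume "\<not> 0 < t i"
  then have "t i = 0" using assms(5,7) by force
  have "x \<in> wcone Q (S - {i})" by (rule wcone_delete_zero[OF assms(1,7,5) \<open>t i = 0\<close> assms(6)])
  then have "stratum_span Q x \<subseteq> span (wt Q ` (S - {i}))"
    using assms(2) by (intro stratum_span_subset_span) auto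
  moreover have "wt Q i \<in> span (wt Q ` S)" using assms(7) by (intro span_base) auto
  ultimately show False using assms(4) wt_free_notin_span[OF assms(3,7)] by blast
qed

text \<open>Near a wall point only the bases \<open>insert j S\<close> change, where
  \<open>S\<close> is a basis of the Higgs problem with \<open>w\<close> in its cone and the weight
  of \<open>j\<close> lies off the wall span. By \<open>box_index_insert\<close> they contribute the
  Higgs value times the pairings of \<open>l\<close> with the weights on the side of the moving
  point.\<close>

lemma chi_near_wall:
  assumes Q: "tame Q" and w: "w \<in> amb Q" and V: "hyperplane Q (stratum_span Q w)"
    and l: "conormal Q (stratum_span Q w) l" and v: "v \<in> amb Q" "l \<bullet> v \<noteq> 0"
  shows "\<exists>a. \<forall>\<^sub>F s in at 0. chi Q (w + s *\<^sub>R v) = a + chi (higgs Q (stratum_span Q w)) w *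
           (\<Sum>j\<in>idx Q. max 0 (sgn (s * (l \<bullet> v)) * (l \<bullet> wt Q j)))"
proof -
  let ?V = "stratum_span Q w"
  let ?QV = "higgs Q ?V"
  have sup: "weight_supported Q ?V" by (rule wall_supported[OF Q w V])
  have ambV: "amb ?QV = ?V" by (rule amb_higgs[OF Q sup])
  have tV: "tame ?QV" by (rule tame_higgs[OF Q sup])
  have lV: "l \<bullet> u = 0" if "u \<in> ?V" for u using l that by (simp add: conormal_def)
  have fin: "finite S" if "S \<subseteq> idx Q" for S using that tame_finite[OF Q] finite_subset by blast
  define B where "B = {S \<in> bases ?QV. w \<in> wcone Q S}"
  define J where "J = {j \<in> idx Q. wt Q j \<notin> ?V}"
  define ins where "ins = (\<lambda>(S::'a set, j). insert j S)"
  have B: "S \<subseteq> idx Q" "\<And>i. i \<in> S \<Longrightarrow> wt Q i \<in> ?V" "wt_free Q S" "span (wt Q ` S) = ?V" "w \<in> wcone Q S"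
    if "S \<in> B" for S
    using that unfolding B_def bases_def ambV wt_free_def by (auto simp: idx_in_def)
  have ins: "wt_free Q (insert j S)" "j \<notin> S" "span (wt Q ` insert j S) = amb Q" "insert j S \<subseteq> idx Q"
    if "S \<in> B" "j \<in> J" for S j
  proof -
    have j: "j \<in> idx Q" "wt Q j \<notin> ?V" using that(2) by (auto simp: J_def)
    show "wt_free Q (insert j S)" "j \<notin> S"
      using wt_free_insert[OF B(3)[OF that(1)]] j(2) B(4)[OF that(1)] by auto
    have "span (insert (wt Q j) ?V) = amb Q"
      using V j tame_wt_amb[OF Q] by (intro span_insert_hyperplane) (auto simp: hyperplane_def)
    then show "span (wt Q ` insert j S) = amb Q"
      unfolding B(4)[OF that(1), symmetric] by (simp add: span_insert span_span)
    show "insert j S \<subseteq> idx Q" using j(1) B(1)[OF that(1)] by blast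
  qed
  have finBJ: "finite (B \<times> J)"
    using finite_bases[OF tV] tame_finite[OF Q] by (auto simp: B_def J_def)
  have inj: "inj_on ins (B \<times> J)"
  proof (rule inj_onI)
    fix p p' assume p: "p \<in> B \<times> J" "p' \<in> B \<times> J" "ins p = ins p'"
    obtain S j S' j' where eq: "p = (S, j)" "p' = (S', j')" by (metis surj_pair)
    have h: "S \<in> B" "j \<in> J" "S' \<in> B" "j' \<in> J" "insert j S = insert j' S'"
      using p unfolding eq ins_def by auto
    have "S = {i \<in> insert j S. wt Q i \<in> ?V}" "S' = {i \<in> insert j' S'. wt Q i \<in> ?V}"
      using B(2)[OF h(1)] B(2)[OF h(3)] h(2,4) unfolding J_def by blast+
    then have "S = S'" using h(5) by simp
    moreover have "j = j'" using h(5) ins(2)[OF h(1,2)] ins(2)[OF h(3,4)] \<open>S = S'\<close> by blast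
    ultimately show "p = p'" by (simp add: eq)
  qed
  have sub: "ins ` (B \<times> J) \<subseteq> bases Q"
  proof (rule image_subsetI)
    fix p assume "p \<in> B \<times> J"
    then obtain S j where "p = (S, j)" "S \<in> B" "j \<in> J" by blast
    then show "ins p \<in> bases Q" using ins(1,3,4)[of S j] by (simp add: ins_def bases_def)
  qed
  have ev_add: "\<forall>\<^sub>F s in at 0. P (w + s *\<^sub>R v)" if "\<forall>\<^sub>F y in nhds w. P y" for P
    using eventually_line[OF that, of v] unfolding eventually_at_filter by (rule eventually_mono) simp
  have amb_s: "w + s *\<^sub>R v \<in> amb Q" for s
    using w v(1) by (intro subspace_add subspace_mul subspace_amb)
  have stable: "\<forall>\<^sub>F s in at 0. w + s *\<^sub>R v \<in> wcone Q S \<longleftrightarrow> w \<in> wcone Q S"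
    if S: "S \<in> bases Q - ins ` (B \<times> J)" for S
  proof (cases "w \<in> wcone Q S")
    case False
    have "finite S" using S fin unfolding bases_def by blast
    from ev_add[OF eventually_not_in_wcone[OF this False]] False show ?thesis
      by (auto elim!: eventually_mono)
  next
    case True
    have S': "S \<subseteq> idx Q" "wt_free Q S" "span (wt Q ` S) = amb Q" using S unfolding bases_def by blast+
    obtain t where t: "\<And>i. i \<in> S \<Longrightarrow> 0 \<le> t i" "w = (\<Sum>i\<in>S. t i *\<^sub>R wt Q i)"
      using True unfolding wcone_def by blast
    \<comment> \<open>A zero coefficient would make \<open>S - {i}\<close> a Higgs basis at
      \<open>w\<close> and thus \<open>S\<close> one of the excluded bases; hence \<open>w\<close>
      is interior to the cone.\<close>
    have pos: "0 < t i" if i: "i \<in> S" for i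
    proof (rule ccontr)
      assume "\<not> 0 < t i"
      then have "t i = 0" using t(1)[OF i] by simp
      let ?R = "S - {i}"
      have wR: "w \<in> wcone Q ?R" by (rule wcone_delete_zero[OF fin[OF S'(1)] i t(1) \<open>t i = 0\<close> t(2)])
      have R: "?R \<subseteq> idx Q" using S'(1) by blast
      have VR: "?V \<subseteq> span (wt Q ` ?R)" by (rule stratum_span_subset_span[OF R wR])
      have iR: "wt Q i \<notin> span (wt Q ` ?R)" by (rule wt_free_notin_span[OF S'(2) i])
      have "wt Q i \<in> amb Q" using tame_wt_amb[OF Q] i S'(1) by blast
      then have ne: "span (wt Q ` ?R) \<noteq> amb Q" using iR by blast
      have "span (wt Q ` ?R) \<subseteq> amb Q" unfolding S'(3)[symmetric] by (intro span_mono) blast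
      then have eq: "span (wt Q ` ?R) = ?V"
        by (intro hyperplane_maximal[OF V subspace_span VR]) (use ne in auto)
      have "?R \<subseteq> idx_in Q ?V"
        using R unfolding eq[symmetric] idx_in_def by (auto intro: span_base)
      moreover have "wt_free Q ?R" by (rule wt_free_subset[OF S'(2)]) blast
      ultimately have "?R \<in> B"
        unfolding B_def bases_def ambV using eq wR by (simp add: wt_free_def)
      moreover have "i \<in> J" using iR i S'(1) unfolding eq J_def by blast
      ultimately have "ins (?R, i) \<in> ins ` (B \<times> J)" by blast
      moreover have "ins (?R, i) = S" using i by (auto simp: ins_def)
      ultimately show False using S by simp
    qed
    have "\<forall>\<^sub>F y in nhds w. y \<in> span (wt Q ` S) \<longrightarrow> y \<in> wcone Q S"
      using eventually_pos_coords[OF fin[OF S'(1)] S'(2), of t] pos unfolding t(2)[symmetric] by blast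
    from ev_add[OF this]
    show ?thesis using True amb_s unfolding S'(3) by (auto elim!: eventually_mono)
  qed
  \<comment> \<open>The coordinates along \<open>S\<close> stay positive near \<open>w\<close>, so
    the sign of the coordinate along \<open>j\<close> decides, and \<open>l\<close> computes
    it.\<close>
  have cross: "\<forall>\<^sub>F s in at 0. w + s *\<^sub>R v \<in> wcone Q (ins p) \<longleftrightarrow> 0 < s * (l \<bullet> v) * (l \<bullet> wt Q (snd p))"
    if p: "p \<in> B \<times> J" for p
  proof -
    obtain S j where pj: "p = (S, j)" "S \<in> B" "j \<in> J" using p by blast
    let ?S = "insert j S"
    note B' = B[OF pj(2)] and ins' = ins[OF pj(2,3)]
    have finS: "finite S" by (rule fin[OF B'(1)])
    obtain f where f: "\<And>i. i \<in> ?S \<Longrightarrow> linear (f i)"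
      "\<And>t i. i \<in> ?S \<Longrightarrow> f i (\<Sum>j\<in>?S. t j *\<^sub>R wt Q j) = t i"
      "\<And>x. x \<in> span (wt Q ` ?S) \<Longrightarrow> x = (\<Sum>j\<in>?S. f j x *\<^sub>R wt Q j)"
      by (rule wt_free_coords[OF ins'(1) finite_insert[THEN iffD2, OF finS]]) (rule that)
    obtain t where t: "\<And>i. i \<in> S \<Longrightarrow> 0 \<le> t i" "w = (\<Sum>i\<in>S. t i *\<^sub>R wt Q i)"
      using B'(5) unfolding wcone_def by blast
    have pos: "0 < t i" if "i \<in> S" for i
      by (rule wall_cone_pos[OF finS B'(1,3) equalityD1[OF B'(4)] t that])
    have fw: "f i w = t i" if "i \<in> S" for i
    proof -
      have "(\<Sum>k\<in>?S. (if k = j then 0 else t k) *\<^sub>R wt Q k)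
          = (\<Sum>k\<in>S. (if k = j then 0 else t k) *\<^sub>R wt Q k)"
        using finS ins'(2) by simp
      also have "\<dots> = w" unfolding t(2) using ins'(2) by (intro sum.cong) auto
      finally show ?thesis using f(2)[of i "\<lambda>k. if k = j then 0 else t k"] that ins'(2) by auto
    qed
    have "\<forall>\<^sub>F y in nhds w. \<forall>i\<in>S. 0 < f i y"
      using f(1) fw pos by (intro eventually_linear_pos[OF finS]) simp_all
    then have "\<forall>\<^sub>F s in at 0. (\<forall>i\<in>S. 0 < f i (w + s *\<^sub>R v)) \<and> s \<noteq> 0"
      by (intro eventually_conj ev_add) (auto simp: eventually_at_filter)
    then show ?thesis
    proof (rule eventually_mono)
      fix s assume s: "(\<forall>i\<in>S. 0 < f i (w + s *\<^sub>R v)) \<and> s \<noteq> 0"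
      let ?y = "w + s *\<^sub>R v"
      have y: "?y = (\<Sum>k\<in>?S. f k ?y *\<^sub>R wt Q k)" using f(3) amb_s ins'(3) by blast
      have "l \<bullet> ?y = l \<bullet> (\<Sum>k\<in>?S. f k ?y *\<^sub>R wt Q k)" using y by simp
      also have "\<dots> = f j ?y * (l \<bullet> wt Q j)"
        using finS ins'(2) lV B'(2) by (simp add: inner_add_right inner_sum_right)
      finally have fj: "f j ?y * (l \<bullet> wt Q j) = s * (l \<bullet> v)"
        using lV self_in_stratum_span[OF w] by (simp add: inner_add_right)
      have a0: "l \<bullet> wt Q j \<noteq> 0"
        using conormal_off_hyperplane[OF V l] pj(3) tame_wt_amb[OF Q] unfolding J_def by blast
      have "?y \<in> wcone Q ?S \<longleftrightarrow> (\<forall>i\<in>?S. 0 \<le> f i ?y)"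
        by (rule in_wcone_iff_coords[OF f(2) y])
      also have "\<dots> \<longleftrightarrow> 0 \<le> f j ?y" using s by (auto intro: less_imp_le)
      also have "\<dots> \<longleftrightarrow> 0 < f j ?y" using fj s v(2) by (auto simp: less_le)
      also have "\<dots> \<longleftrightarrow> 0 < f j ?y * (l \<bullet> wt Q j) * (l \<bullet> wt Q j)"
        using a0 by (simp add: mult.assoc zero_less_mult_iff) (metis linorder_neqE_linordered_idom)
      finally show "?y \<in> wcone Q (ins p) \<longleftrightarrow> 0 < s * (l \<bullet> v) * (l \<bullet> wt Q (snd p))"
        unfolding fj by (simp add: pj(1) ins_def)
    qed
  qed
  define a where "a = (\<Sum>S\<in>bases Q - ins ` (B \<times> J). if w \<in> wcone Q S then real (box_index Q S) else 0)"
  have "\<forall>\<^sub>F s in at 0. (\<forall>S\<in>bases Q - ins ` (B \<times> J). w + s *\<^sub>R v \<in> wcone Q S \<longleftrightarrow> w \<in> wcone Q S) \<and>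
      (\<forall>p\<in>B \<times> J. w + s *\<^sub>R v \<in> wcone Q (ins p) \<longleftrightarrow> 0 < s * (l \<bullet> v) * (l \<bullet> wt Q (snd p)))"
    using stable cross finBJ finite_bases[OF Q]
    by (intro eventually_conj eventually_ball_finite) auto
  then have "\<forall>\<^sub>F s in at 0. chi Q (w + s *\<^sub>R v) = a + chi ?QV w *
           (\<Sum>j\<in>idx Q. max 0 (sgn (s * (l \<bullet> v)) * (l \<bullet> wt Q j)))"
  proof (rule eventually_mono)
    fix s
    assume s: "(\<forall>S\<in>bases Q - ins ` (B \<times> J). w + s *\<^sub>R v \<in> wcone Q S \<longleftrightarrow> w \<in> wcone Q S) \<and>
      (\<forall>p\<in>B \<times> J. w + s *\<^sub>R v \<in> wcone Q (ins p) \<longleftrightarrow> 0 < s * (l \<bullet> v) * (l \<bullet> wt Q (snd p)))"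
    let ?c = "\<lambda>S. if w + s *\<^sub>R v \<in> wcone Q S then real (box_index Q S) else 0"
    let ?m = "\<lambda>j. max 0 (sgn (s * (l \<bullet> v)) * (l \<bullet> wt Q j))"
    have "chi Q (w + s *\<^sub>R v) = sum ?c (bases Q - ins ` (B \<times> J)) + sum ?c (ins ` (B \<times> J))"
      unfolding chi_sum[OF Q] by (rule sum.subset_diff[OF sub finite_bases[OF Q]])
    also have "sum ?c (bases Q - ins ` (B \<times> J)) = a"
      unfolding a_def using s by (intro sum.cong) auto
    also have "sum ?c (ins ` (B \<times> J)) = (\<Sum>p\<in>B \<times> J. ?c (ins p))"
      by (rule sum.reindex[OF inj, unfolded o_def])
    also have "\<dots> = (\<Sum>p\<in>B \<times> J. real (box_index ?QV (fst p)) * ?m (snd p))"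
    proof (intro sum.cong refl)
      fix p assume p: "p \<in> B \<times> J"
      obtain S j where pj: "p = (S, j)" "S \<in> B" "j \<in> J" using p by blast
      have j: "j \<in> idx Q" "wt Q j \<notin> ?V" using pj(3) by (auto simp: J_def)
      have idx: "real (box_index Q (ins p)) = \<bar>l \<bullet> wt Q j\<bar> * real (box_index ?QV S)"
        using box_index_insert[OF Q V l B(1,3,4)[OF pj(2)] j] by (simp add: pj(1) ins_def)
      have "(w + s *\<^sub>R v \<in> wcone Q (ins p)) = (0 < s * (l \<bullet> v) * (l \<bullet> wt Q j))"
        using s p pj(1) by auto
      moreover have "(if 0 < s * (l \<bullet> v) * (l \<bullet> wt Q j) then \<bar>l \<bullet> wt Q j\<bar> else 0) = ?m j"
        by (auto simp: sgn_if max_def zero_less_mult_iff mult_less_0_iff)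
      ultimately show "?c (ins p) = real (box_index ?QV (fst p)) * ?m (snd p)"
        using idx pj(1) by (auto split: if_splits)
    qed
    also have "\<dots> = (\<Sum>S\<in>B. real (box_index ?QV S)) * (\<Sum>j\<in>J. ?m j)"
      by (simp add: sum_product sum.cartesian_product case_prod_beta)
    also have "(\<Sum>S\<in>B. real (box_index ?QV S)) = chi ?QV w"
      by (simp add: chi_def B_def)
    also have "(\<Sum>j\<in>J. ?m j) = (\<Sum>j\<in>idx Q. ?m j)"
      using tame_finite[OF Q] lV by (intro sum.mono_neutral_left) (auto simp: J_def)
    finally show "chi Q (w + s *\<^sub>R v) = a + chi ?QV w * (\<Sum>j\<in>idx Q. ?m j)" .
  qed
  then show ?thesis by blast
qed

section \<open>Crossing walls along a line\<close>

lemma eventually_shift: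
  fixes r :: real
  shows "(\<forall>\<^sub>F s in at r. P s) \<longleftrightarrow> (\<forall>\<^sub>F h in at 0. P (r + h))"
  by (subst at_to_0) (simp add: eventually_filtermap add.commute)

text \<open>If \<open>v\<close> lay in the wall span, the whole line would. Inside this span,
  membership in the cone carrying the wall is locally constant along the segment, so the starting
  point would lie in a cone of proper span, which is impossible in a chamber.\<close>

lemma line_transversal:
  assumes Q: "tame Q" and x: "x \<in> amb Q" "stratum_span Q x = amb Q" and v: "v \<in> amb Q" and "0 \<le> s"
    and gen: "\<And>r. 0 \<le> r \<Longrightarrow> r \<le> s \<Longrightarrow>
      stratum_span Q (x + r *\<^sub>R v) = amb Q \<or> hyperplane Q (stratum_span Q (x + r *\<^sub>R v))"
    and V: "hyperplane Q (stratum_span Q (x + s *\<^sub>R v))"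
  shows "v \<notin> stratum_span Q (x + s *\<^sub>R v)"
proof
  let ?p = "\<lambda>r. x + r *\<^sub>R v"
  let ?V = "stratum_span Q (?p s)"
  assume vV: "v \<in> ?V"
  have amb: "?p r \<in> amb Q" for r using x(1) v by (intro subspace_add subspace_mul subspace_amb)
  have Vs: "subspace ?V" by (rule subspace_stratum_span)
  have pV: "?p r \<in> ?V" for r
  proof -
    have "?p s + (r - s) *\<^sub>R v \<in> ?V"
      by (rule subspace_add[OF Vs self_in_stratum_span[OF amb[of s]] subspace_mul[OF Vs vV]])
    then show ?thesis by (simp add: algebra_simps)
  qed
  obtain S t where S: "S \<subseteq> idx Q" "wt_free Q S" "\<And>i. i \<in> S \<Longrightarrow> 0 < t i"
    "?p s = (\<Sum>i\<in>S. t i *\<^sub>R wt Q i)" "span (wt Q ` S) = ?V"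
    by (rule wall_basis[OF Q amb V]) (rule that)
  have finS: "finite S" using S(1) tame_finite[OF Q] finite_subset by blast
  have loc: "\<forall>\<^sub>F r' in at r within {0..s}. (?p r \<in> wcone Q S) = (?p r' \<in> wcone Q S)"
    if r: "r \<in> {0..s}" for r
  proof -
    have "\<forall>\<^sub>F y in nhds (?p r). y \<in> ?V \<longrightarrow> (?p r \<in> wcone Q S) = (y \<in> wcone Q S)"
    proof (cases "?p r \<in> wcone Q S")
      case False
      from eventually_not_in_wcone[OF finS this] False show ?thesis by (auto elim!: eventually_mono)
    next
      case True
      then obtain u where u: "\<And>i. i \<in> S \<Longrightarrow> 0 \<le> u i" "?p r = (\<Sum>i\<in>S. u i *\<^sub>R wt Q i)"
        unfolding wcone_def by blast
      \<comment> \<open>A point of the segment in this cone has its stratum span inside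
        \<open>?V\<close>; genericity leaves only \<open>?V\<close> itself, so
        \<open>wall_cone_pos\<close> applies.\<close>
      have sub: "stratum_span Q (?p r) \<subseteq> ?V"
        using stratum_span_subset_span[OF S(1) True] unfolding S(5) .
      moreover have "?V \<noteq> amb Q" "?V \<subseteq> amb Q" using V unfolding hyperplane_def by auto
      ultimately have "hyperplane Q (stratum_span Q (?p r))" using gen[of r] r by auto
      from hyperplane_maximal[OF this Vs sub \<open>?V \<subseteq> amb Q\<close> \<open>?V \<noteq> amb Q\<close>]
      have "span (wt Q ` S) \<subseteq> stratum_span Q (?p r)" unfolding S(5) by simp
      then have "0 < u i" if "i \<in> S" for i
        by (rule wall_cone_pos[OF finS S(1,2) _ u that])
      then have "\<forall>\<^sub>F y in nhds (?p r). y \<in> span (wt Q ` S) \<longrightarrow> y \<in> wcone Q S"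
        using eventually_pos_coords[OF finS S(2), of u] unfolding u(2)[symmetric] by blast
      then show ?thesis unfolding S(5) using True by (auto elim!: eventually_mono)
    qed
    from eventually_line[OF this, of v]
    have "\<forall>\<^sub>F h in at 0. (?p r \<in> wcone Q S) = (?p (r + h) \<in> wcone Q S)"
      unfolding eventually_at_filter
    proof (rule eventually_mono)
      fix h assume "?p r + h *\<^sub>R v \<in> ?V \<longrightarrow> (?p r \<in> wcone Q S) = (?p r + h *\<^sub>R v \<in> wcone Q S)"
      moreover have "?p r + h *\<^sub>R v = ?p (r + h)" by (simp add: scaleR_left_distrib)
      ultimately show "h \<noteq> 0 \<longrightarrow> h \<in> UNIV \<longrightarrow> (?p r \<in> wcone Q S) = (?p (r + h) \<in> wcone Q S)"
        using pV[of "r + h"] by simp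
    qed
    then have "\<forall>\<^sub>F r' in at r. (?p r \<in> wcone Q S) = (?p r' \<in> wcone Q S)"
      unfolding eventually_shift[of _ r] .
    then show ?thesis by (rule filter_leD[OF at_le[OF subset_UNIV]])
  qed
  have "(?p s \<in> wcone Q S) = (?p 0 \<in> wcone Q S)"
    by (rule connected_local_const[of "{0..s}" s 0]) (use \<open>0 \<le> s\<close> loc in auto)
  moreover have "?p s \<in> wcone Q S" using S(3,4) by (intro wconeI[of S t]) (auto intro: less_imp_le)
  ultimately have "x \<in> wcone Q S" by simp
  then have "amb Q \<subseteq> ?V" using stratum_span_subset_span[OF S(1), of x] unfolding S(5) x(2) by blast
  then show False using V unfolding hyperplane_def by auto
qed

lemma eventually_same_side:
  fixes r :: real
  assumes "finite T"
  shows "\<forall>\<^sub>F s in at r. s \<notin> T \<and> s \<noteq> r \<and> {u \<in> T. u < s} = {u \<in> T. u < r} \<union> (if r < s then T \<inter> {r} else {})"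
proof -
  have "\<forall>\<^sub>F s in at r. \<forall>u\<in>T. s \<noteq> u \<and> (u \<noteq> r \<longrightarrow> (u < s) = (u < r))"
  proof (rule eventually_ball_finite[OF assms], rule ballI)
    fix u assume "u \<in> T"
    show "\<forall>\<^sub>F s in at r. s \<noteq> u \<and> (u \<noteq> r \<longrightarrow> (u < s) = (u < r))"
    proof (cases u r rule: linorder_cases)
      case less
      have "\<forall>\<^sub>F s in at r. u < s" by (rule order_tendstoD(1)[OF tendsto_ident_at less])
      then show ?thesis by (rule eventually_mono) (use less in auto)
    next
      case equal
      then show ?thesis by (auto simp: eventually_at_filter)
    next
      case greater
      have "\<forall>\<^sub>F s in at r. s < u" by (rule order_tendstoD(2)[OF tendsto_ident_at greater])
      then show ?thesis by (rule eventually_mono) (use greater in auto)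
    qed
  qed
  moreover have "\<forall>\<^sub>F s in at r. s \<noteq> r" by (simp add: eventually_at_filter)
  ultimately show ?thesis
  proof eventually_elim
    case (elim s)
    then show ?case by (auto split: if_splits)
  qed
qed

text \<open>Subtracting the jumps already passed leaves a function that is locally constant.
  \<open>J\<close> is a parameter because the lemma is used with the true jumps along a ray and with
  zero jumps between the ends of two rays.\<close>

lemma chi_crossing:
  fixes Q :: "('i, 'v::euclidean_space) toric_git"
  assumes Q: "tame Q" and x: "x \<in> amb Q" and v: "v \<in> amb Q" and R: "0 \<le> R"
    and T: "T = {s \<in> {0..R}. stratum_span Q (x + s *\<^sub>R v) \<noteq> amb Q}" "finite T" "0 \<notin> T" "R \<notin> T"
    and gen: "\<And>s. s \<in> T \<Longrightarrow> hyperplane Q (stratum_span Q (x + s *\<^sub>R v))"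
    and J: "\<And>s l. s \<in> T \<Longrightarrow> conormal Q (stratum_span Q (x + s *\<^sub>R v)) l \<Longrightarrow>
      l \<bullet> v \<noteq> 0 \<and> J s = sgn (l \<bullet> v) * (l \<bullet> det_wt Q) *
        chi (higgs Q (stratum_span Q (x + s *\<^sub>R v))) (x + s *\<^sub>R v)"
  shows "chi Q (x + R *\<^sub>R v) = chi Q x + (\<Sum>s\<in>T. J s)"
proof -
  let ?p = "\<lambda>r. x + r *\<^sub>R v"
  have amb: "?p r \<in> amb Q" for r using x v by (intro subspace_add subspace_mul subspace_amb)
  define G where "G r = chi Q (?p r) - (\<Sum>s\<in>{s \<in> T. s < r}. J s)" for r
  have step: "?p (r + h) = ?p r + h *\<^sub>R v" for r h by (simp add: scaleR_left_distrib)
  have off: "\<forall>\<^sub>F s in at r. G s = G r" if r: "r \<in> {0..R}" "r \<notin> T" for r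
  proof -
    have eq: "stratum_span Q (?p r) = amb Q" using r T(1) by blast
    have "\<forall>\<^sub>F h in nhds 0. ?p r + h *\<^sub>R v \<in> stratum Q (?p r)"
      using eventually_line[OF eventually_in_stratum[OF tame_finite[OF Q]], of "?p r" v]
      unfolding eq by (rule eventually_mono) (use amb step in metis)
    then have "\<forall>\<^sub>F h in at 0. ?p r + h *\<^sub>R v \<in> stratum Q (?p r)"
      unfolding eventually_at_filter by (rule eventually_mono) simp
    then have "\<forall>\<^sub>F s in at r. ?p s \<in> stratum Q (?p r)"
      unfolding eventually_shift[of _ r] step .
    with eventually_same_side[OF T(2), of r] show ?thesis
    proof eventually_elim
      case (elim s)
      have "{u \<in> T. u < s} = {u \<in> T. u < r}" using elim(1) r(2) by auto
      then show ?case using chi_cong[OF elim(2)] unfolding G_def by simp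
    qed
  qed
  have "\<exists>k. \<forall>\<^sub>F s in at r. G s = k" if r: "r \<in> T" for r
  proof -
    let ?V = "stratum_span Q (?p r)"
    obtain l where l: "conormal Q ?V l" using wall_conormal[OF Q amb gen[OF r]] by blast
    have lv: "l \<bullet> v \<noteq> 0" and Jr: "J r = sgn (l \<bullet> v) * (l \<bullet> det_wt Q) * chi (higgs Q ?V) (?p r)"
      using J[OF r l] by blast+
    let ?M = "\<lambda>\<sigma>. \<Sum>j\<in>idx Q. max 0 (\<sigma> * (l \<bullet> wt Q j))"
    obtain a where a: "\<forall>\<^sub>F h in at 0. chi Q (?p r + h *\<^sub>R v) = a + chi (higgs Q ?V) (?p r) *
        ?M (sgn (h * (l \<bullet> v)))"
      using chi_near_wall[OF Q amb gen[OF r] l v lv] by blast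
    \<comment> \<open>Positive parts minus negative parts of the pairings add up to the pairing with
      \<open>det_wt Q\<close>.\<close>
    have M: "?M \<sigma> - ?M (- \<sigma>) = \<sigma> * (l \<bullet> det_wt Q)" for \<sigma>
      by (simp add: det_wt_def inner_sum_right sum_distrib_left max_def flip: sum_subtractf)
        (intro sum.cong, auto)
    have "\<forall>\<^sub>F s in at r. chi Q (?p s) = a + chi (higgs Q ?V) (?p r) * ?M (sgn ((s - r) * (l \<bullet> v)))"
      unfolding eventually_shift[of _ r] step using a by simp
    with eventually_same_side[OF T(2), of r]
    have "\<forall>\<^sub>F s in at r. G s = a + chi (higgs Q ?V) (?p r) * ?M (- sgn (l \<bullet> v))
        - (\<Sum>s\<in>{s \<in> T. s < r}. J s)"
    proof eventually_elim
      case (elim s)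
      show ?case
      proof (cases "r < s")
        case True
        have "{u \<in> T. u < s} = insert r {u \<in> T. u < r}" using elim(1) True r by auto
        then have "(\<Sum>u\<in>{u \<in> T. u < s}. J u) = J r + (\<Sum>u\<in>{u \<in> T. u < r}. J u)"
          using T(2) by simp
        moreover have "sgn ((s - r) * (l \<bullet> v)) = sgn (l \<bullet> v)" using True by (simp add: sgn_mult)
        ultimately have "G s = a + chi (higgs Q ?V) (?p r) * ?M (sgn (l \<bullet> v))
            - J r - (\<Sum>u\<in>{u \<in> T. u < r}. J u)"
          using elim(2) unfolding G_def by simp
        moreover have "chi (higgs Q ?V) (?p r) * ?M (sgn (l \<bullet> v)) - J r
            = chi (higgs Q ?V) (?p r) * ?M (- sgn (l \<bullet> v))"
        proof -
          have "J r = chi (higgs Q ?V) (?p r) * (?M (sgn (l \<bullet> v)) - ?M (- sgn (l \<bullet> v)))"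
            unfolding M Jr by simp
          then show ?thesis by (simp add: right_diff_distrib)
        qed
        ultimately show ?thesis by linarith
      next
        case False
        then have "s < r" using elim(1) by simp
        have "{u \<in> T. u < s} = {u \<in> T. u < r}" using elim(1) False by simp
        moreover have "sgn ((s - r) * (l \<bullet> v)) = - sgn (l \<bullet> v)" using \<open>s < r\<close> by (simp add: sgn_mult)
        ultimately show ?thesis using elim(2) unfolding G_def by simp
      qed
    qed
    then show ?thesis by blast
  qed
  then obtain k where k: "\<And>r. r \<in> T \<Longrightarrow> \<forall>\<^sub>F s in at r. G s = k r" by metis
  \<comment> \<open>On a wall itself chi is not controlled, so there the value is replaced by the
    common value on both sides; the result is locally constant on the connected segment.\<close>
  define K where "K r = (if r \<in> T then k r else G r)" for r
  have "\<forall>\<^sub>F s in at r within {0..R}. K r = K s" if r: "r \<in> {0..R}" for r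
  proof -
    have "\<forall>\<^sub>F s in at r. G s = K r" using off[OF r] k[of r] by (auto simp: K_def)
    with eventually_same_side[OF T(2), of r] have "\<forall>\<^sub>F s in at r. K r = K s"
      by eventually_elim (simp add: K_def)
    then show ?thesis by (rule filter_leD[OF at_le[OF subset_UNIV]])
  qed
  then have "K 0 = K R" using R by (intro connected_local_const[of "{0..R}"]) auto
  then have "G 0 = G R" using T(3,4) by (simp add: K_def)
  moreover have "{s \<in> T. s < 0} = {}" using T(1) by auto
  moreover have "{s \<in> T. s < R} = T" using T(1,4) by force
  ultimately show ?thesis unfolding G_def by simp
qed

text \<open>Two points of the line in one stratum would put the direction \<open>v\<close> into its
  linear span. This turns sums over crossed walls into sums over crossing times and makes the set of
  times finite.\<close>

lemma stratum_inj_on_line: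
  assumes "tame Q" "x \<in> amb Q" "v \<in> amb Q"
    and "\<And>s. s \<in> I \<Longrightarrow> v \<notin> stratum_span Q (x + s *\<^sub>R v)"
  shows "inj_on (\<lambda>s. stratum Q (x + s *\<^sub>R v)) I"
proof (rule inj_onI, rule ccontr)
  let ?p = "\<lambda>r. x + r *\<^sub>R v"
  fix s s' assume s: "s \<in> I" "s' \<in> I" "stratum Q (?p s) = stratum Q (?p s')" "s \<noteq> s'"
  have amb: "?p r \<in> amb Q" for r using assms(2,3) by (intro subspace_add subspace_mul subspace_amb)
  have "?p s \<in> stratum_span Q (?p s)" "?p s' \<in> stratum_span Q (?p s)"
    using stratum_self[OF amb] stratum_subset_stratum_span s(3) by blast+
  then have "(1 / (s - s')) *\<^sub>R (?p s - ?p s') \<in> stratum_span Q (?p s)"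
    by (intro subspace_mul subspace_diff subspace_stratum_span)
  moreover have "?p s - ?p s' = (s - s') *\<^sub>R v" by (simp add: scaleR_left_diff_distrib)
  ultimately show False using s assms(4)[of s] by simp
qed

lemma finite_times_on_line:
  assumes "tame Q" "x \<in> amb Q" "v \<in> amb Q"
    and "\<And>s. s \<in> I \<Longrightarrow> v \<notin> stratum_span Q (x + s *\<^sub>R v)"
  shows "finite I"
proof (rule finite_imageD[OF _ stratum_inj_on_line[OF assms]])
  have "x + s *\<^sub>R v \<in> amb Q" for s using assms(2,3) by (intro subspace_add subspace_mul subspace_amb)
  then have "(\<lambda>s. stratum Q (x + s *\<^sub>R v)) ` I \<subseteq> gkz_strata Q" unfolding gkz_strata_eq by blast
  then show "finite ((\<lambda>s. stratum Q (x + s *\<^sub>R v)) ` I)"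
    by (rule finite_subset) (rule finite_gkz_strata[OF tame_finite[OF assms(1)]])
qed

text \<open>A step out of the next subspace can be taken so small that it stays in \<open>U\<close>
  and off the previous, closed ones.\<close>

lemma avoid_subspaces:
  fixes V :: "'v::euclidean_space set"
  assumes "subspace V" "y \<in> V" "open U" "y \<in> U"
    and "finite F" "\<And>A. A \<in> F \<Longrightarrow> subspace A \<and> \<not> V \<subseteq> A"
  shows "\<exists>z\<in>V \<inter> U. \<forall>A\<in>F. z \<notin> A"
  using assms(5,6)
proof (induction F rule: finite_induct)
  case empty
  then show ?case using assms by blast
next
  case (insert A F)
  then obtain z where z: "z \<in> V \<inter> U" "\<forall>A\<in>F. z \<notin> A" by blast
  have A: "subspace A" "\<not> V \<subseteq> A" using insert.prems by blast+
  show ?case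
  proof (cases "z \<in> A")
    case False
    then show ?thesis using z by blast
  next
    case True
    obtain u where u: "u \<in> V" "u \<notin> A" using A(2) by blast
    have "open (U - \<Union>F)"
      using insert assms(3) by (intro open_Diff closed_Union) (auto intro: closed_subspace)
    then have "\<forall>\<^sub>F x in nhds z. x \<in> U - \<Union>F" using z by (intro eventually_nhds_in_open) auto
    then have "\<forall>\<^sub>F s in nhds (0::real). z + s *\<^sub>R u \<in> U - \<Union>F" by (rule eventually_line)
    then have "\<forall>\<^sub>F s in at (0::real). z + s *\<^sub>R u \<in> U - \<Union>F \<and> s \<noteq> 0"
      unfolding eventually_at_filter by (rule eventually_mono) simp
    then obtain s :: real where s: "z + s *\<^sub>R u \<in> U - \<Union>F" "s \<noteq> 0"
      using eventually_happens'[OF at_neq_bot] by blast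
    have "z + s *\<^sub>R u \<notin> A"
    proof
      assume "z + s *\<^sub>R u \<in> A"
      then have "(1 / s) *\<^sub>R ((z + s *\<^sub>R u) - z) \<in> A" using True A(1) by (intro subspace_mul subspace_diff)
      then show False using s u by simp
    qed
    moreover have "z + s *\<^sub>R u \<in> V" using z u assms(1) by (intro subspace_add subspace_mul) auto
    ultimately show ?thesis using s(1) by blast
  qed
qed

section \<open>Rays\<close>

text \<open>Written as a line with direction \<open>- det_wt Q\<close>, the form to which the lemmas
  on line crossings apply.\<close>

definition ray_point :: "('i, 'v::euclidean_space) toric_git \<Rightarrow> 'v \<Rightarrow> real \<Rightarrow> 'v" where
  "ray_point Q c t = c + t *\<^sub>R (- det_wt Q)"

abbreviation "ray_stratum Q c t \<equiv> stratum Q (ray_point Q c t)"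

abbreviation "ray_span Q c t \<equiv> stratum_span Q (ray_point Q c t)"

text \<open>Pointwise form of \<open>generic_start\<close> for a point of a chamber
  (\<open>generic_start_iff\<close>): it refers to the parameter of the ray and carries over to
  Coulomb problems parameter by parameter.\<close>

definition good_start :: "('i, 'v::euclidean_space) toric_git \<Rightarrow> 'v \<Rightarrow> bool" where
  "good_start Q c \<longleftrightarrow> c \<in> amb Q \<and> stratum_span Q c = amb Q \<and>
     (\<forall>t\<ge>0. ray_span Q c t = amb Q \<or> hyperplane Q (ray_span Q c t))"

text \<open>Index set replacing \<open>crossed_walls\<close>: a good ray meets each wall at a single
  time, and times, unlike walls, can be compared directly between a problem and its Coulomb
  problem.\<close>

definition wall_times :: "('i, 'v::euclidean_space) toric_git \<Rightarrow> 'v \<Rightarrow> real set" where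
  "wall_times Q c = {t. 0 \<le> t \<and> hyperplane Q (ray_span Q c t)}"

lemma ray_eq: "ray Q c = ray_point Q c ` {0..}"
  unfolding ray_def ray_point_def by auto

lemma ray_point_amb: "tame Q \<Longrightarrow> c \<in> amb Q \<Longrightarrow> ray_point Q c t \<in> amb Q"
  unfolding ray_point_def using tame_det_amb
  by (intro subspace_add subspace_mul subspace_neg subspace_amb)

lemma ray_point_0 [simp]: "ray_point Q c 0 = c"
  by (simp add: ray_point_def)

lemma stratum_meets_ray:
  assumes "tame Q" "c \<in> amb Q"
  shows "S \<in> gkz_strata Q \<and> S \<inter> ray Q c \<noteq> {} \<longleftrightarrow> (\<exists>t\<ge>0. S = ray_stratum Q c t)"
proof
  assume "S \<in> gkz_strata Q \<and> S \<inter> ray Q c \<noteq> {}"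
  then obtain t where "t \<ge> 0" "ray_point Q c t \<in> S" "S \<in> gkz_strata Q" unfolding ray_eq by auto
  then show "\<exists>t\<ge>0. S = ray_stratum Q c t" using stratum_of_mem by blast
next
  assume "\<exists>t\<ge>0. S = ray_stratum Q c t"
  then obtain t where t: "t \<ge> 0" "S = ray_stratum Q c t" by blast
  have "ray_point Q c t \<in> S \<inter> ray Q c"
    using stratum_self[OF ray_point_amb[OF assms]] t unfolding ray_eq by auto
  moreover have "S \<in> gkz_strata Q" unfolding gkz_strata_eq t(2) using ray_point_amb[OF assms] by blast
  ultimately show "S \<in> gkz_strata Q \<and> S \<inter> ray Q c \<noteq> {}" by blast
qed

lemma generic_start_iff:
  assumes Q: "tame Q" and C: "gkz_chamber Q C" "c \<in> C"
  shows "generic_start Q c \<longleftrightarrow> good_start Q c"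
proof -
  have c: "c \<in> amb Q" "stratum_span Q c = amb Q"
    using chamber_of_mem[OF C] C(1) chamber_stratum_iff[OF tame_finite[OF Q]] by auto
  have "gkz_chamber Q (ray_stratum Q c t) \<or> gkz_wall Q (ray_stratum Q c t) \<longleftrightarrow>
      ray_span Q c t = amb Q \<or> hyperplane Q (ray_span Q c t)" for t
    unfolding chamber_stratum_iff[OF tame_finite[OF Q] ray_point_amb[OF Q c(1)]]
      wall_stratum_iff[OF tame_finite[OF Q] ray_point_amb[OF Q c(1)]] hyperplane_stratum_span ..
  moreover have "generic_start Q c \<longleftrightarrow> (\<forall>t\<ge>0. gkz_chamber Q (ray_stratum Q c t) \<or>
      gkz_wall Q (ray_stratum Q c t))"
    unfolding generic_start_def using stratum_meets_ray[OF Q c(1)] by metis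
  ultimately show ?thesis unfolding good_start_def using c by simp
qed

lemma crossed_walls_eq:
  assumes Q: "tame Q" and c: "c \<in> amb Q"
  shows "crossed_walls Q c = (\<lambda>t. ray_stratum Q c t) ` wall_times Q c"
proof (rule set_eqI)
  fix W
  have wall: "gkz_wall Q (ray_stratum Q c t) \<longleftrightarrow>
      hyperplane Q (ray_span Q c t)" for t
    unfolding wall_stratum_iff[OF tame_finite[OF Q] ray_point_amb[OF Q c]] hyperplane_stratum_span ..
  have "W \<in> crossed_walls Q c \<longleftrightarrow> gkz_wall Q W \<and> (W \<in> gkz_strata Q \<and> W \<inter> ray Q c \<noteq> {})"
    by (auto simp: crossed_walls_def gkz_wall_def)
  also have "\<dots> \<longleftrightarrow> (\<exists>t\<ge>0. gkz_wall Q (ray_stratum Q c t) \<and> W = ray_stratum Q c t)"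
    unfolding stratum_meets_ray[OF Q c] by metis
  also have "\<dots> \<longleftrightarrow> W \<in> (\<lambda>t. ray_stratum Q c t) ` wall_times Q c"
    unfolding wall wall_times_def image_iff Bex_def mem_Collect_eq conj_assoc ..
  finally show "W \<in> crossed_walls Q c \<longleftrightarrow> W \<in> (\<lambda>t. ray_stratum Q c t) ` wall_times Q c" .
qed

lemma good_start_transversal:
  assumes Q: "tame Q" and c: "good_start Q c" and t: "t \<in> wall_times Q c"
  shows "- det_wt Q \<notin> ray_span Q c t"
proof -
  have "- det_wt Q \<in> amb Q" using tame_det_amb[OF Q] by (simp add: subspace_neg)
  then show ?thesis
    using c t unfolding good_start_def wall_times_def ray_point_def
    by (intro line_transversal[OF Q]) auto
qed

lemma inj_on_wall_times:
  assumes Q: "tame Q" and c: "good_start Q c"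
  shows "inj_on (\<lambda>t. ray_stratum Q c t) (wall_times Q c)"
    and "finite (wall_times Q c)"
proof -
  have *: "c \<in> amb Q" "- det_wt Q \<in> amb Q"
    using c tame_det_amb[OF Q] by (simp_all add: good_start_def subspace_neg)
  have **: "- det_wt Q \<notin> stratum_span Q (c + t *\<^sub>R (- det_wt Q))" if "t \<in> wall_times Q c" for t
    using good_start_transversal[OF Q c that] unfolding ray_point_def .
  show "inj_on (\<lambda>t. ray_stratum Q c t) (wall_times Q c)"
    unfolding ray_point_def by (rule stratum_inj_on_line[OF Q * **])
  show "finite (wall_times Q c)" by (rule finite_times_on_line[OF Q * **])
qed

section \<open>Generic rays and the value of chi at their ends\<close>

lemma proper_span_insert:
  assumes "dim (stratum_span Q z) + 2 \<le> dim (amb Q)"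
  shows "\<not> amb Q \<subseteq> span (insert x (stratum_span Q z))"
proof
  assume "amb Q \<subseteq> span (insert x (stratum_span Q z))"
  then have "dim (amb Q) \<le> dim (insert x (stratum_span Q z))" by (metis dim_span dim_subset)
  also have "\<dots> \<le> dim (stratum_span Q z) + 1" by (simp add: dim_insert)
  finally show False using assms by simp
qed

lemma small_stratum:
  assumes "\<not> dim (stratum_span Q z) + 2 \<le> dim (amb Q)"
  shows "stratum_span Q z = amb Q \<or> hyperplane Q (stratum_span Q z)"
proof (cases "dim (stratum_span Q z) + 1 = dim (amb Q)")
  case True
  then show ?thesis unfolding hyperplane_stratum_span by blast
next
  case False
  then have "dim (amb Q) \<le> dim (stratum_span Q z)" using assms by linarith
  then have "stratum_span Q z = amb Q"
    by (intro subspace_dim_equal subspace_stratum_span stratum_span_subset_amb subspace_amb)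
  then show ?thesis ..
qed

lemma finite_stratum_spans:
  assumes "tame Q"
  shows "finite (stratum_span Q ` amb Q)"
proof -
  have "stratum_span Q ` amb Q \<subseteq> span ` gkz_strata Q"
    unfolding gkz_strata_eq using span_stratum[OF tame_finite[OF assms]] by (auto intro!: image_eqI)
  then show ?thesis using finite_gkz_strata[OF tame_finite[OF assms]] by (meson finite_surj)
qed

text \<open>
  Perturbs the endpoint of a segment from \<open>u\<close>, or the origin of a ray in direction \<open>u\<close>, so that it
  meets only chambers and walls.
\<close>

lemma exists_generic_near:
  assumes Q: "tame Q" and y: "y \<in> amb Q" "stratum_span Q y = amb Q" and "open U" "y \<in> U"
  obtains z where "z \<in> stratum Q y" "z \<in> U"
    "\<And>w. w \<in> amb Q \<Longrightarrow> z \<in> span (insert u (stratum_span Q w)) \<Longrightarrow>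
      stratum_span Q w = amb Q \<or> hyperplane Q (stratum_span Q w)"
proof -
  have "\<forall>\<^sub>F x in nhds y. x \<in> amb Q \<longrightarrow> x \<in> stratum Q y"
    using eventually_in_stratum[OF tame_finite[OF Q]] unfolding y(2)[symmetric] .
  then obtain U' where U': "open U'" "y \<in> U'" "\<And>x. x \<in> U' \<Longrightarrow> x \<in> amb Q \<Longrightarrow> x \<in> stratum Q y"
    unfolding eventually_nhds by blast
  \<comment> \<open>The subspaces to avoid: \<open>u\<close> together with a stratum span of
    codimension at least 2 still spans a proper subspace, and there are finitely many of
    these.\<close>
  let ?F = "(\<lambda>A. span (insert u A)) `
    {A \<in> stratum_span Q ` amb Q. dim A + 2 \<le> dim (amb Q)}"
  have "finite ?F" using finite_stratum_spans[OF Q] by simp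
  moreover have "subspace A \<and> \<not> amb Q \<subseteq> A" if "A \<in> ?F" for A
    using that proper_span_insert[of Q _ u] by auto
  moreover have "open (U \<inter> U')" "y \<in> U \<inter> U'" using U' assms(4,5) by auto
  ultimately obtain z where z: "z \<in> amb Q \<inter> (U \<inter> U')" "\<forall>A\<in>?F. z \<notin> A"
    using avoid_subspaces[OF subspace_amb y(1)] by meson
  show ?thesis
  proof (rule that)
    show "z \<in> stratum Q y" "z \<in> U" using z(1) U'(3) by auto
    fix w assume w: "w \<in> amb Q" "z \<in> span (insert u (stratum_span Q w))"
    then have "\<not> dim (stratum_span Q w) + 2 \<le> dim (amb Q)" using z(2) by blast
    then show "stratum_span Q w = amb Q \<or> hyperplane Q (stratum_span Q w)" by (rule small_stratum)
  qed
qed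

lemma exists_good_start:
  assumes Q: "tame Q" and C: "gkz_chamber Q C"
  shows "\<exists>c\<in>C. good_start Q c"
proof -
  obtain y where y: "y \<in> amb Q" "C = stratum Q y" using C unfolding gkz_chamber_def gkz_strata_eq by blast
  have yC: "stratum_span Q y = amb Q"
    using C chamber_stratum_iff[OF tame_finite[OF Q] y(1)] y(2) by simp
  obtain c where c: "c \<in> stratum Q y"
    "\<And>w. w \<in> amb Q \<Longrightarrow> c \<in> span (insert (det_wt Q) (stratum_span Q w)) \<Longrightarrow>
      stratum_span Q w = amb Q \<or> hyperplane Q (stratum_span Q w)"
    by (rule exists_generic_near[OF Q y(1) yC open_UNIV UNIV_I, of "det_wt Q"]) (rule that)
  have camb: "c \<in> amb Q" using c(1) by (simp add: stratum_def)
  have "ray_span Q c t = amb Q \<or> hyperplane Q (ray_span Q c t)" for t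
  proof (rule c(2)[OF ray_point_amb[OF Q camb]])
    \<comment> \<open>Translating a ray point back along \<open>det_wt Q\<close> puts the start in
      the span of \<open>det_wt Q\<close> and the stratum span, where the choice of \<open>c\<close>
      allows only chambers and walls.\<close>
    let ?A = "insert (det_wt Q) (ray_span Q c t)"
    have "ray_point Q c t \<in> span ?A" "det_wt Q \<in> span ?A"
      using self_in_stratum_span[OF ray_point_amb[OF Q camb, of t]] by (auto intro: span_base)
    then have "ray_point Q c t + t *\<^sub>R det_wt Q \<in> span ?A" by (intro span_add span_mul)
    then show "c \<in> span ?A" by (simp add: ray_point_def)
  qed
  moreover have "stratum_span Q c = amb Q" using stratum_span_cong[OF c(1)] yC by simp
  ultimately have "good_start Q c" using camb unfolding good_start_def by blast
  then show ?thesis using c(1) y(2) by blast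
qed

text \<open>\<open>chi_crossing\<close> in the direction \<open>- det_wt Q\<close>: the two pairings
  have opposite signs, so each crossing lowers chi by the degree times the Higgs value.\<close>

lemma chi_ray:
  assumes Q: "tame Q" and c: "good_start Q c" and R: "0 \<le> R" "\<And>t. t \<in> wall_times Q c \<Longrightarrow> t < R"
  shows "chi Q c = chi Q (ray_point Q c R) + (\<Sum>t\<in>wall_times Q c.
    real (wall_degree Q (ray_stratum Q c t)) *
      chi (higgs Q (ray_span Q c t)) (ray_point Q c t))"
proof -
  let ?p = "ray_point Q c"
  let ?J = "\<lambda>t. - (real (wall_degree Q (stratum Q (?p t))) * chi (higgs Q (stratum_span Q (?p t))) (?p t))"
  have camb: "c \<in> amb Q" "stratum_span Q c = amb Q" using c by (auto simp: good_start_def)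
  have V: "hyperplane Q (stratum_span Q (?p t))" if "t \<in> wall_times Q c" for t
    using that by (simp add: wall_times_def)
  have "wall_times Q c = {s \<in> {0..R}. stratum_span Q (c + s *\<^sub>R (- det_wt Q)) \<noteq> amb Q}"
    using R(2) c hyperplane_neq unfolding wall_times_def good_start_def ray_point_def
    by (auto intro: less_imp_le)
  moreover have "0 \<notin> wall_times Q c" using camb(2) hyperplane_neq by (auto simp: wall_times_def)
  moreover have "- det_wt Q \<in> amb Q" using tame_det_amb[OF Q] by (simp add: subspace_neg)
  moreover have "R \<notin> wall_times Q c" using R(2) by blast
  moreover have "l \<bullet> (- det_wt Q) \<noteq> 0 \<and> ?J s = sgn (l \<bullet> (- det_wt Q)) * (l \<bullet> det_wt Q) *
        chi (higgs Q (stratum_span Q (c + s *\<^sub>R (- det_wt Q)))) (c + s *\<^sub>R (- det_wt Q))"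
    if s: "s \<in> wall_times Q c" and l: "conormal Q (stratum_span Q (c + s *\<^sub>R (- det_wt Q))) l" for s l
  proof -
    have l': "conormal Q (stratum_span Q (?p s)) l" using l unfolding ray_point_def .
    have sp: "span (stratum Q (?p s)) = stratum_span Q (?p s)"
      by (rule span_stratum[OF tame_finite[OF Q] ray_point_amb[OF Q camb(1)]])
    have "real (wall_degree Q (stratum Q (?p s))) = \<bar>l \<bullet> det_wt Q\<bar>"
      by (rule wall_degree_eq[OF Q]) (simp_all add: sp V[OF s] l')
    moreover have "l \<bullet> (- det_wt Q) \<noteq> 0"
      using conormal_off_hyperplane[OF V[OF s] l' _ good_start_transversal[OF Q c s]]
        tame_det_amb[OF Q] subspace_neg[OF subspace_amb] by blast
    moreover have "sgn (l \<bullet> (- det_wt Q)) * (l \<bullet> det_wt Q) = - \<bar>l \<bullet> det_wt Q\<bar>"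
      by (simp add: sgn_if)
    ultimately show ?thesis unfolding ray_point_def by simp
  qed
  ultimately have "chi Q (c + R *\<^sub>R (- det_wt Q)) = chi Q c + (\<Sum>t\<in>wall_times Q c. ?J t)"
    using inj_on_wall_times(2)[OF Q c] V camb(1) R(1) unfolding ray_point_def
    by (intro chi_crossing[OF Q]) blast+
  then show ?thesis unfolding ray_point_def[of Q c R] by (simp add: sum_negf)
qed

lemma eventually_after_walls:
  assumes "tame Q" "good_start Q c"
  shows "\<forall>\<^sub>F R in at_top. 0 \<le> R \<and> (\<forall>t\<in>wall_times Q c. t < R)"
  using inj_on_wall_times(2)[OF assms]
  by (intro eventually_conj eventually_ge_at_top eventually_ball_finite ballI eventually_gt_at_top)

lemma ray_point_after_walls:
  assumes "good_start Q c" "0 \<le> R" "\<forall>t\<in>wall_times Q c. t < R"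
  shows "ray_span Q c R = amb Q"
  using assms unfolding good_start_def wall_times_def by blast

text \<open>A wall met by the segment joining the far points, with \<open>det_wt Q\<close> outside
  its span, would have in its span a point at bounded distance from \<open>- R det_wt Q\<close>,
  impossible for large \<open>R\<close>. On the remaining walls \<open>det_wt Q\<close> pairs to 0
  with the conormal.\<close>

lemma chi_far_unique:
  fixes Q :: "('i, 'v::euclidean_space) toric_git"
  assumes Q: "tame Q" and c: "good_start Q c" and d: "good_start Q d"
  shows "\<forall>\<^sub>F R in at_top. chi Q (ray_point Q c R) = chi Q (ray_point Q d R)"
proof -
  let ?D = "det_wt Q"
  define VV where "VV = {V \<in> stratum_span Q ` amb Q. hyperplane Q V \<and> ?D \<notin> V}"
  have fin: "finite VV" using finite_stratum_spans[OF Q] by (simp add: VV_def)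
  have "\<exists>l. conormal Q V l" if "V \<in> VV" for V
    using that wall_conormal[OF Q] unfolding VV_def by blast
  then obtain l where l: "\<And>V. V \<in> VV \<Longrightarrow> conormal Q V (l V)" by metis
  \<comment> \<open>Bounds the distance of the points of the segment from
    \<open>- R det_wt Q\<close>; the summand 1 is the radius of the perturbation.\<close>
  define b where "b = norm c + norm d + 1"
  have "\<forall>\<^sub>F R in at_top. \<forall>V\<in>VV. norm (l V) * b / \<bar>l V \<bullet> ?D\<bar> < R"
    by (rule eventually_ball_finite[OF fin]) (simp add: eventually_gt_at_top)
  with eventually_after_walls[OF Q c] eventually_after_walls[OF Q d] show ?thesis
  proof eventually_elim
    case (elim R)
    let ?x = "ray_point Q c R" and ?y = "ray_point Q d R"
    have cd: "c \<in> amb Q" "d \<in> amb Q" using c d by (simp_all add: good_start_def)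
    note x = ray_point_amb[OF Q cd(1), of R] ray_point_after_walls[OF c conjunct1[OF elim(1)] conjunct2[OF elim(1)]]
    note y = ray_point_amb[OF Q cd(2), of R] ray_point_after_walls[OF d conjunct1[OF elim(2)] conjunct2[OF elim(2)]]
    \<comment> \<open>Perturbs the second end within its chamber: chi is unchanged there, and the
      segment now meets only chambers and walls.\<close>
    obtain z where z: "z \<in> stratum Q ?y" "z \<in> ball ?y 1"
      "\<And>w. w \<in> amb Q \<Longrightarrow> z \<in> span (insert ?x (stratum_span Q w)) \<Longrightarrow>
        stratum_span Q w = amb Q \<or> hyperplane Q (stratum_span Q w)"
      by (rule exists_generic_near[OF Q y open_ball[of ?y 1], where u = ?x]) (simp, rule that)
    have zamb: "z \<in> amb Q" "stratum_span Q z = amb Q"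
      using z(1) stratum_span_cong[OF z(1)] y(2) by (auto simp: stratum_def)
    define v where "v = z - ?x"
    have v: "v \<in> amb Q" unfolding v_def by (rule subspace_diff[OF subspace_amb zamb(1) x(1)])
    have amb: "?x + s *\<^sub>R v \<in> amb Q" for s
      by (rule subspace_add[OF subspace_amb x(1) subspace_mul[OF subspace_amb v]])
    have gen: "stratum_span Q (?x + s *\<^sub>R v) = amb Q \<or> hyperplane Q (stratum_span Q (?x + s *\<^sub>R v))"
      for s
    proof (cases "s = 0")
      case True
      then show ?thesis using x by simp
    next
      case False
      let ?w = "?x + s *\<^sub>R v"
      let ?A = "insert ?x (stratum_span Q ?w)"
      have w: "?w \<in> span ?A" using self_in_stratum_span[OF amb[of s]] by (intro span_base insertI2)
      have x': "?x \<in> span ?A" by (intro span_base insertI1)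
      \<comment> \<open>For nonzero \<open>s\<close> the end \<open>z\<close> lies on the line
        through \<open>?x\<close> and \<open>?w\<close>, which is why \<open>?x\<close> is the
        vector adjoined to the stratum spans.\<close>
      have "?x + (1 / s) *\<^sub>R (?w - ?x) \<in> span ?A" by (rule span_add[OF x' span_mul[OF span_diff[OF w x']]])
      moreover have "?x + (1 / s) *\<^sub>R (?w - ?x) = z" using False by (simp add: v_def)
      ultimately show ?thesis using z(3)[OF amb[of s]] by metis
    qed
    define T where "T = {s \<in> {0..1}. stratum_span Q (?x + s *\<^sub>R v) \<noteq> amb Q}"
    have TV: "hyperplane Q (stratum_span Q (?x + s *\<^sub>R v))" if "s \<in> T" for s
      using that gen unfolding T_def by blast
    have trans: "v \<notin> stratum_span Q (?x + s *\<^sub>R v)" if "s \<in> T" for s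
      using that gen TV[OF that] by (intro line_transversal[OF Q x v]) (auto simp: T_def)
    have x1: "?x + 1 *\<^sub>R v = z" by (simp add: v_def)
    have "chi Q (?x + 1 *\<^sub>R v) = chi Q ?x + (\<Sum>s\<in>T. 0)"
    proof (rule chi_crossing[OF Q x(1) v zero_le_one T_def finite_times_on_line[OF Q x(1) v trans]])
      show "0 \<notin> T" "1 \<notin> T" using x(2) zamb(2) x1 by (auto simp: T_def)
      fix s m assume s: "s \<in> T" and m: "conormal Q (stratum_span Q (?x + s *\<^sub>R v)) m"
      let ?w = "?x + s *\<^sub>R v"
      let ?V = "stratum_span Q ?w"
      have "?D \<in> ?V"
      proof (rule ccontr)
        assume D: "?D \<notin> ?V"
        have V: "?V \<in> VV" using D TV[OF s] amb unfolding VV_def by blast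
        note lV = l[OF V]
        have lw: "l ?V \<bullet> ?w = 0"
          using lV self_in_stratum_span[OF amb[of s]] unfolding conormal_def by blast
        have lD: "l ?V \<bullet> ?D \<noteq> 0" by (rule conormal_off_hyperplane[OF TV[OF s] lV tame_det_amb[OF Q] D])
        have s01: "0 \<le> s" "s \<le> 1" using s by (auto simp: T_def)
        have zR: "norm (z + R *\<^sub>R ?D) \<le> norm d + 1"
        proof -
          have "z + R *\<^sub>R ?D = d - (?y - z)" by (simp add: ray_point_def)
          also have "norm \<dots> \<le> norm d + norm (?y - z)" by (rule norm_triangle_ineq4)
          finally show ?thesis using z(2) by (simp add: dist_norm)
        qed
        have "?w + R *\<^sub>R ?D = (1 - s) *\<^sub>R c + s *\<^sub>R (z + R *\<^sub>R ?D)"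
          by (simp add: v_def ray_point_def algebra_simps)
        also have "norm \<dots> \<le> (1 - s) * norm c + s * norm (z + R *\<^sub>R ?D)"
          using s01 by (intro order_trans[OF norm_triangle_ineq]) simp
        also have "\<dots> \<le> 1 * norm c + 1 * (norm d + 1)"
          using s01 zR by (intro add_mono mult_mono) auto
        finally have nb: "norm (?w + R *\<^sub>R ?D) \<le> b" by (simp add: b_def)
        have "R * \<bar>l ?V \<bullet> ?D\<bar> = \<bar>l ?V \<bullet> (?w + R *\<^sub>R ?D)\<bar>"
          using lw elim(1) by (simp add: inner_add_right abs_mult)
        also have "\<dots> \<le> norm (l ?V) * norm (?w + R *\<^sub>R ?D)" by (rule Cauchy_Schwarz_ineq2)
        also have "\<dots> \<le> norm (l ?V) * b" using nb by (intro mult_left_mono) auto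
        finally have "R \<le> norm (l ?V) * b / \<bar>l ?V \<bullet> ?D\<bar>" using lD by (simp add: pos_le_divide_eq)
        then show False using elim(3) V by fastforce
      qed
      then have "m \<bullet> ?D = 0" using m unfolding conormal_def by blast
      moreover have "m \<bullet> v \<noteq> 0" by (rule conormal_off_hyperplane[OF TV[OF s] m v trans[OF s]])
      ultimately show "m \<bullet> v \<noteq> 0 \<and> 0 = sgn (m \<bullet> v) * (m \<bullet> ?D) * chi (higgs Q ?V) ?w" by simp
    qed (use TV in auto)
    then show ?case using chi_cong[OF z(1)] unfolding x1 by simp
  qed
qed

text \<open>The Euler characteristic of the minimal phase at the end of a ray.\<close>

definition min_chi :: "('i, 'v::euclidean_space) toric_git \<Rightarrow> real" where
  "min_chi Q = (SOME e. \<exists>c. good_start Q c \<and> (\<forall>\<^sub>F R in at_top. chi Q (ray_point Q c R) = e))"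

text \<open>Along one good ray chi is eventually constant by \<open>chi_ray\<close>, so the choice
  in \<open>min_chi\<close> is from a nonempty set; \<open>chi_far_unique\<close> carries the chosen
  value to every other ray.\<close>

lemma chi_ray_far:
  assumes Q: "tame Q" and c: "good_start Q c"
  shows "\<forall>\<^sub>F R in at_top. chi Q (ray_point Q c R) = min_chi Q"
proof -
  let ?s = "\<Sum>t\<in>wall_times Q c. real (wall_degree Q (ray_stratum Q c t)) *
      chi (higgs Q (ray_span Q c t)) (ray_point Q c t)"
  have "\<forall>\<^sub>F R in at_top. chi Q (ray_point Q c R) = chi Q c - ?s"
    using eventually_after_walls[OF assms]
  proof (rule eventually_mono)
    fix R assume "0 \<le> R \<and> (\<forall>t\<in>wall_times Q c. t < R)"
    then show "chi Q (ray_point Q c R) = chi Q c - ?s" using chi_ray[OF Q c, of R] by simp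
  qed
  then have "\<exists>e c. good_start Q c \<and> (\<forall>\<^sub>F R in at_top. chi Q (ray_point Q c R) = e)" using c by blast
  from someI_ex[OF this, folded min_chi_def]
  obtain d where d: "good_start Q d" "\<forall>\<^sub>F R in at_top. chi Q (ray_point Q d R) = min_chi Q"
    by blast
  show ?thesis using chi_far_unique[OF Q c d(1)] d(2) by eventually_elim simp
qed

lemma chi_decomposition:
  assumes Q: "tame Q" and c: "good_start Q c"
  shows "chi Q c = min_chi Q + (\<Sum>t\<in>wall_times Q c.
    real (wall_degree Q (ray_stratum Q c t)) *
      chi (higgs Q (ray_span Q c t)) (ray_point Q c t))"
proof -
  obtain R where "chi Q (ray_point Q c R) = min_chi Q" "0 \<le> R" "\<forall>t\<in>wall_times Q c. t < R"
    using eventually_happens'[OF trivial_limit_at_top_linorder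
        eventually_conj[OF chi_ray_far[OF assms] eventually_after_walls[OF assms]]] by blast
  then show ?thesis using chi_ray[OF assms, of R] by simp
qed

lemma chi_outside:
  assumes Q: "tame Q" and "x \<notin> wcone Q (idx Q)"
  shows "chi Q x = 0"
  unfolding chi_sum[OF Q]
proof (rule sum.neutral, rule ballI)
  fix S assume "S \<in> bases Q"
  then have "wcone Q S \<subseteq> wcone Q (idx Q)"
    using wcone_mono[OF tame_finite[OF Q]] unfolding bases_def by blast
  then show "(if x \<in> wcone Q S then real (box_index Q S) else 0) = 0" using assms(2) by auto
qed

lemma relevant_ambI:
  assumes Q: "tame Q" and "- det_wt Q \<in> wcone Q (idx Q)"
  shows "relevant Q (amb Q)"
proof -
  have idx: "idx_in Q (amb Q) = idx Q" using tame_wt_amb[OF Q] by (auto simp: idx_in_def)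
  have sup: "weight_supported Q (amb Q)" unfolding weight_supported_def idx tame_span[OF Q] ..
  obtain t where t: "\<And>i. i \<in> idx Q \<Longrightarrow> 0 \<le> t i" "- det_wt Q = (\<Sum>i\<in>idx Q. t i *\<^sub>R wt Q i)"
    by (rule wconeE[OF assms(2)]) (rule that)
  \<comment> \<open>Adding \<open>det_wt Q\<close> to its negative raises every coefficient by 1 and
    yields a strictly positive relation.\<close>
  have "(\<Sum>i\<in>idx Q. (t i + 1) *\<^sub>R wt Q i) = - det_wt Q + det_wt Q"
    unfolding t(2) by (simp add: scaleR_left_distrib sum.distrib det_wt_def)
  moreover have "\<forall>i\<in>idx Q. 0 < t i + 1" using t(1) by (auto intro: add_nonneg_pos)
  ultimately show ?thesis
    using sup unfolding relevant_def idx by (intro conjI exI[of _ "\<lambda>i. t i + 1"]) simp_all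
qed

text \<open>Divided by \<open>R\<close>, the ray point tends to \<open>- det_wt Q\<close>, which
  lies off the closed support cone when \<open>amb Q\<close> is not relevant; so the ray leaves the
  support.\<close>

lemma min_chi_irrelevant:
  assumes Q: "tame Q" and c: "good_start Q c" and "\<not> relevant Q (amb Q)"
  shows "min_chi Q = 0"
proof -
  have "- det_wt Q \<notin> wcone Q (idx Q)" using assms(3) relevant_ambI[OF Q] by blast
  then have "\<forall>\<^sub>F y in nhds (- det_wt Q). y \<notin> wcone Q (idx Q)"
    by (rule eventually_not_in_wcone[OF tame_finite[OF Q]])
  moreover have "((\<lambda>R. - det_wt Q + (1 / R) *\<^sub>R c) \<longlongrightarrow> - det_wt Q + 0 *\<^sub>R c) at_top"
    by (intro tendsto_intros tendsto_divide_0[OF tendsto_const] filterlim_at_top_imp_at_infinity filterlim_ident)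
  then have "filterlim (\<lambda>R. - det_wt Q + (1 / R) *\<^sub>R c) (nhds (- det_wt Q)) at_top" by simp
  ultimately have "\<forall>\<^sub>F R in at_top. - det_wt Q + (1 / R) *\<^sub>R c \<notin> wcone Q (idx Q)"
    by (rule eventually_compose_filterlim)
  then have "\<forall>\<^sub>F R in at_top. chi Q (ray_point Q c R) = 0"
    using eventually_gt_at_top[of 0]
  proof eventually_elim
    case (elim R)
    have "ray_point Q c R \<notin> wcone Q (idx Q)"
    proof
      assume "ray_point Q c R \<in> wcone Q (idx Q)"
      then have "(1 / R) *\<^sub>R ray_point Q c R \<in> wcone Q (idx Q)" using elim(2) by (intro wcone_scale) auto
      moreover have "(1 / R) *\<^sub>R ray_point Q c R = - det_wt Q + (1 / R) *\<^sub>R c"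
        using elim(2) by (simp add: ray_point_def scaleR_right_diff_distrib)
      ultimately show False using elim(1) by simp
    qed
    then show ?case by (rule chi_outside[OF Q])
  qed
  \<comment> \<open>The trivial conjunct fixes the type of the eventual variable.\<close>
  with chi_ray_far[OF Q c] have "\<forall>\<^sub>F R in at_top. min_chi Q = 0 \<and> (R::real) = R"
    by eventually_elim simp
  then show ?thesis by simp
qed

section \<open>Complete semi-orthogonal decompositions\<close>

lemma wall_time:
  assumes Q: "tame Q" and c: "c \<in> amb Q" and t: "t \<in> wall_times Q c"
  shows "ray_point Q c t \<in> amb Q"
    and "hyperplane Q (ray_span Q c t)"
    and "span (ray_stratum Q c t) = ray_span Q c t"
    and "weight_supported Q (ray_span Q c t)"
    and "tame (higgs Q (ray_span Q c t))"
    and "amb (higgs Q (ray_span Q c t)) = ray_span Q c t"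
proof -
  show p: "ray_point Q c t \<in> amb Q" by (rule ray_point_amb[OF Q c])
  show V: "hyperplane Q (ray_span Q c t)" using t by (simp add: wall_times_def)
  show "span (ray_stratum Q c t) = ray_span Q c t"
    by (rule span_stratum[OF tame_finite[OF Q] p])
  show sup: "weight_supported Q (ray_span Q c t)" by (rule wall_supported[OF Q p V])
  show "tame (higgs Q (ray_span Q c t))" by (rule tame_higgs[OF Q sup])
  show "amb (higgs Q (ray_span Q c t)) = ray_span Q c t"
    by (rule amb_higgs[OF Q sup])
qed

lemma good_start_amb: "good_start Q c \<Longrightarrow> c \<in> amb Q"
  by (simp add: good_start_def)

lemma finite_crossed_walls:
  assumes "tame Q" "good_start Q c"
  shows "finite (crossed_walls Q c)"
  unfolding crossed_walls_eq[OF assms(1) good_start_amb[OF assms(2)]]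
  by (intro finite_imageI inj_on_wall_times[OF assms])

lemma crossed_wallE:
  assumes "tame Q" "c \<in> amb Q" "W \<in> crossed_walls Q c"
  obtains t where "t \<in> wall_times Q c" "W = ray_stratum Q c t"
  using assms(3) unfolding crossed_walls_eq[OF assms(1,2)] by (elim imageE) (rule that)

lemma sum_crossed_walls:
  assumes "tame Q" "good_start Q c"
  shows "(\<Sum>W\<in>crossed_walls Q c. f W) = (\<Sum>t\<in>wall_times Q c. f (ray_stratum Q c t))"
  unfolding crossed_walls_eq[OF assms(1) good_start_amb[OF assms(2)]]
  by (rule sum.reindex[OF inj_on_wall_times(1)[OF assms], unfolded o_def])

lemma complete_sod_chamber: "complete_sod Q C M \<Longrightarrow> gkz_chamber Q C"
  by (erule complete_sod.cases) auto

text \<open>A label enters only as the full space of an iterated Higgs problem, and only if relevant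
  there; relevance does not change between a problem and its Higgs problem. It allows Coulomb
  problems of labels to be formed.\<close>

lemma sod_labels_relevant:
  assumes "complete_sod Q C M" "tame Q" "H \<in># M"
  shows "relevant Q H"
  using assms
proof (induction rule: complete_sod.induct)
  case (sod_empty Q C)
  then show ?case by simp
next
  case (sod_cross Q C c Z M)
  have c: "good_start Q c" using generic_start_iff[OF sod_cross.prems(1)] sod_cross.hyps by blast
  show ?case
  proof (cases "H = amb Q \<and> relevant Q (amb Q)")
    case False
    let ?S = "\<Sum>W\<in>crossed_walls Q c. repeat_mset (wall_degree Q W) (M W)"
    have "H \<in># ?S" using sod_cross.prems(2) False by (auto split: if_splits)
    then have "count ?S H \<noteq> 0" by (simp add: count_eq_zero_iff)
    then have "(\<Sum>W\<in>crossed_walls Q c. wall_degree Q W * count (M W) H) \<noteq> 0" by (simp add: count_sum)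
    then obtain W where W: "W \<in> crossed_walls Q c" "wall_degree Q W * count (M W) H \<noteq> 0"
      by (rule sum.not_neutral_contains_not_neutral)
    then have HM: "H \<in># M W" by (metis count_eq_zero_iff mult_0_right)
    obtain t where t: "t \<in> wall_times Q c" "W = ray_stratum Q c t"
      by (rule crossed_wallE[OF sod_cross.prems(1) good_start_amb[OF c] W(1)]) (rule that)
    note wt = wall_time[OF sod_cross.prems(1) good_start_amb[OF c] t(1)]
    have sp: "span W = ray_span Q c t" using wt(3) t(2) by simp
    have "complete_sod (higgs Q (span W)) (Z W) (M W)"
      and rel: "relevant (higgs Q (span W)) H"
      using sod_cross.IH[OF W(1)] HM wt(5) unfolding sp by blast+
    then have "H \<subseteq> span W"
      using complete_sod_labels[of "higgs Q (span W)" "Z W" "M W" H] HM wt(6) unfolding sp by simp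
    then show ?thesis using rel relevant_higgs by blast
  qed simp
qed

lemma sum_mset_repeat:
  "(\<Sum>x\<in>#repeat_mset n M. f x) = of_nat n * (\<Sum>x\<in>#M. f x :: 'a::comm_semiring_1)"
  by (induction n) (simp_all add: algebra_simps)

lemma sum_mset_sum:
  assumes "finite A"
  shows "(\<Sum>x\<in>#(\<Sum>a\<in>A. M a). f x) = (\<Sum>a\<in>A. \<Sum>x\<in>#M a. f x)"
  using assms by (induction A rule: finite_induct) simp_all

text \<open>Iterates \<open>chi_decomposition\<close> along the run. A minimal phase that the run
  omits has \<open>min_chi\<close> equal to 0, and a label contributes the same in nested Higgs
  problems by \<open>higgs_higgs\<close>.\<close>

lemma chi_complete_sod:
  assumes "complete_sod Q C M" "tame Q" "x \<in> C"
  shows "chi Q x = (\<Sum>H\<in>#M. min_chi (higgs Q H))"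
  using assms
proof (induction arbitrary: x rule: complete_sod.induct)
  case (sod_empty Q C)
  then have "x \<notin> wcone Q (idx Q)" by blast
  then show ?case using chi_outside[OF sod_empty.prems(1)] by simp
next
  case (sod_cross Q C c Z M)
  note Q = sod_cross.prems(1)
  have c: "good_start Q c" using generic_start_iff[OF Q] sod_cross.hyps by blast
  note camb = good_start_amb[OF c]
  have C: "C = stratum Q c" by (rule chamber_of_mem[OF sod_cross.hyps(1) sod_cross.hyps(3)])
  let ?f = "\<lambda>H. min_chi (higgs Q H)"
  have W: "chi (higgs Q (ray_span Q c t)) (ray_point Q c t)
      = (\<Sum>H\<in>#M (ray_stratum Q c t). ?f H)" if t: "t \<in> wall_times Q c" for t
  proof -
    let ?p = "ray_point Q c t"
    let ?W = "stratum Q ?p" and ?V = "stratum_span Q ?p"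
    note wt = wall_time[OF Q camb t]
    have W: "?W \<in> crossed_walls Q c" unfolding crossed_walls_eq[OF Q camb] using t by blast
    have IH: "complete_sod (higgs Q ?V) (Z ?W) (M ?W)" "?W \<subseteq> Z ?W"
      "\<And>x. x \<in> Z ?W \<Longrightarrow> chi (higgs Q ?V) x = (\<Sum>H\<in>#M ?W. min_chi (higgs (higgs Q ?V) H))"
      using sod_cross.IH[OF W] wt(5) unfolding wt(3) by blast+
    have "?p \<in> Z ?W" using IH(2) stratum_self[OF wt(1)] by blast
    then have "chi (higgs Q ?V) ?p = (\<Sum>H\<in>#M ?W. min_chi (higgs (higgs Q ?V) H))" by (rule IH(3))
    also have "\<dots> = (\<Sum>H\<in>#M ?W. ?f H)"
    proof (intro arg_cong[where f = sum_mset] image_mset_cong)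
      fix H assume "H \<in># M ?W"
      then have "H \<subseteq> ?V" using complete_sod_labels[OF IH(1)] unfolding wt(6) by blast
      then show "min_chi (higgs (higgs Q ?V) H) = ?f H" by (simp add: higgs_higgs)
    qed
    finally show ?thesis .
  qed
  have "chi Q x = chi Q c" using sod_cross.prems(2) unfolding C by (rule chi_cong)
  also have "\<dots> = min_chi Q + (\<Sum>t\<in>wall_times Q c. real (wall_degree Q (ray_stratum Q c t)) *
      (\<Sum>H\<in>#M (ray_stratum Q c t). ?f H))"
    unfolding chi_decomposition[OF Q c] using W by simp
  also have "\<dots> = min_chi Q + (\<Sum>W\<in>crossed_walls Q c. real (wall_degree Q W) * (\<Sum>H\<in>#M W. ?f H))"
    unfolding sum_crossed_walls[OF Q c] ..
  also have "min_chi Q = (\<Sum>H\<in>#(if relevant Q (amb Q) then {#amb Q#} else {#}). ?f H)"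
    using min_chi_irrelevant[OF Q c] higgs_amb[OF Q] by simp
  also have "(\<Sum>W\<in>crossed_walls Q c. real (wall_degree Q W) * (\<Sum>H\<in>#M W. ?f H))
      = (\<Sum>H\<in>#(\<Sum>W\<in>crossed_walls Q c. repeat_mset (wall_degree Q W) (M W)). ?f H)"
    by (simp add: sum_mset_sum[OF finite_crossed_walls[OF Q c]] sum_mset_repeat)
  finally show ?case by simp
qed

text \<open>The Higgs problem of a wall lives in the same type and has smaller dimension, so runs
  are built by induction; the chamber for a wall is the Higgs stratum of the crossing point.\<close>

lemma exists_complete_sod:
  fixes Q :: "('i, 'v::euclidean_space) toric_git"
  assumes "tame Q" "gkz_chamber Q C"
  shows "\<exists>M. complete_sod Q C M"
  using assms
proof (induction "dim (amb Q)" arbitrary: Q C rule: less_induct)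
  case less
  note Q = less.prems(1)
  obtain c where c: "c \<in> C" "good_start Q c" using exists_good_start[OF less.prems] by blast
  note camb = good_start_amb[OF c(2)]
  have C: "C = stratum Q c" by (rule chamber_of_mem[OF less.prems(2) c(1)])
  show ?case
  proof (cases "c \<in> wcone Q (idx Q)")
    case False
    then have "C \<inter> wcone Q (idx Q) = {}" unfolding C stratum_def by blast
    then show ?thesis using complete_sod.sod_empty[OF less.prems(2)] by blast
  next
    case True
    then have sub: "C \<subseteq> wcone Q (idx Q)" unfolding C stratum_def by blast
    have gen: "generic_start Q c" using generic_start_iff[OF less.prems c(1)] c(2) by blast
    have "\<exists>Z N. gkz_chamber (higgs Q (span W)) Z \<and> W \<subseteq> Z \<and> complete_sod (higgs Q (span W)) Z N"
      if W: "W \<in> crossed_walls Q c" for W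
    proof -
      obtain t where t: "t \<in> wall_times Q c" "W = ray_stratum Q c t"
        by (rule crossed_wallE[OF Q camb W]) (rule that)
      let ?p = "ray_point Q c t"
      let ?QV = "higgs Q (stratum_span Q ?p)"
      note wt = wall_time[OF Q camb t(1)]
      have sp: "span W = stratum_span Q ?p" using wt(3) t(2) by simp
      note hw = higgs_wall_chamber[OF Q wt(1,2)]
      have ch: "gkz_chamber ?QV (stratum ?QV ?p)"
        using chamber_stratum_iff[OF tame_finite[OF wt(5)] hw(1)] hw(2) by blast
      have "dim (amb ?QV) < dim (amb Q)" using wt(2) unfolding wt(6) hyperplane_def by simp
      then obtain N where "complete_sod ?QV (stratum ?QV ?p) N" using less.hyps wt(5) ch by blast
      then show ?thesis using ch hw(3) unfolding sp unfolding t(2) by blast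
    qed
    then obtain Z N where "\<And>W. W \<in> crossed_walls Q c \<Longrightarrow>
      gkz_chamber (higgs Q (span W)) (Z W) \<and> W \<subseteq> Z W \<and> complete_sod (higgs Q (span W)) (Z W) (N W)"
      by metis
    from complete_sod.sod_cross[OF less.prems(2) sub c(1) gen this] show ?thesis by blast
  qed
qed

section \<open>Coulomb problems\<close>

lemma coulomb_simps [simp]:
  "dlat (coulomb \<pi> Q H) = \<pi> ` dlat Q" "idx (coulomb \<pi> Q H) = idx Q - idx_in Q H"
  "wt (coulomb \<pi> Q H) = \<pi> \<circ> wt Q"
  by (simp_all add: coulomb_def)

text \<open>Adding a large multiple of the strictly positive relation to \<open>- x\<close> makes
  all coefficients nonnegative, so the cone is closed under negation and is a subspace.\<close>

lemma relevant_wcone: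
  assumes Q: "tame Q" and H: "relevant Q H"
  shows "wcone Q (idx_in Q H) = H"
proof
  let ?I = "idx_in Q H"
  have fin: "finite ?I" using tame_finite[OF Q] by (simp add: idx_in_def)
  have sup: "H = span (wt Q ` ?I)" using H unfolding relevant_def weight_supported_def by blast
  show "wcone Q ?I \<subseteq> H" using wcone_subset_span[of Q ?I] unfolding sup[symmetric] .
  obtain c where c: "\<And>i. i \<in> ?I \<Longrightarrow> c i > (0::real)" "(\<Sum>i\<in>?I. c i *\<^sub>R wt Q i) = 0"
    using H unfolding relevant_def by blast
  have neg: "- x \<in> wcone Q ?I" if x: "x \<in> wcone Q ?I" for x
  proof -
    obtain t where t: "\<And>i. i \<in> ?I \<Longrightarrow> 0 \<le> t i" "x = (\<Sum>i\<in>?I. t i *\<^sub>R wt Q i)"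
      by (rule wconeE[OF x]) (rule that)
    \<comment> \<open>Any common upper bound of the quotients \<open>t i / c i\<close> would do;
      their sum is one because they are nonnegative.\<close>
    define r where "r = (\<Sum>i\<in>?I. t i / c i)"
    have "t i \<le> r * c i" if i: "i \<in> ?I" for i
    proof -
      have "t i / c i \<le> r" unfolding r_def
        using fin i t(1) c(1) by (intro member_le_sum) (auto intro!: divide_nonneg_pos)
      then show ?thesis using c(1)[OF i] by (simp add: pos_divide_le_eq)
    qed
    moreover have "- x = (\<Sum>i\<in>?I. (r * c i - t i) *\<^sub>R wt Q i)"
    proof -
      have "(\<Sum>i\<in>?I. (r * c i) *\<^sub>R wt Q i) = r *\<^sub>R (\<Sum>i\<in>?I. c i *\<^sub>R wt Q i)"
        by (simp add: scaleR_sum_right)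
      then show ?thesis using t(2) c(2) by (simp add: scaleR_left_diff_distrib sum_subtractf)
    qed
    ultimately show ?thesis by (intro wconeI[of _ "\<lambda>i. r * c i - t i"]) auto
  qed
  have "subspace (wcone Q ?I)"
    unfolding subspace_def
  proof (intro conjI ballI allI)
    fix x y and r :: real assume x: "x \<in> wcone Q ?I"
    show "r *\<^sub>R x \<in> wcone Q ?I"
    proof (cases "0 \<le> r")
      case True
      then show ?thesis by (rule wcone_scale[OF x])
    next
      case False
      then have "(- r) *\<^sub>R (- x) \<in> wcone Q ?I" by (intro wcone_scale[OF neg[OF x]]) simp
      then show ?thesis by simp
    qed
  qed (auto intro: zero_in_wcone wcone_add)
  then have "span (wt Q ` ?I) \<subseteq> wcone Q ?I"
    by (intro span_minimal image_subsetI wt_in_wcone[OF fin])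
  then show "H \<subseteq> wcone Q ?I" unfolding sup[symmetric] .
qed

text \<open>Asks for \<open>tame Q\<close> rather than a toric GIT problem, so that the Higgs
  problem of a wall whose span contains \<open>H\<close> is again an instance
  (\<open>quotient_higgs\<close>).\<close>

locale relevant_quotient =
  fixes Q :: "('i, 'v::euclidean_space) toric_git" and H :: "'v set" and \<pi> :: "'v \<Rightarrow> 'w::euclidean_space"
  assumes Q: "tame Q" and rel: "relevant Q H" and real: "realises_quotient Q H \<pi>"
begin

abbreviation "K \<equiv> coulomb \<pi> Q H"
abbreviation "I \<equiv> idx_in Q H"

lemma lin: "linear \<pi>"
  using real by (simp add: realises_quotient_def)

lemma ker: "v \<in> amb Q \<Longrightarrow> \<pi> v = 0 \<longleftrightarrow> v \<in> H"
  using real unfolding realises_quotient_def by blast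

lemma H_amb: "H \<subseteq> amb Q"
  using real unfolding realises_quotient_def by blast

lemma H_span: "span (wt Q ` I) = H"
  using rel unfolding relevant_def weight_supported_def by blast

lemma H_subspace: "subspace H"
  by (metis H_span subspace_span)

lemma pi_H: "v \<in> H \<Longrightarrow> \<pi> v = 0"
  using ker H_amb by blast

lemma ker_diff:
  assumes "x \<in> amb Q" "y \<in> amb Q" "\<pi> x = \<pi> y"
  shows "x - y \<in> H"
  using ker[OF subspace_diff[OF subspace_amb assms(1,2)]] assms(3) by (simp add: linear_diff[OF lin])

lemma I_sub: "I \<subseteq> idx Q"
  by (auto simp: idx_in_def)

lemma pi_wt_I: "i \<in> I \<Longrightarrow> \<pi> (wt Q i) = 0"
  by (rule pi_H) (simp add: idx_in_def)

lemma amb_coulomb: "amb K = \<pi> ` amb Q"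
  by (simp add: amb_def linear_span_image[OF lin])

lemma dlat_amb: "x \<in> dlat Q \<Longrightarrow> x \<in> amb Q"
  by (simp add: amb_def span_base)

lemma span_amb: "S \<subseteq> idx Q \<Longrightarrow> span (wt Q ` S) \<subseteq> amb Q"
  using tame_span[OF Q] span_mono[of "wt Q ` S" "wt Q ` idx Q"] by blast

text \<open>Two lifts differ by an arbitrary element of \<open>H\<close>. Relevance writes it with
  nonnegative coefficients on \<open>I\<close>, whereas weight support alone would give only a
  linear combination.\<close>

lemma wcone_coulomb_iff:
  assumes S: "S \<subseteq> idx Q - I" and x: "x \<in> amb Q"
  shows "\<pi> x \<in> wcone K S \<longleftrightarrow> x \<in> wcone Q (S \<union> I)"
proof
  have "S \<union> I \<subseteq> idx Q" using S I_sub by blast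
  then have fin: "finite (S \<union> I)" by (rule finite_subset[OF _ tame_finite[OF Q]])
  assume "\<pi> x \<in> wcone K S"
  then obtain t where t: "\<And>i. i \<in> S \<Longrightarrow> 0 \<le> t i" "\<pi> x = (\<Sum>i\<in>S. t i *\<^sub>R wt K i)"
    by (rule wconeE) (rule that)
  let ?y = "\<Sum>i\<in>S. t i *\<^sub>R wt Q i"
  have y: "?y \<in> wcone Q S" using t(1) by (rule wconeI) auto
  have "\<pi> x = \<pi> ?y" unfolding t(2) linear_sum[OF lin] linear_cmul[OF lin] by simp
  moreover have "?y \<in> amb Q" using y wcone_subset_amb[OF Q] S by blast
  ultimately have "x - ?y \<in> wcone Q I" using ker_diff[OF x] relevant_wcone[OF Q rel] by simp
  then have "?y + (x - ?y) \<in> wcone Q (S \<union> I)"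
    using y wcone_mono[OF fin, of S] wcone_mono[OF fin, of I] by (intro wcone_add) auto
  then show "x \<in> wcone Q (S \<union> I)" by simp
next
  have "S \<union> I \<subseteq> idx Q" using S I_sub by blast
  then have fin: "finite (S \<union> I)" by (rule finite_subset[OF _ tame_finite[OF Q]])
  assume "x \<in> wcone Q (S \<union> I)"
  then obtain t where t: "\<And>i. i \<in> S \<union> I \<Longrightarrow> 0 \<le> t i" "x = (\<Sum>i\<in>S \<union> I. t i *\<^sub>R wt Q i)"
    by (rule wconeE) (rule that)
  have "\<pi> x = (\<Sum>i\<in>S \<union> I. t i *\<^sub>R \<pi> (wt Q i))"
    unfolding t(2) by (simp add: linear_sum[OF lin] linear_cmul[OF lin])
  also have "\<dots> = (\<Sum>i\<in>S. t i *\<^sub>R \<pi> (wt Q i))"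
    using fin pi_wt_I by (intro sum.mono_neutral_right) auto
  finally show "\<pi> x \<in> wcone K S" using t(1) by (intro wconeI[of _ t]) auto
qed

lemma span_coulomb_iff:
  assumes S: "S \<subseteq> idx Q - I" and x: "x \<in> amb Q"
  shows "\<pi> x \<in> span (wt K ` S) \<longleftrightarrow> x \<in> span (wt Q ` (S \<union> I))"
proof -
  have img: "span (wt K ` S) = \<pi> ` span (wt Q ` S)"
    unfolding linear_span_image[OF lin, symmetric] coulomb_simps image_comp ..
  show ?thesis
  proof
    assume "\<pi> x \<in> span (wt K ` S)"
    then obtain y where y: "y \<in> span (wt Q ` S)" "\<pi> x = \<pi> y" unfolding img by blast
    have "y \<in> amb Q" using y(1) span_amb S by blast
    then have "x - y \<in> span (wt Q ` I)" using ker_diff[OF x _ y(2)] H_span by simp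
    moreover have "span (wt Q ` I) \<subseteq> span (wt Q ` (S \<union> I))" "span (wt Q ` S) \<subseteq> span (wt Q ` (S \<union> I))"
      by (intro span_mono; blast)+
    ultimately have "y + (x - y) \<in> span (wt Q ` (S \<union> I))" using y(1) by (meson span_add subsetD)
    then show "x \<in> span (wt Q ` (S \<union> I))" by simp
  next
    assume "x \<in> span (wt Q ` (S \<union> I))"
    then have "\<pi> x \<in> span (\<pi> ` wt Q ` (S \<union> I))" unfolding linear_span_image[OF lin] by blast
    moreover have "\<pi> ` wt Q ` (S \<union> I) \<subseteq> span (wt K ` S)"
      using pi_wt_I by (auto simp: span_zero intro: span_base)
    ultimately show "\<pi> x \<in> span (wt K ` S)" using span_minimal[OF _ subspace_span] by blast
  qed
qed

text \<open>For the denominators, an independent subset of the quotient lattice is lifted and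
  completed by weights spanning \<open>H\<close>. The bound for the lifted family projects, because
  the quotient map kills the added vectors.\<close>

lemma tame_coulomb: "tame K"
proof -
  have sp: "span (wt K ` idx K) = amb K"
  proof
    show "span (wt K ` idx K) \<subseteq> amb K"
      unfolding amb_def using tame_wt[OF Q] by (intro span_mono) auto
    show "amb K \<subseteq> span (wt K ` idx K)"
    proof
      fix y assume "y \<in> amb K"
      then obtain x where x: "x \<in> amb Q" "y = \<pi> x" unfolding amb_coulomb by blast
      have "idx K \<union> I = idx Q" using I_sub by auto
      then have "x \<in> span (wt Q ` (idx K \<union> I))" using x(1) tame_span[OF Q] by simp
      then show "y \<in> span (wt K ` idx K)"
        using span_coulomb_iff[of "idx K" x] x by simp
    qed
  qed
  have diff: "x - y \<in> dlat K" if xy: "x \<in> dlat K" "y \<in> dlat K" for x y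
  proof -
    obtain u v where "u \<in> dlat Q" "x = \<pi> u" "v \<in> dlat Q" "y = \<pi> v" using xy by auto
    then have "x - y = \<pi> (u - v)" "u - v \<in> dlat Q" by (simp_all add: linear_diff[OF lin] tame_diff[OF Q])
    then show ?thesis by simp
  qed
  have zero: "0 \<in> dlat K" using tame_zero[OF Q] linear_0[OF lin] by (simp add: image_iff) (metis)
  have comm: "\<exists>m>0. \<forall>x\<in>dlat K \<inter> span B. of_int m *\<^sub>R x \<in> int_span B"
    if B: "B \<subseteq> dlat K" "independent B" for B
  proof -
    obtain BH where BH: "BH \<subseteq> wt Q ` I" "independent BH" "wt Q ` I \<subseteq> span BH"
      using maximal_independent_subset by blast
    have spH: "span BH = H"
      by (rule trans[OF _ H_span]) (intro equalityI span_mono[OF BH(1)] span_minimal[OF BH(3) subspace_span])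
    have "\<forall>b\<in>B. \<exists>x. x \<in> dlat Q \<and> \<pi> x = b" using B(1) by auto
    then obtain g where g: "\<And>b. b \<in> B \<Longrightarrow> g b \<in> dlat Q" "\<And>b. b \<in> B \<Longrightarrow> \<pi> (g b) = b" by metis
    have inj: "inj_on g B" by (rule inj_on_inverseI[of _ \<pi>]) (rule g(2))
    have BHH: "BH \<subseteq> H" unfolding spH[symmetric] by (rule span_superset)
    have disj: "BH \<inter> g ` B = {}"
    proof -
      have "0 \<notin> B" using B(2) dependent_zero by blast
      then show ?thesis using BHH pi_H g(2) by fastforce
    qed
    have finBH: "finite BH" and finB: "finite B" using BH(2) B(2) independent_imp_finite by blast+
    let ?S = "BH \<union> g ` B"
    have split: "(\<Sum>s\<in>?S. f s *\<^sub>R s) = (\<Sum>s\<in>BH. f s *\<^sub>R s) + (\<Sum>b\<in>B. f (g b) *\<^sub>R g b)" for f :: "'v \<Rightarrow> real"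
      using finBH finB disj by (simp add: sum.union_disjoint sum.reindex[OF inj])
    have pi_sum: "\<pi> (\<Sum>s\<in>?S. f s *\<^sub>R s) = (\<Sum>b\<in>B. f (g b) *\<^sub>R b)" for f :: "'v \<Rightarrow> real"
    proof -
      have "(\<Sum>s\<in>BH. f s *\<^sub>R s) \<in> H" using BHH by (intro subspace_sum subspace_mul H_subspace) auto
      then have "\<pi> (\<Sum>s\<in>BH. f s *\<^sub>R s) = 0" by (rule pi_H)
      then have "\<pi> (\<Sum>s\<in>?S. f s *\<^sub>R s) = \<pi> (\<Sum>b\<in>B. f (g b) *\<^sub>R g b)"
        unfolding split linear_add[OF lin] by simp
      also have "\<dots> = (\<Sum>b\<in>B. f (g b) *\<^sub>R \<pi> (g b))"
        unfolding linear_sum[OF lin] linear_cmul[OF lin] ..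
      also have "\<dots> = (\<Sum>b\<in>B. f (g b) *\<^sub>R b)" by (intro sum.cong) (simp_all add: g(2))
      finally show ?thesis .
    qed
    have ind: "independent ?S"
    proof (rule independent_if_scalars_zero)
      show "finite ?S" using finBH finB by simp
      fix f :: "'v \<Rightarrow> real" and x assume z: "(\<Sum>s\<in>?S. f s *\<^sub>R s) = 0" and x: "x \<in> ?S"
      have "(\<Sum>b\<in>B. f (g b) *\<^sub>R b) = 0" using pi_sum[of f] linear_0[OF lin] unfolding z by simp
      then have fg: "f (g b) = 0" if "b \<in> B" for b
        using independentD[OF B(2) finB subset_refl, of "\<lambda>b. f (g b)"] that by blast
      then have "(\<Sum>b\<in>B. f (g b) *\<^sub>R g b) = 0" by (intro sum.neutral) simp
      then have "(\<Sum>s\<in>BH. f s *\<^sub>R s) = 0" using z unfolding split by simp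
      then have "f b = 0" if "b \<in> BH" for b using independentD[OF BH(2) finBH subset_refl] that by blast
      then show "f x = 0" using x fg by blast
    qed
    have "?S \<subseteq> dlat Q" using BH(1) g(1) I_sub tame_wt[OF Q] by blast
    then obtain m where m: "m > 0" "\<forall>x\<in>dlat Q \<inter> span ?S. of_int m *\<^sub>R x \<in> int_span ?S"
      using tame_comm[OF Q _ ind] by blast
    have "of_int m *\<^sub>R y \<in> int_span B" if y: "y \<in> dlat K" "y \<in> span B" for y
    proof -
      obtain x where x: "x \<in> dlat Q" "y = \<pi> x" using y(1) by auto
      have "\<pi> ` g ` B = B" using g(2) by (simp add: image_comp)
      then have "span B = \<pi> ` span (g ` B)" using linear_span_image[OF lin, of "g ` B"] by simp
      then obtain u where u: "u \<in> span (g ` B)" "\<pi> x = \<pi> u" using y(2) x(2) by blast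
      have "span (g ` B) \<subseteq> amb Q" unfolding amb_def using g(1) by (intro span_mono) blast
      then have "x - u \<in> span BH" using ker_diff[OF dlat_amb[OF x(1)] _ u(2)] u(1) spH by blast
      moreover have "span BH \<subseteq> span ?S" "span (g ` B) \<subseteq> span ?S" by (intro span_mono; blast)+
      ultimately have "u + (x - u) \<in> span ?S" using u(1) by (meson span_add subsetD)
      then have "of_int m *\<^sub>R x \<in> int_span ?S" using m(2) x(1) by simp
      then obtain n where n: "of_int m *\<^sub>R x = (\<Sum>s\<in>?S. of_int (n s) *\<^sub>R s)" by (rule int_spanE)
      have "of_int m *\<^sub>R y = \<pi> (of_int m *\<^sub>R x)" by (simp add: x(2) linear_cmul[OF lin])
      also have "\<dots> = (\<Sum>b\<in>B. of_int (n (g b)) *\<^sub>R b)" unfolding n by (rule pi_sum)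
      finally show ?thesis by (rule int_spanI)
    qed
    then show ?thesis using m(1) by blast
  qed
  have "finite (idx K)" using tame_finite[OF Q] by simp
  moreover have "wt K ` idx K \<subseteq> dlat K" using tame_wt[OF Q] by auto
  ultimately show ?thesis unfolding tame_def using sp zero diff comm by blast
qed

section \<open>Chambers, walls and degrees in the quotient\<close>

lemma idx_coulomb_Un: "idx K \<union> I = idx Q"
  using I_sub by auto

lemma coulomb_stratum_image: "y \<in> stratum Q x \<Longrightarrow> x \<in> amb Q \<Longrightarrow> \<pi> y \<in> stratum K (\<pi> x)"
proof -
  assume y: "y \<in> stratum Q x" and x: "x \<in> amb Q"
  have yamb: "y \<in> amb Q" using y by (simp add: stratum_def)
  have "\<pi> x \<in> wcone K S \<longleftrightarrow> \<pi> y \<in> wcone K S" if S: "S \<subseteq> idx K" for S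
  proof -
    have S': "S \<subseteq> idx Q - I" using S by simp
    then have "S \<union> I \<subseteq> idx Q" using I_sub by blast
    then have "x \<in> wcone Q (S \<union> I) \<longleftrightarrow> y \<in> wcone Q (S \<union> I)" using y unfolding stratum_def by blast
    then show ?thesis unfolding wcone_coulomb_iff[OF S' x] wcone_coulomb_iff[OF S' yamb] .
  qed
  moreover have "\<pi> y \<in> amb K" using yamb by (simp add: amb_coulomb)
  ultimately show ?thesis unfolding stratum_def by blast
qed

text \<open>Adding \<open>I\<close> matches the faces of the Coulomb problem with the faces of
  \<open>Q\<close> that contain \<open>I\<close>. The conditions of all other faces are lost, which
  makes Coulomb strata coarser.\<close>

lemma coulomb_stratum_span_iff:
  assumes x: "x \<in> amb Q" and v: "v \<in> amb Q"
  shows "\<pi> v \<in> stratum_span K (\<pi> x) \<longleftrightarrow>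
    (\<forall>S\<subseteq>idx Q. I \<subseteq> S \<longrightarrow> x \<in> wcone Q S \<longrightarrow> v \<in> span (wt Q ` S))"
proof
  assume h: "\<pi> v \<in> stratum_span K (\<pi> x)"
  show "\<forall>S\<subseteq>idx Q. I \<subseteq> S \<longrightarrow> x \<in> wcone Q S \<longrightarrow> v \<in> span (wt Q ` S)"
  proof (intro allI impI)
    fix S assume S: "S \<subseteq> idx Q" "I \<subseteq> S" "x \<in> wcone Q S"
    have S': "S - I \<subseteq> idx Q - I" "S - I \<union> I = S" using S by blast+
    have "\<pi> x \<in> wcone K (S - I)" using wcone_coulomb_iff[OF S'(1) x] S(3) unfolding S'(2) by simp
    then have "\<pi> v \<in> span (wt K ` (S - I))" using h S'(1) unfolding stratum_span_def by simp
    then show "v \<in> span (wt Q ` S)" unfolding span_coulomb_iff[OF S'(1) v] S'(2) .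
  qed
next
  assume h: "\<forall>S\<subseteq>idx Q. I \<subseteq> S \<longrightarrow> x \<in> wcone Q S \<longrightarrow> v \<in> span (wt Q ` S)"
  have "\<pi> v \<in> span (wt K ` S)" if S: "S \<subseteq> idx K" "\<pi> x \<in> wcone K S" for S
  proof -
    have S': "S \<subseteq> idx Q - I" using S by simp
    then have "x \<in> wcone Q (S \<union> I)" using wcone_coulomb_iff[OF S' x] S(2) by blast
    moreover have "S \<union> I \<subseteq> idx Q" using S' I_sub by blast
    ultimately have "v \<in> span (wt Q ` (S \<union> I))" using h by blast
    then show ?thesis unfolding span_coulomb_iff[OF S' v] .
  qed
  then show "\<pi> v \<in> stratum_span K (\<pi> x)" using v unfolding stratum_span_def amb_coulomb by blast
qed

lemma coulomb_stratum_span_eqI: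
  assumes "x \<in> amb Q" "U \<subseteq> amb Q"
    and "\<And>v. v \<in> amb Q \<Longrightarrow> v \<in> U \<longleftrightarrow>
      (\<forall>S\<subseteq>idx Q. I \<subseteq> S \<longrightarrow> x \<in> wcone Q S \<longrightarrow> v \<in> span (wt Q ` S))"
  shows "stratum_span K (\<pi> x) = \<pi> ` U"
proof
  show "stratum_span K (\<pi> x) \<subseteq> \<pi> ` U"
  proof
    fix y assume y: "y \<in> stratum_span K (\<pi> x)"
    then have "y \<in> amb K" using stratum_span_subset_amb by blast
    then obtain v where v: "v \<in> amb Q" "y = \<pi> v" unfolding amb_coulomb by (rule imageE)
    then have "v \<in> U" using y coulomb_stratum_span_iff[OF assms(1) v(1)] assms(3)[OF v(1)] by simp
    then show "y \<in> \<pi> ` U" using v(2) by simp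
  qed
  show "\<pi> ` U \<subseteq> stratum_span K (\<pi> x)"
  proof (rule image_subsetI)
    fix v assume v: "v \<in> U"
    then have "v \<in> amb Q" using assms(2) by blast
    then show "\<pi> v \<in> stratum_span K (\<pi> x)"
      using v coulomb_stratum_span_iff[OF assms(1)] assms(3) by simp
  qed
qed

lemma H_subset_span: "I \<subseteq> S \<Longrightarrow> H \<subseteq> span (wt Q ` S)"
  using span_mono[of "wt Q ` I" "wt Q ` S"] H_span by (simp add: image_mono)

lemma coulomb_chamber:
  assumes "x \<in> amb Q" "stratum_span Q x = amb Q"
  shows "stratum_span K (\<pi> x) = amb K"
  unfolding amb_coulomb
proof (rule coulomb_stratum_span_eqI[OF assms(1) subset_refl])
  fix v assume v: "v \<in> amb Q"
  then show "v \<in> amb Q \<longleftrightarrow>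
      (\<forall>S\<subseteq>idx Q. I \<subseteq> S \<longrightarrow> x \<in> wcone Q S \<longrightarrow> v \<in> span (wt Q ` S))"
    using stratum_span_subset_span[of _ Q x] unfolding assms(2) by blast
qed

text \<open>A proper span from a face containing \<open>I\<close> would have to be the wall span by
  maximality, but it contains \<open>H\<close>. Such walls disappear in the quotient.\<close>

lemma coulomb_wall_off:
  assumes x: "x \<in> amb Q" and V: "hyperplane Q (stratum_span Q x)" and H: "\<not> H \<subseteq> stratum_span Q x"
  shows "stratum_span K (\<pi> x) = amb K"
  unfolding amb_coulomb
proof (rule coulomb_stratum_span_eqI[OF x subset_refl])
  fix v assume v: "v \<in> amb Q"
  have "v \<in> span (wt Q ` S)" if S: "S \<subseteq> idx Q" "I \<subseteq> S" "x \<in> wcone Q S" for S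
  proof (rule ccontr)
    assume nv: "v \<notin> span (wt Q ` S)"
    have "span (wt Q ` S) = stratum_span Q x"
      using nv v by (intro hyperplane_maximal[OF V subspace_span stratum_span_subset_span[OF S(1,3)]
            span_amb[OF S(1)]]) blast
    then show False using H H_subset_span[OF S(2)] by simp
  qed
  then show "v \<in> amb Q \<longleftrightarrow>
      (\<forall>S\<subseteq>idx Q. I \<subseteq> S \<longrightarrow> x \<in> wcone Q S \<longrightarrow> v \<in> span (wt Q ` S))"
    using v by blast
qed

text \<open>The free set spanning the wall, enlarged by \<open>I\<close>, still spans only the wall
  and is a face seen by the quotient; so the condition cutting out the wall is not lost.\<close>

lemma coulomb_wall:
  assumes x: "x \<in> amb Q" and V: "hyperplane Q (stratum_span Q x)" and H: "H \<subseteq> stratum_span Q x"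
  shows "stratum_span K (\<pi> x) = \<pi> ` stratum_span Q x"
proof (rule coulomb_stratum_span_eqI[OF x stratum_span_subset_amb])
  fix v assume v: "v \<in> amb Q"
  obtain S t where S: "S \<subseteq> idx Q" "wt_free Q S" "\<And>i. i \<in> S \<Longrightarrow> 0 < t i"
    "x = (\<Sum>i\<in>S. t i *\<^sub>R wt Q i)" "span (wt Q ` S) = stratum_span Q x"
    by (rule wall_basis[OF Q x V]) (rule that)
  have xS: "x \<in> wcone Q S" using S(3,4) by (intro wconeI[of S t]) (auto intro: less_imp_le)
  have SI: "S \<union> I \<subseteq> idx Q" using S(1) I_sub by blast
  have "x \<in> wcone Q (S \<union> I)"
    using xS wcone_mono[OF finite_subset[OF SI tame_finite[OF Q]], of S] by blast
  moreover have "span (wt Q ` (S \<union> I)) \<subseteq> stratum_span Q x"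
  proof (rule span_minimal[OF _ subspace_stratum_span])
    have "wt Q ` I \<subseteq> stratum_span Q x" using H by (auto simp: idx_in_def)
    moreover have "wt Q ` S \<subseteq> stratum_span Q x" unfolding S(5)[symmetric] by (rule span_superset)
    ultimately show "wt Q ` (S \<union> I) \<subseteq> stratum_span Q x" by blast
  qed
  ultimately show "v \<in> stratum_span Q x \<longleftrightarrow>
      (\<forall>S\<subseteq>idx Q. I \<subseteq> S \<longrightarrow> x \<in> wcone Q S \<longrightarrow> v \<in> span (wt Q ` S))"
    using SI stratum_span_subset_span[of _ Q x] by blast
qed

lemma coulomb_hyperplane:
  assumes V: "hyperplane Q V" and H: "H \<subseteq> V"
  shows "hyperplane K (\<pi> ` V)"
proof -
  have Vs: "subspace V" and Va: "V \<subseteq> amb Q" using V by (auto simp: hyperplane_def)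
  obtain u where u: "u \<in> amb Q" "u \<notin> V" using hyperplane_neq[OF V] Va by blast
  have "span (insert u V) = amb Q"
    using V u by (intro span_insert_hyperplane) (auto simp: hyperplane_def)
  then have sp: "span (insert (\<pi> u) (\<pi> ` V)) = amb K"
    unfolding amb_coulomb by (metis image_insert linear_span_image[OF lin])
  have Vs': "subspace (\<pi> ` V)" by (rule linear_subspace_image[OF lin Vs])
  have "\<pi> u \<notin> \<pi> ` V"
  proof
    assume "\<pi> u \<in> \<pi> ` V"
    then obtain v where v: "v \<in> V" "\<pi> u = \<pi> v" by (rule imageE) auto
    have "u - v \<in> V" using ker_diff[OF u(1) _ v(2)] v(1) Va H by blast
    then have "(u - v) + v \<in> V" using v(1) Vs by (intro subspace_add)
    then show False using u(2) by simp
  qed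
  then have "\<pi> u \<notin> span (\<pi> ` V)" using Vs' by (simp add: span_eq_iff[THEN iffD2])
  then have "dim (amb K) = dim (\<pi> ` V) + 1" unfolding sp[symmetric] dim_span by (simp add: dim_insert)
  moreover have "\<pi> ` V \<subseteq> amb K" unfolding amb_coulomb using Va by blast
  ultimately show ?thesis using Vs' by (simp add: hyperplane_def)
qed

lemma det_coulomb: "det_wt K = \<pi> (det_wt Q)"
proof -
  have "\<pi> (det_wt Q) = (\<Sum>i\<in>idx Q. \<pi> (wt Q i))" by (simp add: det_wt_def linear_sum[OF lin])
  also have "\<dots> = (\<Sum>i\<in>idx Q - I. \<pi> (wt Q i))"
    using tame_finite[OF Q] pi_wt_I by (intro sum.mono_neutral_right) auto
  finally show ?thesis by (simp add: det_wt_def)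
qed

lemma ray_point_coulomb: "ray_point K (\<pi> c) t = \<pi> (ray_point Q c t)"
  by (simp add: ray_point_def det_coulomb linear_add[OF lin] linear_diff[OF lin] linear_cmul[OF lin])

text \<open>A functional vanishing on \<open>H\<close> factors through the quotient. The factor is
  represented with the adjoint of a linear right inverse and then projected to \<open>amb K\<close>,
  where conormals must lie.\<close>

lemma coulomb_conormal:
  assumes V: "H \<subseteq> V" "V \<subseteq> amb Q" and l: "conormal Q V l"
  obtains l' where "conormal K (\<pi> ` V) l'" "\<And>x. x \<in> amb Q \<Longrightarrow> l' \<bullet> \<pi> x = l \<bullet> x"
proof -
  obtain g where g: "range g \<subseteq> amb Q" "linear g" "\<And>y. y \<in> \<pi> ` amb Q \<Longrightarrow> \<pi> (g y) = y"
    using linear_exists_right_inverse_on[OF lin subspace_amb] by blast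
  obtain l' z where l': "l' \<in> span (amb K)" "\<And>w. w \<in> span (amb K) \<Longrightarrow> orthogonal z w"
    "adjoint g l = l' + z"
    using orthogonal_subspace_decomp_exists[of "amb K" "adjoint g l"] by blast
  have lH: "l \<bullet> h = 0" if "h \<in> H" for h using l V that unfolding conormal_def by blast
  have eq: "l' \<bullet> \<pi> x = l \<bullet> x" if x: "x \<in> amb Q" for x
  proof -
    have px: "\<pi> x \<in> span (amb K)" using x by (intro span_base) (simp add: amb_coulomb)
    have "l' \<bullet> \<pi> x = adjoint g l \<bullet> \<pi> x"
      using l'(2)[OF px] unfolding l'(3) by (simp add: inner_add_left orthogonal_def)
    also have "\<dots> = l \<bullet> g (\<pi> x)" using adjoint_works[OF g(2)] by (simp add: inner_commute)
    also have "\<dots> = l \<bullet> x"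
    proof -
      have "\<pi> (g (\<pi> x)) = \<pi> x" using g(3) x by blast
      then have "g (\<pi> x) - x \<in> H" using g(1) x by (intro ker_diff) auto
      then show ?thesis using lH[of "g (\<pi> x) - x"] by (simp add: inner_diff_right)
    qed
    finally show ?thesis .
  qed
  have "l' \<in> amb K" using l'(1) by (simp add: span_eq_iff[THEN iffD2])
  moreover have "l' \<bullet> y \<in> \<int>" if "y \<in> dlat K" for y
    using that l eq[OF dlat_amb] unfolding conormal_def lat_def by auto
  moreover have "l' \<bullet> v = 0" if "v \<in> \<pi> ` V" for v
    using that l eq V(2) unfolding conormal_def by auto
  moreover have "\<exists>y\<in>dlat K. l' \<bullet> y = 1"
    using l eq[OF dlat_amb] unfolding conormal_def by auto
  ultimately have "conormal K (\<pi> ` V) l'" unfolding conormal_def lat_def by blast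
  then show ?thesis using that[of l'] eq by simp
qed

lemma coulomb_wall_degree:
  assumes V: "hyperplane Q V" "H \<subseteq> V" and l: "conormal Q V l"
    and W: "span W = V" "span W' = \<pi> ` V"
  shows "wall_degree K W' = wall_degree Q W"
proof -
  have "V \<subseteq> amb Q" using V(1) by (simp add: hyperplane_def)
  then obtain l' where l': "conormal K (\<pi> ` V) l'" "\<And>x. x \<in> amb Q \<Longrightarrow> l' \<bullet> \<pi> x = l \<bullet> x"
    by (rule coulomb_conormal[OF V(2) _ l]) (rule that)
  have "real (wall_degree K W') = \<bar>l' \<bullet> det_wt K\<bar>"
    using wall_degree_eq[OF tame_coulomb, of W' l'] coulomb_hyperplane[OF V] l'(1) W(2) by simp
  also have "\<dots> = \<bar>l \<bullet> det_wt Q\<bar>" unfolding det_coulomb l'(2)[OF tame_det_amb[OF Q]] ..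
  also have "\<dots> = real (wall_degree Q W)"
    using wall_degree_eq[OF Q, of W l] V(1) l W(1) by simp
  finally show ?thesis by simp
qed

lemma higgs_coulomb:
  assumes V: "subspace V" "H \<subseteq> V" "V \<subseteq> amb Q"
  shows "higgs K (\<pi> ` V) = coulomb \<pi> (higgs Q V) H"
proof -
  have mem: "\<pi> x \<in> \<pi> ` V \<longleftrightarrow> x \<in> V" if x: "x \<in> amb Q" for x
  proof
    assume "\<pi> x \<in> \<pi> ` V"
    then obtain v where v: "v \<in> V" "\<pi> x = \<pi> v" by (rule imageE) auto
    have "x - v \<in> V" using ker_diff[OF x _ v(2)] v(1) V(2,3) by blast
    then have "(x - v) + v \<in> V" using v(1) V(1) by (intro subspace_add)
    then show "x \<in> V" by simp
  qed simp
  have "\<pi> ` dlat Q \<inter> \<pi> ` V = \<pi> ` (dlat Q \<inter> V)" using mem dlat_amb by blast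
  moreover have "idx_in K (\<pi> ` V) = idx_in Q V - idx_in (higgs Q V) H"
    using mem tame_wt_amb[OF Q] by (auto simp: idx_in_def)
  ultimately show ?thesis by (simp add: higgs_def coulomb_def)
qed

lemma quotient_higgs:
  assumes V: "weight_supported Q V" "H \<subseteq> V" "V \<subseteq> amb Q"
  shows "relevant_quotient (higgs Q V) H \<pi>"
proof
  show "tame (higgs Q V)" by (rule tame_higgs[OF Q V(1)])
  show "relevant (higgs Q V) H" using relevant_higgs[OF V(2)] rel by blast
  show "realises_quotient (higgs Q V) H \<pi>"
    unfolding realises_quotient_def amb_higgs[OF Q V(1)] using lin ker V(2,3) pi_H by blast
qed

lemma coulomb_good_start:
  assumes c: "good_start Q c"
  shows "good_start K (\<pi> c)"
    and "wall_times K (\<pi> c) = {t \<in> wall_times Q c. H \<subseteq> ray_span Q c t}"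
proof -
  note camb = good_start_amb[OF c]
  let ?V = "\<lambda>t. ray_span Q c t" and ?VK = "\<lambda>t. ray_span K (\<pi> c) t"
  have VK: "if hyperplane Q (?V t) \<and> H \<subseteq> ?V t then hyperplane K (?VK t) else ?VK t = amb K"
    if t: "0 \<le> t" for t
  proof -
    have p: "ray_point Q c t \<in> amb Q" by (rule ray_point_amb[OF Q camb])
    consider "?V t = amb Q" | "hyperplane Q (?V t)" "H \<subseteq> ?V t" | "hyperplane Q (?V t)" "\<not> H \<subseteq> ?V t"
      using c t unfolding good_start_def by blast
    then show ?thesis
    proof cases
      case 1
      then show ?thesis
        using coulomb_chamber[OF p] hyperplane_neq[of Q "amb Q"] unfolding ray_point_coulomb by auto
    next
      case 2
      then show ?thesis
        using coulomb_wall[OF p 2] coulomb_hyperplane[OF 2] unfolding ray_point_coulomb by simp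
    next
      case 3
      then show ?thesis using coulomb_wall_off[OF p 3] unfolding ray_point_coulomb by simp
    qed
  qed
  have "stratum_span K (\<pi> c) = amb K" using coulomb_chamber c unfolding good_start_def by blast
  moreover have "\<pi> c \<in> amb K" using camb unfolding amb_coulomb by blast
  moreover have "?VK t = amb K \<or> hyperplane K (?VK t)" if "0 \<le> t" for t
    using VK[OF that] by (auto split: if_splits)
  ultimately show "good_start K (\<pi> c)" unfolding good_start_def by blast
  have "hyperplane K (?VK t) \<longleftrightarrow> hyperplane Q (?V t) \<and> H \<subseteq> ?V t" if "0 \<le> t" for t
    using VK[OF that] hyperplane_neq[of K "?VK t"] by (auto split: if_splits)
  then show "wall_times K (\<pi> c) = {t \<in> wall_times Q c. H \<subseteq> ray_span Q c t}"
    unfolding wall_times_def by blast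
qed

lemma amb_coulomb_zero_iff: "{0} = amb K \<longleftrightarrow> H = amb Q"
proof
  assume "{0} = amb K"
  then have "\<pi> v = 0" if "v \<in> amb Q" for v using that unfolding amb_coulomb by blast
  then show "H = amb Q" using ker H_amb by blast
next
  assume "H = amb Q"
  then have "\<pi> v = 0" if "v \<in> amb Q" for v using that pi_H by blast
  moreover have "0 \<in> amb Q" by (rule subspace_0[OF subspace_amb])
  ultimately show "{0} = amb K" unfolding amb_coulomb by force
qed

end

section \<open>Projection of runs\<close>

lemma relevant_zero: "relevant Q {0}"
  unfolding relevant_def
proof
  have "wt Q ` idx_in Q {0} \<subseteq> {0}" by (auto simp: idx_in_def)
  then have "span (wt Q ` idx_in Q {0}) \<subseteq> {0}" by (rule span_minimal) (simp add: subspace_def)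
  then show "weight_supported Q {0}" unfolding weight_supported_def using span_zero by blast
  show "\<exists>c. (\<forall>i\<in>idx_in Q {0}. c i > (0::real)) \<and> (\<Sum>i\<in>idx_in Q {0}. c i *\<^sub>R wt Q i) = 0"
    by (intro exI[of _ "\<lambda>_. 1"]) (auto simp: idx_in_def)
qed

text \<open>Deliberately an existence statement: it yields one projected run. Comparison with the
  other runs downstairs is left to \<open>count_zero_unique\<close>, whose proof in turn applies
  this lemma to smaller quotients.\<close>

lemma count_complete_sod_coulomb:
  fixes \<pi> :: "'v::euclidean_space \<Rightarrow> 'w::euclidean_space"
  assumes "complete_sod Q C M" "tame Q" "relevant Q H" "realises_quotient Q H \<pi>"
    and "gkz_chamber (coulomb \<pi> Q H) CH" "\<pi> ` C \<subseteq> CH"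
  shows "\<exists>M'. complete_sod (coulomb \<pi> Q H) CH M' \<and> count M' {0} = count M H"
  using assms
proof (induction arbitrary: CH rule: complete_sod.induct)
  case (sod_empty Q C)
  interpret relevant_quotient Q H \<pi> by unfold_locales (use sod_empty.prems in auto)
  obtain x where x: "x \<in> amb Q" "C = stratum Q x"
    using sod_empty.hyps(1) unfolding gkz_chamber_def by (auto elim: stratumE)
  have xC: "x \<in> C" using stratum_self x by blast
  have "\<pi> x \<in> CH" using xC sod_empty.prems(5) by blast
  then have CH: "CH = stratum K (\<pi> x)" by (rule chamber_of_mem[OF sod_empty.prems(4)])
  have "x \<notin> wcone Q (idx Q)" using xC sod_empty.hyps(2) by blast
  then have "\<pi> x \<notin> wcone K (idx K)"
    using wcone_coulomb_iff[of "idx K" x] x(1) idx_coulomb_Un by simp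
  then have "CH \<inter> wcone K (idx K) = {}" unfolding CH stratum_def by blast
  then have "complete_sod K CH {#}" by (rule complete_sod.sod_empty[OF sod_empty.prems(4)])
  then show ?case by auto
next
  case (sod_cross Q C c Z M)
  interpret relevant_quotient Q H \<pi> by unfold_locales (use sod_cross.prems in auto)
  have c: "good_start Q c" using generic_start_iff[OF Q] sod_cross.hyps by blast
  note camb = good_start_amb[OF c]
  note Kc = coulomb_good_start[OF c]
  note pamb = good_start_amb[OF Kc(1)]
  let ?p = "ray_point Q c"
  let ?W = "\<lambda>t. stratum Q (?p t)" and ?W' = "\<lambda>t. ray_stratum K (\<pi> c) t"
  let ?T = "wall_times K (\<pi> c)"
  have cCH: "\<pi> c \<in> CH" using sod_cross.hyps(3) sod_cross.prems(5) by blast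
  have CH: "CH = stratum K (\<pi> c)" by (rule chamber_of_mem[OF sod_cross.prems(4) cCH])
  have gen: "generic_start K (\<pi> c)"
    using generic_start_iff[OF tame_coulomb sod_cross.prems(4) cCH] Kc(1) by blast
  have "\<pi> c \<in> wcone K (idx K)"
    using wcone_coulomb_iff[of "idx K" c] camb idx_coulomb_Un sod_cross.hyps(2,3) by auto
  then have sub: "CH \<subseteq> wcone K (idx K)" unfolding CH stratum_def by blast
  have step: "\<exists>Z' N. gkz_chamber (higgs K (span (?W' t))) Z' \<and> ?W' t \<subseteq> Z' \<and>
      complete_sod (higgs K (span (?W' t))) Z' N \<and> count N {0} = count (M (?W t)) H \<and>
      wall_degree K (?W' t) = wall_degree Q (?W t)" if t: "t \<in> ?T" for t
  proof -
    have t': "t \<in> wall_times Q c" "H \<subseteq> stratum_span Q (?p t)" using t Kc(2) by blast+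
    note wt = wall_time[OF Q camb t'(1)] and wt' = wall_time[OF tame_coulomb pamb t]
    let ?V = "stratum_span Q (?p t)"
    let ?QV = "higgs Q ?V"
    note Va = stratum_span_subset_amb[of Q "?p t"]
    have spK: "ray_span K (\<pi> c) t = \<pi> ` ?V"
      unfolding ray_point_coulomb by (rule coulomb_wall[OF wt(1,2) t'(2)])
    \<comment> \<open>Identifies the Higgs problem downstairs as a Coulomb problem of
      \<open>?QV\<close>, to which the induction hypothesis for the wall applies.\<close>
    have hk: "higgs K (span (?W' t)) = coulomb \<pi> ?QV H"
      unfolding wt'(3) spK by (rule higgs_coulomb[OF subspace_stratum_span t'(2) Va])
    interpret V: relevant_quotient ?QV H \<pi> by (rule quotient_higgs[OF wt(4) t'(2) Va])
    have W: "?W t \<in> crossed_walls Q c" unfolding crossed_walls_eq[OF Q camb] using t'(1) by blast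
    have h: "gkz_chamber ?QV (Z (?W t))" "?W t \<subseteq> Z (?W t)"
      and IH: "\<And>CH. gkz_chamber (coulomb \<pi> ?QV H) CH \<Longrightarrow> \<pi> ` Z (?W t) \<subseteq> CH \<Longrightarrow>
        \<exists>N. complete_sod (coulomb \<pi> ?QV H) CH N \<and> count N {0} = count (M (?W t)) H"
      using sod_cross.IH[OF W] V.Q V.rel V.real unfolding wt(3) by blast+
    note hw = higgs_wall_chamber[OF Q wt(1,2)]
    have "?p t \<in> Z (?W t)" using h(2) stratum_self[OF wt(1)] by blast
    then have Z: "Z (?W t) = stratum ?QV (?p t)" by (rule chamber_of_mem[OF h(1)])
    let ?Z' = "stratum (coulomb \<pi> ?QV H) (\<pi> (?p t))"
    have "\<pi> (?p t) \<in> amb (coulomb \<pi> ?QV H)" using hw(1) unfolding V.amb_coulomb by blast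
    then have ch: "gkz_chamber (coulomb \<pi> ?QV H) ?Z'"
      using chamber_stratum_iff[OF tame_finite[OF V.tame_coulomb]] V.coulomb_chamber[OF hw(1,2)] by blast
    have "\<pi> ` Z (?W t) \<subseteq> ?Z'" unfolding Z using V.coulomb_stratum_image[OF _ hw(1)] by blast
    then obtain N where N: "complete_sod (coulomb \<pi> ?QV H) ?Z' N" "count N {0} = count (M (?W t)) H"
      using IH[OF ch] by blast
    have "?W' t \<subseteq> ?Z'"
      using higgs_wall_chamber(3)[OF tame_coulomb wt'(1,2)] hk
      unfolding wt'(3) unfolding ray_point_coulomb by simp
    moreover obtain l where "conormal Q ?V l" using wall_conormal[OF Q wt(1,2)] by blast
    then have "wall_degree K (?W' t) = wall_degree Q (?W t)"
      by (rule coulomb_wall_degree[OF wt(2) t'(2)]) (simp_all only: wt(3) wt'(3) spK)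
    ultimately show ?thesis using ch N unfolding hk by blast
  qed
  then obtain Z' N where ZN: "\<And>t. t \<in> ?T \<Longrightarrow> gkz_chamber (higgs K (span (?W' t))) (Z' t) \<and> ?W' t \<subseteq> Z' t \<and>
      complete_sod (higgs K (span (?W' t))) (Z' t) (N t) \<and> count (N t) {0} = count (M (?W t)) H \<and>
      wall_degree K (?W' t) = wall_degree Q (?W t)"
    by metis
  \<comment> \<open>The subruns were chosen per crossing time, but a run needs them per wall; a good
    ray meets each wall only once.\<close>
  define time where "time = inv_into ?T ?W'"
  have time: "time (?W' t) = t" if "t \<in> ?T" for t
    unfolding time_def by (rule inv_into_f_f[OF inj_on_wall_times(1)[OF tame_coulomb Kc(1)] that])
  have run: "gkz_chamber (higgs K (span W)) (Z' (time W)) \<and> W \<subseteq> Z' (time W) \<and>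
      complete_sod (higgs K (span W)) (Z' (time W)) (N (time W))"
    if W: "W \<in> crossed_walls K (\<pi> c)" for W
  proof -
    obtain t where t: "t \<in> ?T" "W = ?W' t" by (rule crossed_wallE[OF tame_coulomb pamb W]) (rule that)
    show ?thesis unfolding t(2) time[OF t(1)] using ZN[OF t(1)] by blast
  qed
  let ?M' = "(if relevant K (amb K) then {#amb K#} else {#}) +
    (\<Sum>W\<in>crossed_walls K (\<pi> c). repeat_mset (wall_degree K W) (N (time W)))"
  have "complete_sod K CH ?M'" by (rule complete_sod.sod_cross[OF sod_cross.prems(4) sub cCH gen run])
  moreover have "count ?M' {0} = count ((if relevant Q (amb Q) then {#amb Q#} else {#}) +
      (\<Sum>W\<in>crossed_walls Q c. repeat_mset (wall_degree Q W) (M W))) H"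
  proof -
    have "count ?M' {0} = (if {0} = amb K then 1 else 0) +
        (\<Sum>W | W \<in> crossed_walls K (\<pi> c) \<and> {0} \<subseteq> span W. wall_degree K W * count (N (time W)) {0})"
      by (rule count_sod_cross[OF relevant_zero, of K "\<pi> c" "\<lambda>W. Z' (time W)"])
        (use run finite_crossed_walls[OF tame_coulomb Kc(1)] in auto)
    also have "{W. W \<in> crossed_walls K (\<pi> c) \<and> {0} \<subseteq> span W} = crossed_walls K (\<pi> c)"
      using span_zero by blast
    also have "(\<Sum>W\<in>crossed_walls K (\<pi> c). wall_degree K W * count (N (time W)) {0})
        = (\<Sum>t\<in>?T. wall_degree K (?W' t) * count (N (time (?W' t))) {0})"
      by (rule sum_crossed_walls[OF tame_coulomb Kc(1)])
    also have "\<dots> = (\<Sum>t\<in>?T. wall_degree Q (?W t) * count (M (?W t)) H)"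
      by (intro sum.cong refl) (simp add: time ZN)
    \<comment> \<open>The times downstairs are the times upstairs at walls whose span contains
      \<open>H\<close>; the terms at the other times are set to 0.\<close>
    also have "\<dots> = (\<Sum>t\<in>wall_times Q c. if H \<subseteq> span (?W t) then wall_degree Q (?W t) * count (M (?W t)) H else 0)"
      unfolding Kc(2) using wall_time(3)[OF Q camb]
      by (subst sum.inter_filter[OF inj_on_wall_times(2)[OF Q c]]) (intro sum.cong refl, simp)
    also have "\<dots> = (\<Sum>W\<in>crossed_walls Q c. if H \<subseteq> span W then wall_degree Q W * count (M W) H else 0)"
      by (rule sum_crossed_walls[OF Q c, symmetric])
    also have "\<dots> = (\<Sum>W | W \<in> crossed_walls Q c \<and> H \<subseteq> span W. wall_degree Q W * count (M W) H)"
      by (rule sum.inter_filter[OF finite_crossed_walls[OF Q c], symmetric])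
    also have "(if {0} = amb K then 1 else 0) + \<dots> = count ((if relevant Q (amb Q) then {#amb Q#} else {#}) +
      (\<Sum>W\<in>crossed_walls Q c. repeat_mset (wall_degree Q W) (M W))) H"
      unfolding amb_coulomb_zero_iff
      by (rule count_sod_cross[OF rel, symmetric, of c Z M])
        (use sod_cross.IH finite_crossed_walls[OF Q c] in auto)
    finally show ?thesis .
  qed
  ultimately show ?case by blast
qed

section \<open>Independence of choices\<close>

text \<open>In the zero space the ray rests at the origin, the empty set is the only basis because
  all weights vanish, and its box is the single point 0.\<close>

lemma min_chi_higgs_zero:
  assumes Q: "tame Q"
  shows "min_chi (higgs Q {0}) = 1"
proof -
  let ?O = "higgs Q {0}"
  have sup: "weight_supported Q {0}" using relevant_zero unfolding relevant_def by blast
  note O = tame_higgs[OF Q sup] and amb = amb_higgs[OF Q sup]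
  have "stratum_span ?O x = amb ?O" for x
    using stratum_span_subset_amb[of ?O x] subspace_0[OF subspace_stratum_span, of ?O x] unfolding amb by blast
  then have good: "good_start ?O 0" unfolding good_start_def amb by blast
  have wt0: "wt Q i = 0" if "i \<in> idx ?O" for i using that by (simp add: idx_in_def)
  have ray: "ray_point ?O 0 R = 0" for R using wt0 by (simp add: ray_point_def det_wt_def)
  have "bases ?O = {{}}"
  proof
    show "bases ?O \<subseteq> {{}}"
    proof
      fix S assume S: "S \<in> bases ?O"
      have "0 \<notin> wt Q ` S" using S dependent_zero unfolding bases_def wt_free_def by auto
      then have "S = {}" using S wt0 unfolding bases_def by force
      then show "S \<in> {{}}" by simp
    qed
    show "{{}} \<subseteq> bases ?O" by (simp add: bases_def wt_free_def amb independent_empty)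
  qed
  moreover have "box_index ?O {} = 1"
  proof -
    have "{x \<in> dlat ?O. \<exists>t. (\<forall>i\<in>{}. 0 \<le> t i \<and> t i < (1::real)) \<and> x = (\<Sum>i\<in>{}. t i *\<^sub>R wt ?O i)} = {0}"
      using tame_zero[OF O] by auto
    then show ?thesis unfolding box_index_def by (simp only: card.empty card_insert_disjoint) simp
  qed
  ultimately have "chi ?O 0 = 1" using zero_in_wcone[of ?O "{}"] by (simp add: chi_sum[OF O])
  then have "\<forall>\<^sub>F R::real in at_top. min_chi ?O = 1"
    using chi_ray_far[OF O good] unfolding ray by (auto elim!: eventually_mono)
  then show ?thesis by simp
qed

text \<open>The quotient is realised by a projection inside the same type, as an induction over
  problems of a fixed type requires.\<close>

lemma exists_quotient:
  fixes Q :: "('i, 'v::euclidean_space) toric_git"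
  assumes H: "subspace H" "H \<subseteq> amb Q" "H \<noteq> {0}"
  obtains \<pi> :: "'v \<Rightarrow> 'v" where "realises_quotient Q H \<pi>" "dim (\<pi> ` amb Q) < dim (amb Q)"
proof -
  obtain B where B: "B \<subseteq> H" "independent B" "H \<subseteq> span B" using maximal_independent_subset by blast
  have spB: "span B = H" using B(1,3) H(1) by (meson span_minimal subset_antisym)
  obtain D where D: "B \<subseteq> D" "D \<subseteq> amb Q" "independent D" "amb Q \<subseteq> span D"
    using maximal_independent_subset_extend[of B "amb Q"] B(1,2) H(2) by blast
  have spD: "span D = amb Q" using D(2,4) by (meson span_minimal subset_antisym subspace_amb)
  obtain \<pi> :: "'v \<Rightarrow> 'v" where lin: "linear \<pi>" and pi: "\<And>x. x \<in> D \<Longrightarrow> \<pi> x = (if x \<in> B then 0 else x)"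
    using linear_independent_extend[OF D(3), of "\<lambda>x. if x \<in> B then 0 else x"] by metis
  have pB: "\<pi> x = 0" if "x \<in> span B" for x
  proof (rule linear_eq_0_on_span[OF lin _ that])
    fix b assume "b \<in> B"
    then show "\<pi> b = 0" using pi[of b] D(1) by auto
  qed
  have pD: "\<pi> x = x" if "x \<in> span (D - B)" for x
  proof (rule linear_eq_on_span[OF lin linear_ident _ that])
    fix b assume "b \<in> D - B"
    then show "\<pi> b = b" using pi[of b] by auto
  qed
  have split: "\<exists>a b. a \<in> span B \<and> b \<in> span (D - B) \<and> x = a + b" if "x \<in> amb Q" for x
  proof -
    have "B \<union> (D - B) = D" using D(1) by blast
    then show ?thesis using that spD span_Un[of B "D - B"] by auto
  qed
  have "{v \<in> amb Q. \<pi> v = 0} = H"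
  proof
    show "{v \<in> amb Q. \<pi> v = 0} \<subseteq> H"
    proof clarify
      fix v assume v: "v \<in> amb Q" "\<pi> v = 0"
      obtain a b where ab: "a \<in> span B" "b \<in> span (D - B)" "v = a + b" using split[OF v(1)] by blast
      then have "b = 0" using v(2) pB pD by (simp add: linear_add[OF lin])
      then show "v \<in> H" using ab spB by simp
    qed
  qed (use H(2) pB spB in auto)
  moreover have "dim (\<pi> ` amb Q) < dim (amb Q)"
  proof -
    have "\<pi> ` amb Q \<subseteq> span (D - B)"
    proof (rule image_subsetI)
      fix x assume "x \<in> amb Q"
      then obtain a b where ab: "a \<in> span B" "b \<in> span (D - B)" "x = a + b" using split by blast
      then show "\<pi> x \<in> span (D - B)" using pB pD by (simp add: linear_add[OF lin])
    qed
    then have "dim (\<pi> ` amb Q) \<le> card (D - B)"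
      using independent_imp_finite[OF D(3)] by (intro dim_le_card) auto
    also have "\<dots> < card D"
    proof -
      have "B \<noteq> {}" using spB H(3) by auto
      then show ?thesis using D(1) independent_imp_finite[OF D(3)] by (intro psubset_card_mono) auto
    qed
    also have "card D = dim (amb Q)"
      using dim_eq_card_independent[OF D(3)] unfolding spD[symmetric] dim_span by simp
    finally show ?thesis .
  qed
  ultimately show ?thesis using that lin unfolding realises_quotient_def by blast
qed

lemma exists_coulomb_chamber:
  assumes "relevant_quotient Q H \<pi>" "gkz_chamber Q C"
  obtains CH where "gkz_chamber (coulomb \<pi> Q H) CH" "\<pi> ` C \<subseteq> CH"
proof -
  interpret relevant_quotient Q H \<pi> by fact
  obtain x where x: "x \<in> amb Q" "C = stratum Q x"
    using assms(2) unfolding gkz_chamber_def by (auto elim: stratumE)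
  have xQ: "stratum_span Q x = amb Q" using assms(2) chamber_stratum_iff[OF tame_finite[OF Q] x(1)] x(2) by simp
  have "\<pi> x \<in> amb K" using x(1) by (simp add: amb_coulomb)
  then have "gkz_chamber K (stratum K (\<pi> x))"
    using chamber_stratum_iff[OF tame_finite[OF tame_coulomb]] coulomb_chamber[OF x(1) xQ] by blast
  moreover have "\<pi> ` C \<subseteq> stratum K (\<pi> x)" using coulomb_stratum_image x by blast
  ultimately show ?thesis using that by blast
qed

text \<open>Restricting to the label {0} makes the induction close: any other label becomes {0} in a
  quotient of smaller dimension, and chi at one point of \<open>C\<close> gives the last
  equation.\<close>

lemma count_zero_unique:
  fixes Q :: "('i, 'v::euclidean_space) toric_git"
  assumes "tame Q" "complete_sod Q C M" "complete_sod Q C M'"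
  shows "count M {0} = count M' {0}"
  using assms
proof (induction "dim (amb Q)" arbitrary: Q C M M' rule: less_induct)
  case less
  note Q = less.prems(1)
  have C: "gkz_chamber Q C" by (rule complete_sod_chamber[OF less.prems(2)])
  have other: "count M H = count M' H" if H: "H \<noteq> {0}" for H
  proof (cases "H \<in># M \<or> H \<in># M'")
    case False
    then show ?thesis by (simp add: not_in_iff)
  next
    case True
    then have rel: "relevant Q H" and Ha: "H \<subseteq> amb Q"
      using sod_labels_relevant[OF _ Q] complete_sod_labels less.prems by blast+
    have "subspace H" using rel weight_supported_subspace unfolding relevant_def by blast
    then obtain \<pi> :: "'v \<Rightarrow> 'v" where pi: "realises_quotient Q H \<pi>" "dim (\<pi> ` amb Q) < dim (amb Q)"
      using exists_quotient[OF _ Ha H] by blast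
    interpret relevant_quotient Q H \<pi> by unfold_locales (rule Q rel pi(1))+
    obtain CH where CH: "gkz_chamber K CH" "\<pi> ` C \<subseteq> CH"
      by (rule exists_coulomb_chamber[OF relevant_quotient_axioms C]) (rule that)
    obtain N where N: "complete_sod K CH N" "count N {0} = count M H"
      using count_complete_sod_coulomb[OF less.prems(2) Q rel pi(1) CH] by blast
    obtain N' where N': "complete_sod K CH N'" "count N' {0} = count M' H"
      using count_complete_sod_coulomb[OF less.prems(3) Q rel pi(1) CH] by blast
    have "count N {0} = count N' {0}"
      using less.hyps[OF _ tame_coulomb N(1) N'(1)] pi(2) unfolding amb_coulomb by blast
    then show ?thesis using N(2) N'(2) by simp
  qed
  let ?f = "\<lambda>H. min_chi (higgs Q H)"
  \<comment> \<open>The unknown count enters with coefficient 1 by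
    \<open>min_chi_higgs_zero\<close>, so equality of the two sums can be solved for it.\<close>
  have split: "(\<Sum>H\<in>#A. ?f H) = real (count A {0}) + (\<Sum>H\<in>#filter_mset (\<lambda>H. H \<noteq> {0}) A. ?f H)" for A
  proof -
    have "A = replicate_mset (count A {0}) {0} + filter_mset (\<lambda>H. H \<noteq> {0}) A"
      using multiset_partition[of A "\<lambda>H. H = {0}"] by (simp add: filter_eq_replicate_mset)
    then have "(\<Sum>H\<in>#A. ?f H) = (\<Sum>H\<in>#replicate_mset (count A {0}) {0}. ?f H) +
        (\<Sum>H\<in>#filter_mset (\<lambda>H. H \<noteq> {0}) A. ?f H)"
      by (metis image_mset_union sum_mset.union)
    then show ?thesis by (simp add: min_chi_higgs_zero[OF Q])
  qed
  have "filter_mset (\<lambda>H. H \<noteq> {0}) M = filter_mset (\<lambda>H. H \<noteq> {0}) M'"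
    by (rule multiset_eqI) (simp add: other)
  moreover obtain x where x: "x \<in> C"
    using exists_good_start[OF Q C] by blast
  have "(\<Sum>H\<in>#M. ?f H) = (\<Sum>H\<in>#M'. ?f H)"
    using chi_complete_sod[OF less.prems(2) Q x] chi_complete_sod[OF less.prems(3) Q x] by simp
  ultimately show ?case unfolding split[of M] split[of M'] by simp
qed

theorem theorem1p2:
  fixes Q :: "('i, 'v::euclidean_space) toric_git"
    and C H :: "'v set"
    and \<pi> :: "'v \<Rightarrow> 'w::euclidean_space"
    and CH :: "'w set"
  assumes "toric_git_problem Q"
    and "gkz_chamber Q C"
    and "relevant Q H"
    and "realises_quotient Q H \<pi>"
    and "gkz_chamber (coulomb \<pi> Q H) CH" and "\<pi> ` C \<subseteq> CH"
  shows "sod_mult Q C H = sod_mult (coulomb \<pi> Q H) CH {0}"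
proof -
  have Q: "tame Q" by (rule tame_of_problem[OF assms(1)])
  interpret relevant_quotient Q H \<pi> by unfold_locales (rule Q assms)+
  obtain M where M: "complete_sod Q C M" using exists_complete_sod[OF Q assms(2)] by blast
  obtain N where N: "complete_sod K CH N" using exists_complete_sod[OF tame_coulomb assms(5)] by blast
  have unique: "count N' {0} = count N {0}" if "complete_sod K CH N'" for N'
    by (rule count_zero_unique[OF tame_coulomb that N])
  \<comment> \<open>Every run for \<open>Q\<close>, not just \<open>M\<close>, projects to some run
    for \<open>K\<close>; uniqueness there identifies its count with that of \<open>N\<close>, which
    also makes the left-hand description well defined.\<close>
  have transfer: "count M' H = count N {0}" if "complete_sod Q C M'" for M'
    using count_complete_sod_coulomb[OF that Q rel real assms(5,6)] unique by metis
  have "sod_mult Q C H = count N {0}"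
    unfolding sod_mult_def by (rule the_equality) (use M transfer in metis)+
  moreover have "sod_mult K CH {0} = count N {0}"
    unfolding sod_mult_def by (rule the_equality) (use N unique in metis)+
  ultimately show ?thesis by simp
qed

end
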